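(* Let $s\in\mathbb{Z}$, $s\ne0$, and let $f=\Re(X)$ be the real field of spin $s$ on $SO(3)$ with coefficients $(c_l)_{l\ge|s|}$ and circular covariance function $k$ (see context), normalized so that $1=\mathbb{E}[|f(p)|^2]=\sum_{l\ge|s|}\frac{c_l^2}{2}=\frac{k(0)}2$; set $\xi^2=\sum_{l\ge|s|}\frac{c_l^2}{2}\frac{l(l+1)-s^2}{2}=-\frac{k''(0)}{2}$. Then $f$ is a smooth Gaussian field on $SO(3)$. The Gram matrix of the Adler–Taylor metric $g^f_p(v,w)=\mathbb{E}\{d_pf(v)d_pf(w)\}$ at a point $p=R(\varphi,\theta,\psi)$, in the Euler angle coordinates $(\varphi,\theta,\psi)$, is $$\Sigma_{(\xi,s)}(\theta)=\begin{pmatrix} \xi^2\sin^2\theta+s^2\cos^2\theta & 0 & s^2\cos\theta \\ 0 & \xi^2 & 0 \\ s^2\cos\theta & 0 & s^2 \end{pmatrix}.$$ The standard metric $g$ on $SO(3)$ has Gram matrix $\Sigma_{(1,1)}(\theta)$, so for all $p\in SO(3)$ the eigenvalues of $g^f_p$ with respect to $g_p$ are $$a_1(p),a_2(p),a_3(p)=\xi^2,\xi^2,s^2.$$ Moreover, the scalar curvature of the metric $g^f$ is constant and equals $$\mathrm{Scal}^f=\frac{2}{\xi^2}-\frac{s^2}{2\xi^4}.$$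
   Context: Metric on $SO(3)$: the standard metric $g$ is the one induced by the inclusion $SO(3)\subset\mathbb{R}^{3\times3}$ with scalar product $\langle A,B\rangle=\frac12\mathrm{tr}(A^TB)$. Euler angles: $R(\varphi,\theta,\psi)=R_3(\varphi)R_2(\theta)R_3(\psi)$, where $R_3(\varphi)$ is the rotation by $\varphi$ about the third axis (rows $(\cos\varphi,-\sin\varphi,0),(\sin\varphi,\cos\varphi,0),(0,0,1)$) and $R_2(\theta)$ is the rotation by $\theta$ about the second axis (rows $(\cos\theta,0,\sin\theta),(0,1,0),(-\sin\theta,0,\cos\theta)$). Restricted to $(-\pi,\pi)\times(0,\pi)\times(-\pi,\pi)$, $R$ is the inverse of a smooth chart with full-measure domain. Wigner functions: for $l\in\mathbb{N}$, $D^l=(D^l_{m,n})_{-l\le m,n\le l}:SO(3)\to U(2l+1)$ is the (continuous) irreducible unitary representation of dimension $2l+1$, in the basis for which $D^l_{m,n}(R_3(\varphi)pR_3(\psi))=e^{-im\varphi}D^l_{m,n}(p)e^{-in\psi}$ (standard Wigner $D$-matrices), and $d^l_{m,n}(\theta)=D^l_{m,n}(R_2(\theta))$. Spin field: given real constants $c_l>0$, $l\ge|s|$, set $X=\sum_{l=|s|}^\infty c_l\sum_{m=-l}^l\gamma^l_{m,s}D^l_{m,s}$ and $f=\Re(X)$, where the $\gamma^l_{m,s}$ are i.i.d. complex Gaussian with $\Re\gamma^l_{m,s},\Im\gamma^l_{m,s}\sim\mathcal{N}(0,\frac12)$ independent. The circular covariance function is $k(\theta)=\sum_{l=|s|}^\infty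 c_l^2d^l_{s,s}(\theta)$. Standing assumption: $(c_l)$ decays fast enough that this series converges in the $C^\infty(\mathbb{R})$ topology, and $f$ is almost surely a $C^\infty$ function on $SO(3)$. The eigenvalues of $g^f_p$ with respect to $g_p$ are the eigenvalues of the matrix of $g^f_p$ in a $g_p$-orthonormal basis. *)

theory Defs
  imports "HOL-Probability.Probability"
begin

section \<open>Smooth functions\<close>

fun Ck_on :: "nat \<Rightarrow> 'a::real_normed_vector set \<Rightarrow> ('a \<Rightarrow> 'b::real_normed_vector) \<Rightarrow> bool" where
  "Ck_on 0 U f \<longleftrightarrow> continuous_on U f"
| "Ck_on (Suc n) U f \<longleftrightarrow> (\<forall>x\<in>U. f differentiable (at x))
     \<and> (\<forall>v. Ck_on n U (\<lambda>x. frechet_derivative f (at x) v))"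

text \<open>Only meant for open \<open>U\<close>, since the derivatives are two-sided.\<close>

definition smooth_on_open ::
    "'a::real_normed_vector set \<Rightarrow> ('a \<Rightarrow> 'b::real_normed_vector) \<Rightarrow> bool" where
  "smooth_on_open U f \<longleftrightarrow> (\<forall>n. Ck_on n U f)"

text \<open>A function on an arbitrary subset of a normed space, in particular on an embedded
  submanifold, is smooth if it locally extends to a smooth function of the ambient space.\<close>

definition smooth_on_subset ::
    "'a::real_normed_vector set \<Rightarrow> ('a \<Rightarrow> 'b::real_normed_vector) \<Rightarrow> bool" where
  "smooth_on_subset S f \<longleftrightarrow>
     (\<forall>p\<in>S. \<exists>U F. open U \<and> p \<in> U \<and> smooth_on_open U F \<and> (\<forall>q\<in>U \<inter> S. F q = f q))"

definition vderiv :: "(real \<Rightarrow> 'b::real_normed_vector) \<Rightarrow> real \<Rightarrow> 'b" where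
  "vderiv f t = vector_derivative f (at t)"

definition converges_Cinf ::
    "(nat \<Rightarrow> real \<Rightarrow> 'b::real_normed_vector) \<Rightarrow> (real \<Rightarrow> 'b) \<Rightarrow> bool" where
  "converges_Cinf F g \<longleftrightarrow> (\<forall>n. smooth_on_open UNIV (F n)) \<and> smooth_on_open UNIV g
     \<and> (\<forall>j K. compact K \<longrightarrow>
          uniform_limit K (\<lambda>n. (vderiv ^^ j) (F n)) ((vderiv ^^ j) g) sequentially)"


section \<open>The rotation group and Euler angles\<close>

definition SO3 :: "(real^3^3) set" where
  "SO3 = {p. rotation_matrix p}"

definition R3 :: "real \<Rightarrow> real^3^3" where
  "R3 a = vector [vector [cos a, - sin a, 0], vector [sin a, cos a, 0], vector [0, 0, 1]]"

definition R2 :: "real \<Rightarrow> real^3^3" where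
  "R2 a = vector [vector [cos a, 0, sin a], vector [0, 1, 0], vector [- sin a, 0, cos a]]"

text \<open>The coordinates are ordered as \<open>(\<phi>, \<theta>, \<psi>)\<close>.\<close>

definition euler :: "real^3 \<Rightarrow> real^3^3" where
  "euler x = R3 (x$1) ** R2 (x$2) ** R3 (x$3)"

definition euler_domain :: "(real^3) set" where
  "euler_domain = {x. x$1 \<in> {-pi<..<pi} \<and> x$2 \<in> {0<..<pi} \<and> x$3 \<in> {-pi<..<pi}}"

text \<open>Tangent vectors at \<open>p\<close> are the velocities at time 0 of curves in \<^term>\<open>SO3\<close> through \<open>p\<close>,
  viewed as elements of the ambient space of matrices.\<close>

definition tangent_SO3 :: "real^3^3 \<Rightarrow> (real^3^3) set" where
  "tangent_SO3 p = {v. \<exists>c::real \<Rightarrow> real^3^3. (\<forall>t. c t \<in> SO3) \<and> c 0 = p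
     \<and> smooth_on_open UNIV c \<and> (c has_vector_derivative v) (at 0)}"

text \<open>Derivatives within \<^term>\<open>SO3\<close> are not unique as linear maps on the ambient space, but any two
  of them agree on tangent vectors; this is to be applied to tangent vectors only.\<close>

definition diff_SO3 :: "(real^3^3 \<Rightarrow> real) \<Rightarrow> real^3^3 \<Rightarrow> real^3^3 \<Rightarrow> real" where
  "diff_SO3 f p v = frechet_derivative f (at p within SO3) v"


section \<open>Metrics on the rotation group\<close>

text \<open>A metric maps a point \<open>p\<close> and two tangent vectors at \<open>p\<close> to a real number.\<close>

type_synonym SO3_metric = "real^3^3 \<Rightarrow> real^3^3 \<Rightarrow> real^3^3 \<Rightarrow> real"

definition standard_metric :: SO3_metric where
  "standard_metric p v w = trace (transpose v ** w) / 2"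

text \<open>The inverses of the charts of \<^term>\<open>SO3\<close>.  Openness of the image and continuity of the
  inverse are automatic because \<^term>\<open>SO3\<close> has dimension 3.\<close>

definition local_param :: "(real^3) set \<Rightarrow> (real^3 \<Rightarrow> real^3^3) \<Rightarrow> bool" where
  "local_param U \<Psi> \<longleftrightarrow> open U \<and> smooth_on_open U \<Psi> \<and> \<Psi> ` U \<subseteq> SO3 \<and> inj_on \<Psi> U
     \<and> (\<forall>x\<in>U. inj (frechet_derivative \<Psi> (at x)))"

definition partial :: "3 \<Rightarrow> (real^3 \<Rightarrow> 'b::real_normed_vector) \<Rightarrow> real^3 \<Rightarrow> 'b" where
  "partial i F x = frechet_derivative F (at x) (axis i 1)"

definition gram :: "SO3_metric \<Rightarrow> (real^3 \<Rightarrow> real^3^3) \<Rightarrow> real^3 \<Rightarrow> real^3^3" where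
  "gram h \<Psi> x = (\<chi> i j. h (\<Psi> x) (partial i \<Psi> x) (partial j \<Psi> x))"

definition christoffel :: "(real^3 \<Rightarrow> real^3^3) \<Rightarrow> 3 \<Rightarrow> 3 \<Rightarrow> 3 \<Rightarrow> real^3 \<Rightarrow> real" where
  "christoffel G k i j x = (\<Sum>m\<in>UNIV. matrix_inv (G x) $ k $ m *
     (partial i (\<lambda>y. G y $ m $ j) x + partial j (\<lambda>y. G y $ m $ i) x
       - partial m (\<lambda>y. G y $ i $ j) x)) / 2"

definition ricci :: "(real^3 \<Rightarrow> real^3^3) \<Rightarrow> 3 \<Rightarrow> 3 \<Rightarrow> real^3 \<Rightarrow> real" where
  "ricci G i j x = (\<Sum>k\<in>UNIV.
       partial k (christoffel G k i j) x - partial j (christoffel G k i k) x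
     + (\<Sum>m\<in>UNIV. christoffel G k k m x * christoffel G m i j x
                  - christoffel G k j m x * christoffel G m i k x))"

text \<open>With these sign conventions the round spheres have positive scalar curvature.\<close>

definition scalar_curvature_coord :: "(real^3 \<Rightarrow> real^3^3) \<Rightarrow> real^3 \<Rightarrow> real" where
  "scalar_curvature_coord G x = (\<Sum>i\<in>UNIV. \<Sum>j\<in>UNIV. matrix_inv (G x) $ i $ j * ricci G i j x)"

definition scalar_curvature_at :: "SO3_metric \<Rightarrow> real^3^3 \<Rightarrow> real \<Rightarrow> bool" where
  "scalar_curvature_at h p \<kappa> \<longleftrightarrow> (\<forall>U \<Psi> x. local_param U \<Psi> \<and> x \<in> U \<and> \<Psi> x = p \<longrightarrow>
     scalar_curvature_coord (gram h \<Psi>) x = \<kappa>)"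

definition orthonormal_basis_at :: "SO3_metric \<Rightarrow> real^3^3 \<Rightarrow> (3 \<Rightarrow> real^3^3) \<Rightarrow> bool" where
  "orthonormal_basis_at h p e \<longleftrightarrow> span (range e) = tangent_SO3 p
     \<and> (\<forall>i j. h p (e i) (e j) = (if i = j then 1 else 0))"

text \<open>Eigenvalues are counted with algebraic multiplicity: the characteristic polynomial of \<open>A\<close> is
  \<open>(t - a\<^sub>1) (t - a\<^sub>2) (t - a\<^sub>3)\<close>.\<close>

definition has_eigenvalues :: "real^3^3 \<Rightarrow> real \<Rightarrow> real \<Rightarrow> real \<Rightarrow> bool" where
  "has_eigenvalues A a1 a2 a3 \<longleftrightarrow> (\<forall>t. det (mat t - A) = (t - a1) * (t - a2) * (t - a3))"

definition eigenvalues_wrt ::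
    "SO3_metric \<Rightarrow> SO3_metric \<Rightarrow> real^3^3 \<Rightarrow> real \<Rightarrow> real \<Rightarrow> real \<Rightarrow> bool" where
  "eigenvalues_wrt h g p a1 a2 a3 \<longleftrightarrow>
     (\<exists>e. orthonormal_basis_at g p e) \<and>
     (\<forall>e. orthonormal_basis_at g p e \<longrightarrow>
        has_eigenvalues (\<chi> i j. h p (e i) (e j)) a1 a2 a3)"

definition Sigma_mat :: "real \<Rightarrow> real \<Rightarrow> real \<Rightarrow> real^3^3" where
  "Sigma_mat \<xi> s \<theta> = vector
     [vector [\<xi>\<^sup>2 * (sin \<theta>)\<^sup>2 + s\<^sup>2 * (cos \<theta>)\<^sup>2, 0, s\<^sup>2 * cos \<theta>],
      vector [0, \<xi>\<^sup>2, 0],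
      vector [s\<^sup>2 * cos \<theta>, 0, s\<^sup>2]]"


section \<open>Wigner matrices\<close>

definition weights :: "nat \<Rightarrow> int set" where
  "weights l = {- int l..int l}"

text \<open>A matrix-valued function on \<^term>\<open>SO3\<close> with rows and columns indexed by a finite set \<open>I\<close> is
  given by its entries \<open>\<rho> m n :: real^3^3 \<Rightarrow> complex\<close>, relevant for \<open>m, n \<in> I\<close> only.\<close>

definition unitary_rep_SO3 :: "'i set \<Rightarrow> ('i \<Rightarrow> 'i \<Rightarrow> real^3^3 \<Rightarrow> complex) \<Rightarrow> bool" where
  "unitary_rep_SO3 I \<rho> \<longleftrightarrow>
     (\<forall>m\<in>I. \<forall>n\<in>I. continuous_on SO3 (\<rho> m n)) \<and>
     (\<forall>p\<in>SO3. \<forall>q\<in>SO3. \<forall>m\<in>I. \<forall>n\<in>I. \<rho> m n (p ** q) = (\<Sum>k\<in>I. \<rho> m k p * \<rho> k n q)) \<and>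
     (\<forall>p\<in>SO3. \<forall>m\<in>I. \<forall>n\<in>I. (\<Sum>k\<in>I. cnj (\<rho> k m p) * \<rho> k n p) = (if m = n then 1 else 0))"

definition coord_space :: "'i set \<Rightarrow> ('i \<Rightarrow> complex) set" where
  "coord_space I = {v. \<forall>m. m \<notin> I \<longrightarrow> v m = 0}"

definition complex_subspace :: "('i \<Rightarrow> complex) set \<Rightarrow> bool" where
  "complex_subspace V \<longleftrightarrow> (\<lambda>_. 0) \<in> V \<and> (\<forall>v\<in>V. \<forall>w\<in>V. (\<lambda>m. v m + w m) \<in> V)
     \<and> (\<forall>a. \<forall>v\<in>V. (\<lambda>m. a * v m) \<in> V)"

definition irreducible_SO3 :: "'i set \<Rightarrow> ('i \<Rightarrow> 'i \<Rightarrow> real^3^3 \<Rightarrow> complex) \<Rightarrow> bool" where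
  "irreducible_SO3 I \<rho> \<longleftrightarrow> (\<forall>V. V \<subseteq> coord_space I \<and> complex_subspace V \<and>
     (\<forall>p\<in>SO3. \<forall>v\<in>V. (\<lambda>m. if m \<in> I then \<Sum>n\<in>I. \<rho> m n p * v n else 0) \<in> V) \<longrightarrow>
     V = {\<lambda>_. 0} \<or> V = coord_space I)"

text \<open>The conditions determine each \<^term>\<open>D l\<close> up to conjugation by a constant diagonal unitary
  matrix, that is, up to the phases of the basis vectors; the diagonal entries are determined.
  The standard matrices are the choice of phases that makes all \<^term>\<open>D l m n (R2 \<theta>)\<close> real with the
  usual signs.\<close>

definition wigner_matrices :: "(nat \<Rightarrow> int \<Rightarrow> int \<Rightarrow> real^3^3 \<Rightarrow> complex) \<Rightarrow> bool" where
  "wigner_matrices D \<longleftrightarrow> (\<forall>l.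
     unitary_rep_SO3 (weights l) (D l) \<and> irreducible_SO3 (weights l) (D l) \<and>
     (\<forall>m\<in>weights l. \<forall>n\<in>weights l. \<forall>p\<in>SO3. \<forall>\<phi> \<psi>.
        D l m n (R3 \<phi> ** p ** R3 \<psi>) = cis (- of_int m * \<phi>) * D l m n p * cis (- of_int n * \<psi>)))"

definition wigner_d ::
    "(nat \<Rightarrow> int \<Rightarrow> int \<Rightarrow> real^3^3 \<Rightarrow> complex) \<Rightarrow> nat \<Rightarrow> int \<Rightarrow> int \<Rightarrow> real \<Rightarrow> complex" where
  "wigner_d D l m n \<theta> = D l m n (R2 \<theta>)"


section \<open>Gaussian variables and fields\<close>

text \<open>Constants are Gaussian, with variance 0.\<close>

definition gaussian_rv :: "'w measure \<Rightarrow> ('w \<Rightarrow> real) \<Rightarrow> bool" where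
  "gaussian_rv M Y \<longleftrightarrow> Y \<in> borel_measurable M \<and>
     (\<exists>\<mu>. (AE \<omega> in M. Y \<omega> = \<mu>) \<or>
        (\<exists>\<sigma>>0. distributed M lborel Y (\<lambda>x. ennreal (normal_density \<mu> \<sigma> x))))"

text \<open>The finite-dimensional distributions are Gaussian: every linear combination of values is.\<close>

definition smooth_gaussian_field_SO3 ::
    "'w measure \<Rightarrow> ('w \<Rightarrow> real^3^3 \<Rightarrow> real) \<Rightarrow> bool" where
  "smooth_gaussian_field_SO3 M f \<longleftrightarrow>
     (AE \<omega> in M. smooth_on_subset SO3 (f \<omega>)) \<and>
     (\<forall>P a. finite P \<and> P \<subseteq> SO3 \<longrightarrow> gaussian_rv M (\<lambda>\<omega>. \<Sum>p\<in>P. a p * f \<omega> p))"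

definition complex_gaussian :: "'w measure \<Rightarrow> ('w \<Rightarrow> complex) \<Rightarrow> bool" where
  "complex_gaussian M Z \<longleftrightarrow>
     prob_space.indep_var M borel (\<lambda>\<omega>. Re (Z \<omega>)) borel (\<lambda>\<omega>. Im (Z \<omega>)) \<and>
     distributed M lborel (\<lambda>\<omega>. Re (Z \<omega>)) (\<lambda>x. ennreal (normal_density 0 (sqrt (1/2)) x)) \<and>
     distributed M lborel (\<lambda>\<omega>. Im (Z \<omega>)) (\<lambda>x. ennreal (normal_density 0 (sqrt (1/2)) x))"

text \<open>The field is differentiable almost surely only, so that its differential is a random variable
  on the completed probability space.\<close>

definition adler_taylor_metric :: "'w measure \<Rightarrow> ('w \<Rightarrow> real^3^3 \<Rightarrow> real) \<Rightarrow> SO3_metric" where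
  "adler_taylor_metric M f p v w =
     (LINT \<omega>|completion M. diff_SO3 (f \<omega>) p v * diff_SO3 (f \<omega>) p w)"


section \<open>Spin fields\<close>

text \<open>The \<open>j\<close>-th term, \<open>j = 0, 1, \<dots>\<close>, of a series over \<open>l \<ge> \<bar>s\<bar>\<close>.\<close>

definition shifted :: "int \<Rightarrow> (nat \<Rightarrow> 'a) \<Rightarrow> nat \<Rightarrow> 'a" where
  "shifted s F j = F (nat \<bar>s\<bar> + j)"

text \<open>The variables \<open>\<gamma> l m\<close> are those with second lower index \<open>s\<close>, which is fixed.\<close>

definition iid_complex_gaussians :: "'w measure \<Rightarrow> int \<Rightarrow> (nat \<Rightarrow> int \<Rightarrow> 'w \<Rightarrow> complex) \<Rightarrow> bool" where
  "iid_complex_gaussians M s \<gamma> \<longleftrightarrow>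
     (let I = {(l, m). \<bar>s\<bar> \<le> int l \<and> m \<in> weights l} in
       prob_space.indep_vars M (\<lambda>_. borel) (\<lambda>(l, m). \<gamma> l m) I \<and>
       (\<forall>(l, m)\<in>I. complex_gaussian M (\<gamma> l m)))"

definition spin_field :: "(nat \<Rightarrow> int \<Rightarrow> int \<Rightarrow> real^3^3 \<Rightarrow> complex) \<Rightarrow> (nat \<Rightarrow> real) \<Rightarrow>
    (nat \<Rightarrow> int \<Rightarrow> 'w \<Rightarrow> complex) \<Rightarrow> int \<Rightarrow> 'w \<Rightarrow> real^3^3 \<Rightarrow> complex" where
  "spin_field D c \<gamma> s \<omega> p =
     suminf (shifted s (\<lambda>l. of_real (c l) * (\<Sum>m\<in>weights l. \<gamma> l m \<omega> * D l m s p)))"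

definition circ_cov_term :: "(nat \<Rightarrow> int \<Rightarrow> int \<Rightarrow> real^3^3 \<Rightarrow> complex) \<Rightarrow> (nat \<Rightarrow> real) \<Rightarrow>
    int \<Rightarrow> real \<Rightarrow> nat \<Rightarrow> complex" where
  "circ_cov_term D c s \<theta> l = of_real ((c l)\<^sup>2) * wigner_d D l s s \<theta>"

text \<open>Complex-valued by type; the diagonal entries \<^term>\<open>wigner_d D l s s\<close> are in fact real.\<close>

definition circ_cov :: "(nat \<Rightarrow> int \<Rightarrow> int \<Rightarrow> real^3^3 \<Rightarrow> complex) \<Rightarrow> (nat \<Rightarrow> real) \<Rightarrow>
    int \<Rightarrow> real \<Rightarrow> complex" where
  "circ_cov D c s \<theta> = suminf (shifted s (circ_cov_term D c s \<theta>))"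

end

theory Submission
  imports Defs
begin

text \<open>The covariance of \<open>f\<close> is left-invariant: \<open>E f(p) f(q) = K(p\<inverse> q)\<close> with
  \<open>K(R(\<phi>, \<theta>, \<psi>)) = cos (s (\<phi> + \<psi>)) k(\<theta>) / 2\<close>.  The differential of \<open>f\<close> along a tangent vector
  is an almost sure limit of Gaussian difference quotients, so the Adler-Taylor metric is the
  left-invariant metric that is read off from the second order expansion of \<open>K\<close> at the identity,
  namely \<open>diag(\<xi>\<^sup>2, \<xi>\<^sup>2, s\<^sup>2)\<close> in body coordinates.  The only input from representation theory is
  the second derivative \<open>- (l (l + 1) - s\<^sup>2) / 2\<close> of \<open>d\<^sup>l\<close> at 0 in the entry \<open>(s, s)\<close>.  It comes from
  the character: \<open>R\<^sub>3(\<phi>) R\<^sub>2(\<theta>)\<close> is conjugate to some \<open>R\<^sub>3(\<omega>)\<close>, so that the sum over \<open>m\<close> of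
  \<open>d\<^sup>l(\<theta>) exp(- i m \<phi>)\<close> in the entries \<open>(m, m)\<close> equals the sum of \<open>exp(- i m \<omega>)\<close>, and the diagonal
  entries are recovered by discrete Fourier inversion in \<open>\<phi>\<close>.  The curvature follows, in an
  arbitrary chart, from the structure equations of the left-invariant coframe.\<close>

section \<open>Calculus of smooth functions\<close>

text \<open>The curvature is claimed in every chart, and Euler angles miss the points where they
  degenerate. With the body velocities of the coordinate fields of a chart, Koszul's formula becomes
  algebra with constant coefficients; for the metric diag(a, a, rho a) it ends in Scal = (2 -
  rho/2)/a, to be read with a = xi^2 and rho = s^2/xi^2. The identity is itself a singular point of
  the Euler angles: near it phi and psi need not converge separately. But K involves only theta and
  y = phi + psi, and (1 + cos theta) cos y, (1 + cos theta) sin y and cos theta are linear in the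
  matrix entries. So the expansion of K is read off from the entries of the rotation, with cos(s y)
  treated as a Chebyshev polynomial in cos y; its slope s^2 at 1 produces the third eigenvalue. The
  random series is never differentiated term by term: only variances of increments of the field are
  computed, and polarization recovers the bilinear form from the variances of the
  differential.\<close>

lemma frechet_derivative_cong_open:
  assumes "open U" "x \<in> U" "\<And>y. y \<in> U \<Longrightarrow> f y = g y"
  shows "frechet_derivative f (at x) = frechet_derivative g (at x)"
proof -
  have "(f has_derivative F) (at x) \<longleftrightarrow> (g has_derivative F) (at x)" for F
    using assms has_derivative_transform_within_open[of f F x UNIV U g]
      has_derivative_transform_within_open[of g F x UNIV U f] by auto
  then show ?thesis unfolding frechet_derivative_def by presburger
qed

lemma differentiable_cong_open:
  assumes "open U" "x \<in> U" "\<And>y. y \<in> U \<Longrightarrow> f y = g y" "f differentiable at x"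
  shows "g differentiable at x"
  using assms has_derivative_transform_within_open[of f _ x UNIV U g]
  unfolding differentiable_def by blast

lemma frechet_derivative_eqI:
  "(f has_derivative F) (at x) \<Longrightarrow> frechet_derivative f (at x) v = F v"
  by (simp add: frechet_derivative_at[symmetric])

lemma Ck_on_cong:
  assumes "open U" "\<And>x. x \<in> U \<Longrightarrow> f x = g x" "Ck_on n U f"
  shows "Ck_on n U g"
  using assms(2,3)
proof (induction n arbitrary: f g)
  case 0
  then show ?case by (simp cong: continuous_on_cong)
next
  case (Suc n)
  have "Ck_on n U (\<lambda>x. frechet_derivative g (at x) v)" for v
    by (rule Suc.IH[of "\<lambda>x. frechet_derivative f (at x) v"])
      (use Suc.prems frechet_derivative_cong_open[OF \<open>open U\<close>, of _ f g] in auto)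
  then show ?case
    using Suc.prems differentiable_cong_open[OF \<open>open U\<close>, of _ f g] by auto
qed

text \<open>\<open>Ck_on\<close> is phrased with the chosen \<open>frechet_derivative\<close>. On an
  open set any explicit derivative may stand in for it, which is what the inductions on the order of
  differentiability supply.\<close>

lemma Ck_on_SucI:
  assumes "open U" "\<And>x. x \<in> U \<Longrightarrow> (f has_derivative F x) (at x)"
    and "\<And>v. Ck_on n U (\<lambda>x. F x v)"
  shows "Ck_on (Suc n) U f"
proof -
  have "Ck_on n U (\<lambda>x. frechet_derivative f (at x) v)" for v
    by (rule Ck_on_cong[OF assms(1) _ assms(3)[of v]])
      (simp add: frechet_derivative_eqI[OF assms(2)])
  then show ?thesis
    using assms(2) by (auto simp: differentiable_def)
qed

lemma Ck_on_continuous: "Ck_on n U f \<Longrightarrow> continuous_on U f"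
  by (cases n) (auto intro!: continuous_at_imp_continuous_on differentiable_imp_continuous_within)

lemma Ck_on_Suc_imp: "Ck_on (Suc n) U f \<Longrightarrow> Ck_on n U f"
proof (induction n arbitrary: f)
  case 0
  then show ?case using Ck_on_continuous by fastforce
next
  case (Suc n)
  then show ?case by auto
qed

lemma Ck_on_const: "open U \<Longrightarrow> Ck_on n U (\<lambda>x. c)"
proof (induction n arbitrary: c)
  case (Suc n)
  then show ?case
    by (intro Ck_on_SucI[where F="\<lambda>x v. 0"]) auto
qed auto

lemma Ck_on_add:
  "open U \<Longrightarrow> Ck_on n U f \<Longrightarrow> Ck_on n U g \<Longrightarrow> Ck_on n U (\<lambda>x. f x + g x)"
proof (induction n arbitrary: f g)
  case 0
  then show ?case by (auto intro: continuous_intros)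
next
  case (Suc n)
  show ?case
    by (rule Ck_on_SucI[where F="\<lambda>x v. frechet_derivative f (at x) v + frechet_derivative g (at x) v"])
      (use Suc in \<open>auto intro!: has_derivative_add simp: frechet_derivative_works\<close>)
qed

lemma Ck_on_bounded_linear:
  assumes "bounded_linear h"
  shows "open U \<Longrightarrow> Ck_on n U f \<Longrightarrow> Ck_on n U (\<lambda>x. h (f x))"
proof (induction n arbitrary: f)
  case 0
  then show ?case using bounded_linear.continuous_on[OF assms] by auto
next
  case (Suc n)
  show ?case
    by (rule Ck_on_SucI[where F="\<lambda>x v. h (frechet_derivative f (at x) v)"])
      (use Suc in \<open>auto intro!: bounded_linear.has_derivative[OF assms] simp: frechet_derivative_works\<close>)
qed

lemma Ck_on_bilinear:
  assumes "bounded_bilinear B"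
  shows "open U \<Longrightarrow> Ck_on n U f \<Longrightarrow> Ck_on n U g \<Longrightarrow> Ck_on n U (\<lambda>x. B (f x) (g x))"
proof (induction n arbitrary: f g)
  case 0
  then show ?case using bounded_bilinear.continuous_on[OF assms] by auto
next
  case (Suc n)
  note fg = Ck_on_Suc_imp[OF Suc.prems(2)] Ck_on_Suc_imp[OF Suc.prems(3)]
  show ?case
    by (rule Ck_on_SucI[where F="\<lambda>x v. B (f x) (frechet_derivative g (at x) v)
        + B (frechet_derivative f (at x) v) (g x)"])
      (use Suc fg in \<open>auto intro!: bounded_bilinear.FDERIV[OF assms] Ck_on_add
         simp: frechet_derivative_works\<close>)
qed

lemma smooth_imp_differentiable: "smooth_on_open U f \<Longrightarrow> x \<in> U \<Longrightarrow> f differentiable (at x)"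
  unfolding smooth_on_open_def by (metis Ck_on.simps(2))

lemma smooth_has_derivative:
  "smooth_on_open U f \<Longrightarrow> x \<in> U \<Longrightarrow> (f has_derivative frechet_derivative f (at x)) (at x)"
  using smooth_imp_differentiable frechet_derivative_works by blast

lemma smooth_frechet_derivative:
  "smooth_on_open U f \<Longrightarrow> smooth_on_open U (\<lambda>x. frechet_derivative f (at x) v)"
  unfolding smooth_on_open_def by (metis Ck_on.simps(2))

lemma smooth_partial: "smooth_on_open U f \<Longrightarrow> smooth_on_open U (partial i f)"
  unfolding partial_def[abs_def] by (rule smooth_frechet_derivative)

lemma smooth_imp_continuous_on: "smooth_on_open U f \<Longrightarrow> continuous_on U f"
  unfolding smooth_on_open_def by (meson Ck_on_continuous)

lemma smooth_linear:
  "bounded_linear h \<Longrightarrow> open U \<Longrightarrow> smooth_on_open U f \<Longrightarrow> smooth_on_open U (\<lambda>x. h (f x))"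
  unfolding smooth_on_open_def by (auto intro: Ck_on_bounded_linear)

lemma smooth_bilinear:
  "bounded_bilinear B \<Longrightarrow> open U \<Longrightarrow> smooth_on_open U f \<Longrightarrow> smooth_on_open U g \<Longrightarrow>
    smooth_on_open U (\<lambda>x. B (f x) (g x))"
  unfolding smooth_on_open_def by (auto intro: Ck_on_bilinear)

lemma smooth_const: "open U \<Longrightarrow> smooth_on_open U (\<lambda>x. c)"
  unfolding smooth_on_open_def by (auto intro: Ck_on_const)

text \<open>The family is closed under differentiation, (A, B, C) becoming (wB, -wA, 0), so the
  induction runs over all coefficients at once. Rotations about a coordinate axis have this form in
  the angle, see \<open>R_harmonic\<close>.\<close>

lemma smooth_harmonic:
  fixes A B C :: "'a::real_normed_vector"
  shows "smooth_on_open UNIV (\<lambda>t::real. cos (w * t) *\<^sub>R A + sin (w * t) *\<^sub>R B + C)"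
proof -
  have "Ck_on n UNIV (\<lambda>t::real. cos (w * t) *\<^sub>R A + sin (w * t) *\<^sub>R B + C)" for n
  proof (induction n arbitrary: A B C)
    case 0
    then show ?case by (auto intro!: continuous_intros)
  next
    case (Suc n)
    have "Ck_on n UNIV (\<lambda>x. v *\<^sub>R (cos (w * x) *\<^sub>R (w *\<^sub>R B) + sin (w * x) *\<^sub>R (- w *\<^sub>R A)))" for v
      using Ck_on_bounded_linear[OF bounded_linear_scaleR_right open_UNIV
          Suc[of "w *\<^sub>R B" "- w *\<^sub>R A" 0], of v] by simp
    then show ?case
      by (intro Ck_on_SucI[where F="\<lambda>x v. v *\<^sub>R (cos (w * x) *\<^sub>R (w *\<^sub>R B) + sin (w * x) *\<^sub>R (- w *\<^sub>R A))"])
        (auto intro!: derivative_eq_intros simp: algebra_simps fun_eq_iff)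
  qed
  then show ?thesis by (simp add: smooth_on_open_def)
qed

lemma smooth_real_DERIV:
  fixes f :: "real \<Rightarrow> 'a::real_normed_vector"
  assumes "smooth_on_open UNIV f"
  shows "(f has_vector_derivative vderiv f t) (at t)"
  using smooth_imp_differentiable[OF assms, of t] unfolding vderiv_def
  by (simp add: vector_derivative_works)

lemma smooth_vderiv:
  fixes f :: "real \<Rightarrow> 'a::real_normed_vector"
  assumes "smooth_on_open UNIV f"
  shows "smooth_on_open UNIV (vderiv f)"
proof -
  have "vderiv f = (\<lambda>t. frechet_derivative f (at t) 1)"
    using frechet_derivative_eqI[OF smooth_real_DERIV[OF assms, unfolded has_vector_derivative_def]]
    by (auto simp: fun_eq_iff)
  then show ?thesis using smooth_frechet_derivative[OF assms] by simp
qed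

subsection \<open>Symmetry of second derivatives\<close>

text \<open>The mixed second difference is a first difference in u of a first difference in v; the
  mean value theorem is applied in each direction in turn. As the left side is symmetric in u and v,
  using the lemma in both orders gives the symmetry of second derivatives.\<close>

lemma second_difference_mvt:
  fixes f :: "'a::real_normed_vector \<Rightarrow> real"
  assumes sm: "smooth_on_open U f" and h: "h > 0"
    and U: "\<And>a b. 0 \<le> a \<Longrightarrow> a \<le> h \<Longrightarrow> 0 \<le> b \<Longrightarrow> b \<le> h \<Longrightarrow> x + a *\<^sub>R u + b *\<^sub>R v \<in> U"
  obtains a b where "0 < a" "a < h" "0 < b" "b < h"
    "f (x + h *\<^sub>R u + h *\<^sub>R v) - f (x + h *\<^sub>R u) - f (x + h *\<^sub>R v) + f x
     = h * h * frechet_derivative (\<lambda>y. frechet_derivative f (at y) u) (at (x + a *\<^sub>R u + b *\<^sub>R v)) v"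
proof -
  let ?d = "\<lambda>y. frechet_derivative f (at y) u"
  have D: "((\<lambda>t. F (x + t *\<^sub>R u + b *\<^sub>R v)) has_real_derivative
      frechet_derivative F (at (x + t *\<^sub>R u + b *\<^sub>R v)) u) (at t)"
    if "smooth_on_open U F" "0 \<le> t" "t \<le> h" "0 \<le> b" "b \<le> h" for F :: "'a \<Rightarrow> real" and t b
  proof -
    have l: "linear (frechet_derivative F (at (x + t *\<^sub>R u + b *\<^sub>R v)))"
      using smooth_has_derivative[OF that(1) U[OF that(2-5)]] has_derivative_linear by blast
    have "((\<lambda>t. F (x + t *\<^sub>R u + b *\<^sub>R v)) has_derivative
        (\<lambda>k. frechet_derivative F (at (x + t *\<^sub>R u + b *\<^sub>R v)) (k *\<^sub>R u))) (at t)"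
      by (rule has_derivative_compose[where g=F and f="\<lambda>t. x + t *\<^sub>R u + b *\<^sub>R v", OF _ smooth_has_derivative[OF that(1) U[OF that(2-5)]]])
        (auto intro!: derivative_eq_intros)
    then show ?thesis
      by (rule has_derivative_imp_has_field_derivative) (simp add: linear_cmul[OF l])
  qed
  have D2: "((\<lambda>t. F (x + a *\<^sub>R u + t *\<^sub>R v)) has_real_derivative
      frechet_derivative F (at (x + a *\<^sub>R u + t *\<^sub>R v)) v) (at t)"
    if "smooth_on_open U F" "0 \<le> t" "t \<le> h" "0 \<le> a" "a \<le> h" for F :: "'a \<Rightarrow> real" and t a
  proof -
    have l: "linear (frechet_derivative F (at (x + a *\<^sub>R u + t *\<^sub>R v)))"
      using smooth_has_derivative[OF that(1) U[OF that(4,5,2,3)]] has_derivative_linear by blast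
    have "((\<lambda>t. F (x + a *\<^sub>R u + t *\<^sub>R v)) has_derivative
        (\<lambda>k. frechet_derivative F (at (x + a *\<^sub>R u + t *\<^sub>R v)) (k *\<^sub>R v))) (at t)"
      by (rule has_derivative_compose[where g=F and f="\<lambda>t. x + a *\<^sub>R u + t *\<^sub>R v", OF _ smooth_has_derivative[OF that(1) U[OF that(4,5,2,3)]]])
        (auto intro!: derivative_eq_intros)
    then show ?thesis
      by (rule has_derivative_imp_has_field_derivative) (simp add: linear_cmul[OF l])
  qed
  have "\<exists>z>0. z < h \<and> (f (x + h *\<^sub>R u + h *\<^sub>R v) - f (x + h *\<^sub>R u + 0 *\<^sub>R v))
      - (f (x + 0 *\<^sub>R u + h *\<^sub>R v) - f (x + 0 *\<^sub>R u + 0 *\<^sub>R v))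
      = (h - 0) * (?d (x + z *\<^sub>R u + h *\<^sub>R v) - ?d (x + z *\<^sub>R u + 0 *\<^sub>R v))"
    by (rule MVT2[OF h]) (intro DERIV_diff D[OF sm]; use h in simp)
  then obtain a where a: "0 < a" "a < h" and aeq:
    "f (x + h *\<^sub>R u + h *\<^sub>R v) - f (x + h *\<^sub>R u) - f (x + h *\<^sub>R v) + f x
      = h * (?d (x + a *\<^sub>R u + h *\<^sub>R v) - ?d (x + a *\<^sub>R u + 0 *\<^sub>R v))" by auto
  have "\<exists>z>0. z < h \<and> ?d (x + a *\<^sub>R u + h *\<^sub>R v) - ?d (x + a *\<^sub>R u + 0 *\<^sub>R v)
      = (h - 0) * frechet_derivative ?d (at (x + a *\<^sub>R u + z *\<^sub>R v)) v"
    by (rule MVT2[OF h]) (rule D2[OF smooth_frechet_derivative[OF sm]]; use a h in simp)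
  then obtain b where b: "0 < b" "b < h"
    "?d (x + a *\<^sub>R u + h *\<^sub>R v) - ?d (x + a *\<^sub>R u + 0 *\<^sub>R v)
      = h * frechet_derivative ?d (at (x + a *\<^sub>R u + b *\<^sub>R v)) v" by auto
  show thesis
    by (rule that[OF a b(1,2)]) (use aeq b(3) in \<open>simp add: algebra_simps\<close>)
qed

lemma smooth_second_derivative_symmetric:
  fixes f :: "'a::real_normed_vector \<Rightarrow> real"
  assumes sm: "smooth_on_open U f" and U: "open U" "x \<in> U"
  shows "frechet_derivative (\<lambda>y. frechet_derivative f (at y) u) (at x) v
       = frechet_derivative (\<lambda>y. frechet_derivative f (at y) v) (at x) u"
proof (rule ccontr)
  let ?p = "\<lambda>u v y. frechet_derivative (\<lambda>y. frechet_derivative f (at y) u) (at y) v"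
  \<comment> \<open>Half the gap: one common value within e of both mixed derivatives at x is
    impossible.\<close>
  define e where "e = \<bar>?p u v x - ?p v u x\<bar> / 2"
  assume "\<not> ?thesis"
  then have e: "e > 0" unfolding e_def by simp
  have c: "isCont (?p u v) x" for u v
    using smooth_imp_continuous_on[OF smooth_frechet_derivative[OF smooth_frechet_derivative[OF sm]]]
      U by (simp add: continuous_on_eq_continuous_at)
  obtain d1 where d1: "d1 > 0" "\<And>y. dist y x < d1 \<Longrightarrow> dist (?p u v y) (?p u v x) < e"
    using c[of u v] e unfolding continuous_at_eps_delta by blast
  obtain d2 where d2: "d2 > 0" "\<And>y. dist y x < d2 \<Longrightarrow> dist (?p v u y) (?p v u x) < e"
    using c[of v u] e unfolding continuous_at_eps_delta by blast
  obtain d3 where d3: "d3 > 0" "ball x d3 \<subseteq> U" using U open_contains_ball by blast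
  define d where "d = min d1 (min d2 d3)"
  \<comment> \<open>Keeps the parallelogram spanned by h u and h v at x inside the ball of radius d;
    the summand 1 covers u = v = 0.\<close>
  define h where "h = d / (2 * (norm u + norm v + 1))"
  have d: "d > 0" using d1 d2 d3 by (simp add: d_def)
  have nn: "norm u + norm v + 1 > 0" by (simp add: add_nonneg_pos)
  have h: "h > 0" using d nn by (simp add: h_def)
  have near: "dist (x + a *\<^sub>R u + b *\<^sub>R v) x < d"
    if "0 \<le> a" "a \<le> h" "0 \<le> b" "b \<le> h" for a b
  proof -
    have "dist (x + a *\<^sub>R u + b *\<^sub>R v) x \<le> norm (a *\<^sub>R u) + norm (b *\<^sub>R v)"
      by (simp add: dist_norm add.assoc norm_triangle_ineq del: norm_scaleR)
    also have "\<dots> \<le> h * norm u + h * norm v"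
      using that by (auto intro!: add_mono mult_right_mono)
    also have "\<dots> < h * (norm u + norm v + 1) * 2" using h nn
      by (simp add: algebra_simps) (smt (verit) mult_nonneg_nonneg norm_ge_zero)
    also have "\<dots> = d" using nn by (simp add: h_def field_simps)
    finally show ?thesis .
  qed
  have inU: "x + a *\<^sub>R u + b *\<^sub>R v \<in> U"
    if "0 \<le> a" "a \<le> h" "0 \<le> b" "b \<le> h" for a b
    using near[OF that] d3 by (auto simp: d_def dist_commute)
  obtain a b where ab: "0 < a" "a < h" "0 < b" "b < h" and
    e1: "f (x + h *\<^sub>R u + h *\<^sub>R v) - f (x + h *\<^sub>R u) - f (x + h *\<^sub>R v) + f x
     = h * h * ?p u v (x + a *\<^sub>R u + b *\<^sub>R v)"
    by (rule second_difference_mvt[OF sm h, of x u v]) (use inU in blast)+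
  obtain b' a' where ab': "0 < b'" "b' < h" "0 < a'" "a' < h" and
    e2: "f (x + h *\<^sub>R v + h *\<^sub>R u) - f (x + h *\<^sub>R v) - f (x + h *\<^sub>R u) + f x
     = h * h * ?p v u (x + b' *\<^sub>R v + a' *\<^sub>R u)"
    by (rule second_difference_mvt[OF sm h, of x v u])
      (use inU in \<open>metis (no_types, lifting) add.assoc add.commute\<close>)+
  have "h * h * ?p u v (x + a *\<^sub>R u + b *\<^sub>R v) = h * h * ?p v u (x + a' *\<^sub>R u + b' *\<^sub>R v)"
    using e1 e2 by (simp add: algebra_simps)
  then have eq: "?p u v (x + a *\<^sub>R u + b *\<^sub>R v) = ?p v u (x + a' *\<^sub>R u + b' *\<^sub>R v)" using h by simp
  have "dist (?p u v (x + a *\<^sub>R u + b *\<^sub>R v)) (?p u v x) < e"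
    using d1(2) near[of a b] ab by (auto simp: d_def)
  moreover have "dist (?p v u (x + a' *\<^sub>R u + b' *\<^sub>R v)) (?p v u x) < e"
    using d2(2) near[of a' b'] ab' by (auto simp: d_def)
  ultimately show False using eq by (auto simp: e_def dist_real_def abs_if split: if_splits)
qed

section \<open>Curvature in a left-invariant frame\<close>

text \<open>A Berger metric, evaluated on body velocities: left-invariant and, besides, invariant
  under rotations about the third body axis.\<close>

definition berger :: "real \<Rightarrow> real \<Rightarrow> real^3 \<Rightarrow> real^3 \<Rightarrow> real" where
  "berger \<alpha> \<beta> u v = \<alpha> * (u$1 * v$1 + u$2 * v$2) + \<beta> * (u$3 * v$3)"

lemma bounded_bilinear_berger: "bounded_bilinear (berger \<alpha> \<beta>)"
  unfolding bilinear_conv_bounded_bilinear[symmetric]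
  by (auto simp: bilinear_def linear_iff berger_def algebra_simps)

text \<open>The Levi-Civita connection of a left-invariant metric: by Koszul's formula,
  \<open>2 N u v = u \<times> v - A\<inverse> ((A v) \<times> u + (A u) \<times> v)\<close> for the metric
  \<open>A = diag 1 1 \<rho>\<close>; rescaling the metric does not change it.\<close>

definition berger_conn :: "real \<Rightarrow> real^3 \<Rightarrow> real^3 \<Rightarrow> real^3" where
  "berger_conn \<rho> u v = (1/2) *\<^sub>R vector
     [\<rho> * u$2 * v$3 - (2 - \<rho>) * u$3 * v$2,
      (2 - \<rho>) * u$3 * v$1 - \<rho> * u$1 * v$3,
      u$1 * v$2 - u$2 * v$1]"

lemma bounded_bilinear_berger_conn: "bounded_bilinear (berger_conn \<rho>)"
  unfolding bilinear_conv_bounded_bilinear[symmetric]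
  by (auto simp: bilinear_def linear_iff berger_conn_def vec_eq_iff forall_3 algebra_simps)

text \<open>Here \<open>eij\<close> stands for the i-th partial derivative of the frame vector
  \<open>wj\<close>, and the hypotheses are the Maurer-Cartan equations. The left side is the
  product rule expansion of the three Gram matrix derivatives in a Christoffel symbol of the first
  kind.\<close>

lemma koszul_berger:
  assumes "eij - eji = - cross3 wi wj" "eim - emi = - cross3 wi wm" "ejm - emj = - cross3 wj wm"
  shows "berger \<alpha> (\<rho> * \<alpha>) eim wj + berger \<alpha> (\<rho> * \<alpha>) wm eij
       + (berger \<alpha> (\<rho> * \<alpha>) ejm wi + berger \<alpha> (\<rho> * \<alpha>) wm eji)
       - (berger \<alpha> (\<rho> * \<alpha>) emi wj + berger \<alpha> (\<rho> * \<alpha>) wi emj)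
       = 2 * berger \<alpha> (\<rho> * \<alpha>) wm (eij + berger_conn \<rho> wi wj)"
proof -
  have "eji = eij + cross3 wi wj" "emi = eim + cross3 wi wm" "emj = ejm + cross3 wj wm"
    using assms by (auto simp: algebra_simps)
  then show ?thesis
    by (simp add: berger_def berger_conn_def cross3_def algebra_simps)
qed

text \<open>The curvature dA + A \<and> A of the connection form A =
  \<open>berger_conn \<rho>\<close> w, with dw already replaced by \<open>- cross3 u v\<close>
  through the Maurer-Cartan equation.\<close>

definition berger_riem :: "real \<Rightarrow> real^3 \<Rightarrow> real^3 \<Rightarrow> real^3 \<Rightarrow> real^3" where
  "berger_riem \<rho> u v z = berger_conn \<rho> (- cross3 u v) z
     + berger_conn \<rho> u (berger_conn \<rho> v z) - berger_conn \<rho> v (berger_conn \<rho> u z)"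

lemma linear_berger_riem: "linear (\<lambda>u. berger_riem \<rho> u v z)"
proof -
  interpret N: bounded_bilinear "berger_conn \<rho>" by (rule bounded_bilinear_berger_conn)
  show ?thesis
    by (simp add: linear_iff berger_riem_def N.add_left N.add_right N.scaleR_left N.scaleR_right
        cross_add_left cross_mult_left N.minus_left N.diff_left algebra_simps)
qed

text \<open>This trace is the Ricci form in the frame. For \<rho> = 1 it is half the scalar product,
  the Ricci form of a round 3-sphere of radius 2.\<close>

lemma trace_berger_riem:
  "(\<Sum>a\<in>UNIV. berger_riem \<rho> (axis a 1) v z $ a)
    = (1 - \<rho> / 2) * (v$1 * z$1 + v$2 * z$2) + \<rho>\<^sup>2 / 2 * (v$3 * z$3)"
proof -
  have "berger_riem \<rho> (axis 1 1) v z $ 1 = (v$2 * z$2 * (1 - 3/4 * \<rho>) + \<rho>\<^sup>2 / 4 * (v$3 * z$3))"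
    "berger_riem \<rho> (axis 2 1) v z $ 2 = (v$1 * z$1 * (1 - 3/4 * \<rho>) + \<rho>\<^sup>2 / 4 * (v$3 * z$3))"
    "berger_riem \<rho> (axis 3 1) v z $ 3 = (v$1 * z$1 + v$2 * z$2) * \<rho> / 4"
    by (simp_all add: berger_riem_def berger_conn_def cross3_def axis_def algebra_simps power2_eq_square)
  then show ?thesis by (simp add: sum_3 algebra_simps)
qed

section \<open>Rules for partial derivatives\<close>

lemma partial_cong_open:
  "open U \<Longrightarrow> x \<in> U \<Longrightarrow> (\<And>y. y \<in> U \<Longrightarrow> f y = g y) \<Longrightarrow> partial i f x = partial i g x"
  unfolding partial_def using frechet_derivative_cong_open[of U x f g] by simp

lemma partial_add:
  assumes "f differentiable at x" "g differentiable at x"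
  shows "partial i (\<lambda>y. f y + g y) x = partial i f x + partial i g x"
  unfolding partial_def
  by (rule frechet_derivative_eqI[OF has_derivative_add[OF assms[unfolded frechet_derivative_works]]])

lemma partial_bilinear:
  assumes "bounded_bilinear B" "f differentiable at x" "g differentiable at x"
  shows "partial i (\<lambda>y. B (f y) (g y)) x = B (f x) (partial i g x) + B (partial i f x) (g x)"
  unfolding partial_def
  by (rule frechet_derivative_eqI[OF bounded_bilinear.FDERIV[OF assms[unfolded frechet_derivative_works]]])

lemma partial_linear:
  assumes "bounded_linear h" "f differentiable at x"
  shows "partial i (\<lambda>y. h (f y)) x = h (partial i f x)"
  unfolding partial_def
  by (rule frechet_derivative_eqI[OF bounded_linear.has_derivative[OF assms[unfolded frechet_derivative_works]]])

lemma partial_sum: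
  assumes "\<And>k. k \<in> I \<Longrightarrow> f k differentiable at x"
  shows "partial i (\<lambda>y. \<Sum>k\<in>I. f k y) x = (\<Sum>k\<in>I. partial i (f k) x)"
  unfolding partial_def
  by (rule frechet_derivative_eqI[OF has_derivative_sum[OF assms[unfolded frechet_derivative_works]]])

text \<open>Symmetry of second derivatives rests on the mean value theorem and is proved for real
  functions; here it is applied to each component of f.\<close>

lemma partial_commute:
  fixes f :: "real^3 \<Rightarrow> 'a::euclidean_space"
  assumes "smooth_on_open U f" "open U" "x \<in> U"
  shows "partial i (partial j f) x = partial j (partial i f) x"
proof (rule euclidean_eqI)
  fix b :: 'a
  have l: "bounded_linear (\<lambda>v. v \<bullet> b)" by (rule bounded_linear_inner_left)
  have p: "partial i (\<lambda>y. h y \<bullet> b) y = partial i h y \<bullet> b"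
    if "smooth_on_open U h" "y \<in> U" for h :: "real^3 \<Rightarrow> 'a" and i y
    using partial_linear[OF l smooth_imp_differentiable[OF that]] .
  have q: "partial i (partial j f) x \<bullet> b = partial i (partial j (\<lambda>y. f y \<bullet> b)) x" for i j
  proof -
    have "partial i (partial j f) x \<bullet> b = partial i (\<lambda>y. partial j f y \<bullet> b) x"
      using p[OF smooth_partial[OF assms(1)] assms(3)] by simp
    also have "\<dots> = partial i (partial j (\<lambda>y. f y \<bullet> b)) x"
      by (rule partial_cong_open[OF assms(2,3)]) (simp add: p[OF assms(1)])
    finally show ?thesis .
  qed
  have "partial i (partial j (\<lambda>y. f y \<bullet> b)) x = partial j (partial i (\<lambda>y. f y \<bullet> b)) x"
    using smooth_second_derivative_symmetric[OF smooth_linear[OF l assms(2,1)] assms(2,3),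
        of "axis j 1" "axis i 1"]
    unfolding partial_def[abs_def] .
  then show "partial i (partial j f) x \<bullet> b = partial j (partial i f) x \<bullet> b"
    unfolding q[of i j] q[of j i] .
qed

lemma
  assumes "invertible (A::real^'n^'n)"
  shows matrix_inv_right: "A ** matrix_inv A = mat 1"
    and matrix_inv_left: "matrix_inv A ** A = mat 1"
  using someI_ex[of "\<lambda>A'. A ** A' = mat 1 \<and> A' ** A = mat 1"] assms
  unfolding invertible_def matrix_inv_def by auto

text \<open>The vector \<open>w j\<close> holds the frame components of the j-th coordinate field of
  a chart. For a chart of the rotation group it is the body velocity, and
  \<open>maurer_cartan\<close> is the structure equation of the form p^-1 dp, with the commutator of
  skew matrices written as a cross product.\<close>

locale berger_frame =
  fixes U :: "(real^3) set" and w :: "3 \<Rightarrow> real^3 \<Rightarrow> real^3" and \<alpha> \<rho> :: real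
    and G :: "real^3 \<Rightarrow> real^3^3"
  assumes pos: "\<alpha> > 0" "\<rho> > 0" and openU: "open U"
    and smooth: "smooth_on_open U (w j)"
    and maurer_cartan: "x \<in> U \<Longrightarrow> partial i (w j) x - partial j (w i) x = - cross3 (w i x) (w j x)"
    and indep: "x \<in> U \<Longrightarrow> det (\<chi> a j. w j x $ a) \<noteq> 0"
    and gram: "x \<in> U \<Longrightarrow> G x $ i $ j = berger \<alpha> (\<rho> * \<alpha>) (w i x) (w j x)"
begin

definition W :: "real^3 \<Rightarrow> real^3^3" where "W x = (\<chi> a j. w j x $ a)"

text \<open>The covariant derivative of the j-th coordinate field along the i-th one, in frame
  components.\<close>

definition E :: "3 \<Rightarrow> 3 \<Rightarrow> real^3 \<Rightarrow> real^3" where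
  "E i j x = partial i (w j) x + berger_conn \<rho> (w i x) (w j x)"

lemma W_mult: "W x *v t = (\<Sum>k\<in>UNIV. t $ k *\<^sub>R w k x)"
  by (simp add: W_def vec_eq_iff matrix_vector_mult_def mult.commute)

lemma diff_w: "x \<in> U \<Longrightarrow> w j differentiable at x"
  using smooth_imp_differentiable[OF smooth] .

lemma diff_pw: "x \<in> U \<Longrightarrow> partial i (w j) differentiable at x"
  using smooth_imp_differentiable[OF smooth_partial[OF smooth]] .

lemma smooth_E: "smooth_on_open U (E i j)"
proof -
  have "smooth_on_open U (\<lambda>x. berger_conn \<rho> (w i x) (w j x))"
    by (rule smooth_bilinear[OF bounded_bilinear_berger_conn openU smooth smooth])
  then show ?thesis
    using smooth_partial[OF smooth, of i j] openU
    unfolding E_def[abs_def] smooth_on_open_def by (auto intro: Ck_on_add)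
qed

lemma partial_E:
  assumes "x \<in> U"
  shows "partial l (E i j) x = partial l (partial i (w j)) x
    + (berger_conn \<rho> (w i x) (partial l (w j) x) + berger_conn \<rho> (partial l (w i) x) (w j x))"
proof -
  have "(\<lambda>x. berger_conn \<rho> (w i x) (w j x)) differentiable at x"
    by (rule smooth_imp_differentiable[OF _ assms],
        rule smooth_bilinear[OF bounded_bilinear_berger_conn openU smooth smooth])
  then show ?thesis
    unfolding E_def[abs_def]
    by (simp add: partial_add diff_pw assms partial_bilinear[OF bounded_bilinear_berger_conn] diff_w)
qed

lemma G_eq: "x \<in> U \<Longrightarrow> G x = transpose (W x) ** (\<chi> a b. if a = b then if a = 3 then (\<rho> * \<alpha>) else \<alpha> else 0) ** W x"
  by (simp add: vec_eq_iff forall_3 matrix_matrix_mult_def sum_3 W_def transpose_def gram berger_def algebra_simps)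

lemma diag_det: "det (\<chi> a b::3. if a = b then if a = 3 then (\<rho> * \<alpha>) else \<alpha> else 0) = \<alpha> * \<alpha> * (\<rho> * \<alpha>)"
  by (simp add: det_3)

lemma invertible_W: "x \<in> U \<Longrightarrow> invertible (W x)"
  using indep by (simp add: invertible_det_nz W_def)

lemma invertible_G: "x \<in> U \<Longrightarrow> invertible (G x)"
  using indep pos by (simp add: invertible_det_nz G_eq det_mul diag_det W_def[symmetric] flip: W_def)

lemma partial_G:
  assumes "x \<in> U"
  shows "partial l (\<lambda>y. G y $ i $ j) x
    = berger \<alpha> (\<rho> * \<alpha>) (w i x) (partial l (w j) x) + berger \<alpha> (\<rho> * \<alpha>) (partial l (w i) x) (w j x)"
proof -
  have "partial l (\<lambda>y. G y $ i $ j) x = partial l (\<lambda>y. berger \<alpha> (\<rho> * \<alpha>) (w i y) (w j y)) x"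
    by (rule partial_cong_open[OF openU assms]) (simp add: gram)
  then show ?thesis
    by (simp add: partial_bilinear[OF bounded_bilinear_berger] diff_w assms)
qed

text \<open>Koszul's formula writes the Christoffel symbols of the first kind as scalar products of
  the \<open>w m\<close> with \<open>E i j\<close>. These are the entries of \<open>G\<close>
  applied to the claimed vector, so multiplying by the inverse of \<open>G\<close> identifies
  it.\<close>

lemma christoffel_W:
  assumes "x \<in> U"
  shows "(\<chi> k. christoffel G k i j x) = matrix_inv (W x) *v E i j x"
proof -
  define t where "t = matrix_inv (W x) *v E i j x"
  have Wt: "W x *v t = E i j x"
    by (simp add: t_def matrix_vector_mul_assoc matrix_inv_right[OF invertible_W[OF assms]])
  let ?c = "\<chi> m. (partial i (\<lambda>y. G y $ m $ j) x + partial j (\<lambda>y. G y $ m $ i) x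
       - partial m (\<lambda>y. G y $ i $ j) x) / 2"
  interpret B: bounded_bilinear "berger \<alpha> (\<rho> * \<alpha>)" by (rule bounded_bilinear_berger)
  have "?c $ m = berger \<alpha> (\<rho> * \<alpha>) (w m x) (E i j x)" for m
    using koszul_berger[OF maurer_cartan[OF assms, of i j] maurer_cartan[OF assms, of i m]
        maurer_cartan[OF assms, of j m], where \<alpha>=\<alpha> and \<rho>=\<rho>]
    by (simp add: partial_G[OF assms] E_def algebra_simps)
  also have "\<And>m. \<dots> m = (G x *v t) $ m"
    unfolding Wt[symmetric] W_mult
    by (simp add: B.sum_right B.scaleR_right) (simp add: matrix_vector_mult_def gram[OF assms] mult.commute)
  finally have "?c = G x *v t" by (simp add: vec_eq_iff)
  then have "matrix_inv (G x) *v ?c = t"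
    by (simp add: matrix_vector_mul_assoc matrix_inv_left[OF invertible_G[OF assms]])
  moreover have "(\<chi> k. christoffel G k i j x) = matrix_inv (G x) *v ?c"
    by (simp add: vec_eq_iff christoffel_def matrix_vector_mult_def sum_divide_distrib)
  ultimately show ?thesis by (simp add: t_def)
qed

lemma sum_christoffel:
  assumes "x \<in> U"
  shows "(\<Sum>k\<in>UNIV. christoffel G k i j x *\<^sub>R w k x) = E i j x"
proof -
  have "(\<Sum>k\<in>UNIV. christoffel G k i j x *\<^sub>R w k x) = W x *v (\<chi> k. christoffel G k i j x)"
    by (simp add: W_mult)
  also have "\<dots> = E i j x"
    by (simp add: christoffel_W[OF assms] matrix_vector_mul_assoc matrix_inv_right[OF invertible_W[OF assms]])
  finally show ?thesis .
qed

text \<open>Cramer's rule replaces the matrix inverse inside \<open>christoffel\<close> by a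
  quotient of polynomials in smooth functions, from which differentiability is immediate.\<close>

lemma cramer_W:
  assumes "x \<in> U"
  shows "christoffel G k i j x = det (\<chi> a b. if b = k then E i j x $ a else w b x $ a) / det (W x)"
proof -
  have "W x *v (\<chi> k. christoffel G k i j x) = E i j x"
    using sum_christoffel[OF assms] by (simp add: W_mult)
  then have "(\<chi> k. christoffel G k i j x) = (\<chi> k. det(\<chi> a b. if b=k then E i j x $ a else W x $ a $ b) / det (W x))"
    using cramer[of "W x"] indep[OF assms] by (simp add: W_def)
  then have "christoffel G k i j x = det(\<chi> a b. if b=k then E i j x $ a else W x $ a $ b) / det (W x)"
    by (simp add: vec_eq_iff)
  then show ?thesis by (simp add: W_def cong: if_cong)
qed

lemma christoffel_differentiable:
  assumes "x \<in> U"
  shows "christoffel G k i j differentiable at x"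
proof (rule differentiable_cong_open[OF openU assms])
  show "det (\<chi> a b. if b = k then E i j y $ a else w b y $ a) / det (W y) = christoffel G k i j y"
    if "y \<in> U" for y using cramer_W[OF that] by simp
  have [simp]: "(\<lambda>y. w b y $ a) differentiable at x" "(\<lambda>y. E i j y $ a) differentiable at x" for a b
    using smooth_imp_differentiable[OF smooth_linear[OF bounded_linear_vec_nth openU smooth] assms]
      smooth_imp_differentiable[OF smooth_linear[OF bounded_linear_vec_nth openU smooth_E] assms] by auto
  have "det (W x) \<noteq> 0" using indep[OF assms] by (simp add: W_def)
  then show "(\<lambda>y. det (\<chi> a b. if b = k then E i j y $ a else w b y $ a) / det (W y)) differentiable at x"
    unfolding det_3 W_def using exhaust_3[of k]
    by (intro differentiable_divide differentiable_add differentiable_diff differentiable_mult)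
      (auto intro!: differentiable_mult)
qed

text \<open>The antisymmetrization \<open>berger_conn \<rho> u v - berger_conn \<rho> v u\<close> is
  \<open>cross3 u v\<close>, which cancels the Maurer-Cartan term: the connection is
  torsion-free.\<close>

lemma christoffel_commute:
  assumes "x \<in> U"
  shows "christoffel G k i j x = christoffel G k j i x"
proof -
  have "E i j x = E j i x"
    using maurer_cartan[OF assms, of i j]
    by (auto simp: E_def berger_conn_def cross3_def vec_eq_iff forall_3 field_simps)
  then have "(\<chi> k. christoffel G k i j x) = (\<chi> k. christoffel G k j i x)"
    by (simp add: christoffel_W[OF assms])
  then show ?thesis
    by (simp add: vec_eq_iff)
qed

text \<open>The coordinate components of the iterated covariant derivative of the j-th coordinate
  field, first along the i-th and then along the l-th one. Antisymmetrized in l and i it is the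
  Riemann tensor.\<close>

definition S :: "3 \<Rightarrow> 3 \<Rightarrow> 3 \<Rightarrow> real^3 \<Rightarrow> real^3" where
  "S l i j x = (\<chi> k. partial l (christoffel G k i j) x
     + (\<Sum>m\<in>UNIV. christoffel G k l m x * christoffel G m i j x))"

text \<open>Obtained by differentiating \<open>sum_christoffel\<close>. In frame components a
  covariant derivative is the partial derivative plus \<open>berger_conn \<rho> (w l x)\<close>, so
  the unwieldy derivatives of Christoffel symbols turn into derivatives of
  \<open>E i j\<close>.\<close>

lemma W_S:
  assumes x: "x \<in> U"
  shows "W x *v S l i j x = partial l (E i j) x + berger_conn \<rho> (w l x) (E i j x)"
proof -
  interpret N: bounded_bilinear "berger_conn \<rho>" by (rule bounded_bilinear_berger_conn)
  let ?\<Gamma> = "christoffel G"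
  have d: "(\<lambda>y. ?\<Gamma> k i j y *\<^sub>R w k y) differentiable at x" for k
    by (intro differentiable_scaleR christoffel_differentiable diff_w x)
  have p: "partial l (w k) x = E l k x - berger_conn \<rho> (w l x) (w k x)" for k
    by (simp add: E_def)
  have "partial l (E i j) x = partial l (\<lambda>y. \<Sum>k\<in>UNIV. ?\<Gamma> k i j y *\<^sub>R w k y) x"
    by (rule partial_cong_open[OF openU x]) (simp add: sum_christoffel)
  also have "\<dots> = (\<Sum>k\<in>UNIV. ?\<Gamma> k i j x *\<^sub>R partial l (w k) x + partial l (?\<Gamma> k i j) x *\<^sub>R w k x)"
    using d by (simp add: partial_sum partial_bilinear[OF bounded_bilinear_scaleR]
        christoffel_differentiable diff_w x)
  also have "\<dots> = (\<Sum>k\<in>UNIV. ?\<Gamma> k i j x *\<^sub>R E l k x) - (\<Sum>k\<in>UNIV. ?\<Gamma> k i j x *\<^sub>R berger_conn \<rho> (w l x) (w k x))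
      + (\<Sum>k\<in>UNIV. partial l (?\<Gamma> k i j) x *\<^sub>R w k x)"
    by (simp add: p scaleR_diff_right sum.distrib sum_subtractf)
  also have "(\<Sum>k\<in>UNIV. ?\<Gamma> k i j x *\<^sub>R berger_conn \<rho> (w l x) (w k x)) = berger_conn \<rho> (w l x) (E i j x)"
    by (simp add: sum_christoffel[OF x, symmetric] N.sum_right N.scaleR_right)
  also have "(\<Sum>k\<in>UNIV. ?\<Gamma> k i j x *\<^sub>R E l k x) = (\<Sum>k\<in>UNIV. \<Sum>m\<in>UNIV. (?\<Gamma> m l k x * ?\<Gamma> k i j x) *\<^sub>R w m x)"
    by (simp add: sum_christoffel[OF x, symmetric] scaleR_sum_right mult.commute)
  also have "\<dots> = (\<Sum>m\<in>UNIV. (\<Sum>k\<in>UNIV. ?\<Gamma> m l k x * ?\<Gamma> k i j x) *\<^sub>R w m x)"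
    unfolding scaleR_sum_left by (rule sum.swap)
  finally show ?thesis
    by (simp add: W_mult S_def scaleR_add_left sum.distrib)
qed

text \<open>The second partial derivatives of \<open>w j\<close> cancel by symmetry, and its first
  partial derivatives cancel between the product rule and the outer connection term. Only the
  exterior derivative of w and the quadratic terms survive.\<close>

lemma W_S_diff:
  assumes x: "x \<in> U"
  shows "W x *v (S l i j x - S i l j x) = berger_riem \<rho> (w l x) (w i x) (w j x)"
proof -
  interpret N: bounded_bilinear "berger_conn \<rho>" by (rule bounded_bilinear_berger_conn)
  have "W x *v (S l i j x - S i l j x) =
     berger_conn \<rho> (partial l (w i) x - partial i (w l) x) (w j x)
     + berger_conn \<rho> (w l x) (berger_conn \<rho> (w i x) (w j x)) - berger_conn \<rho> (w i x) (berger_conn \<rho> (w l x) (w j x))"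
    unfolding matrix_vector_mult_diff_distrib W_S[OF x] partial_E[OF x] E_def N.add_right
        partial_commute[OF smooth openU x, of l i] N.diff_left by (simp only: algebra_simps)
  then show ?thesis
    unfolding maurer_cartan[OF x] berger_riem_def .
qed

text \<open>The Ricci tensor is the trace of u \<mapsto> R(u, v) z, and a trace does not depend on
  the basis: conjugation by W moves it from the coordinate fields to the frame, where
  \<open>trace_berger_riem\<close> evaluates it.\<close>

lemma ricci_frame:
  assumes x: "x \<in> U"
  shows "ricci G i j x = (1 - \<rho> / 2) * (w j x $ 1 * w i x $ 1 + w j x $ 2 * w i x $ 2)
      + \<rho>\<^sup>2 / 2 * (w j x $ 3 * w i x $ 3)"
proof -
  let ?V = "matrix_inv (W x)" and ?L = "\<lambda>u. berger_riem \<rho> u (w j x) (w i x)"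
  \<comment> \<open>Swapping the lower indices brings the index order of \<open>ricci\<close> to
    that of \<open>S\<close>.\<close>
  have 1: "partial l (christoffel G k i j) x = partial l (christoffel G k j i) x" for k l i j
    by (rule partial_cong_open[OF openU x]) (rule christoffel_commute)
  have "ricci G i j x = (\<Sum>k\<in>UNIV. (S k j i x - S j k i x) $ k)"
    unfolding ricci_def
  proof (rule sum.cong[OF refl])
    fix k
    have "(\<Sum>m\<in>UNIV. christoffel G k k m x * christoffel G m i j x)
        = (\<Sum>m\<in>UNIV. christoffel G k k m x * christoffel G m j i x)"
      by (simp only: christoffel_commute[OF x, of _ i j])
    moreover have "(\<Sum>m\<in>UNIV. christoffel G k j m x * christoffel G m i k x)
        = (\<Sum>m\<in>UNIV. christoffel G k j m x * christoffel G m k i x)"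
      by (simp only: christoffel_commute[OF x, of _ i k])
    ultimately show "partial k (christoffel G k i j) x - partial j (christoffel G k i k) x
        + (\<Sum>m\<in>UNIV. christoffel G k k m x * christoffel G m i j x
            - christoffel G k j m x * christoffel G m i k x) = (S k j i x - S j k i x) $ k"
      by (simp add: S_def sum_subtractf 1[of k k i j] 1[of j k i k])
  qed
  also have "\<dots> = (\<Sum>k\<in>UNIV. (?V *v ?L (w k x)) $ k)"
    by (simp add: W_S_diff[OF x, symmetric] matrix_vector_mul_assoc matrix_inv_left[OF invertible_W[OF x]])
  also have "\<dots> = trace (?V ** (matrix ?L ** W x))"
  proof -
    have "?L (w k x) $ b = (matrix ?L ** W x) $ b $ k" for k b
    proof -
      have "?L (w k x) = matrix ?L *v w k x"
        using matrix_works[of ?L "w k x"] linear_berger_riem[of \<rho> "w j x" "w i x"]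
        by (simp add: linear_matrix_vector_mul_eq)
      then show ?thesis
        by (simp add: matrix_matrix_mult_def matrix_vector_mult_def W_def)
    qed
    then show ?thesis
      by (simp add: trace_def matrix_vector_mult_def matrix_matrix_mult_def[of ?V])
  qed
  also have "\<dots> = trace (matrix ?L ** (W x ** ?V))"
    using trace_mul_sym[of ?V "matrix ?L ** W x"] by (simp add: matrix_mul_assoc)
  also have "\<dots> = (\<Sum>a\<in>UNIV. ?L (axis a 1) $ a)"
    by (simp add: matrix_inv_right[OF invertible_W[OF x]] trace_def matrix_def)
  finally show ?thesis
    using trace_berger_riem[of \<rho> "w j x" "w i x"] pos by simp
qed

theorem scalar_curvature_frame:
  assumes x: "x \<in> U"
  shows "scalar_curvature_coord G x = (2 - \<rho> / 2) / \<alpha>"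
proof -
  let ?A = "\<chi> a b::3. if a = b then if a = 3 then (\<rho> * \<alpha>) else \<alpha> else 0"
  let ?B = "\<chi> a b::3. if a = b then if a = 3 then 1/(\<rho> * \<alpha>) else 1/\<alpha> else 0"
  let ?H = "W x ** matrix_inv (G x) ** transpose (W x)"
  have AB: "?A ** ?B = mat 1"
    using pos by (simp add: vec_eq_iff forall_3 matrix_matrix_mult_def sum_3 mat_def)
  \<comment> \<open>As G is the transpose of W times ?A times W, transporting the inverse of G to
    the frame gives the inverse ?B of the diagonal matrix ?A. Contraction with the inverse metric
    then only sees the diagonal of the Ricci form.\<close>
  have "(?H ** ?A) ** W x = W x ** (matrix_inv (G x) ** G x)"
    by (simp add: G_eq[OF x] matrix_mul_assoc)
  also have "\<dots> = W x" by (simp add: matrix_inv_left[OF invertible_G[OF x]])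
  finally have "?H ** ?A ** W x ** matrix_inv (W x) = W x ** matrix_inv (W x)" by simp
  then have "?H ** ?A = mat 1"
    by (simp add: matrix_inv_right[OF invertible_W[OF x]] flip: matrix_mul_assoc)
  then have "?H ** ?A ** ?B = ?B" by simp
  then have H: "?H = ?B" by (simp add: AB flip: matrix_mul_assoc)
  have Hab: "(\<Sum>i\<in>UNIV. \<Sum>j\<in>UNIV. matrix_inv (G x) $ i $ j * (w j x $ a * w i x $ a)) = ?B $ a $ a" for a
    unfolding H[symmetric]
    by (simp add: matrix_matrix_mult_def transpose_def W_def sum_3 algebra_simps)
  let ?h = "\<lambda>a i j. matrix_inv (G x) $ i $ j * (w j x $ a * w i x $ a)"
  have "matrix_inv (G x) $ i $ j * ricci G i j x
      = (1 - \<rho> / 2) * (?h 1 i j + ?h 2 i j) + \<rho>\<^sup>2 / 2 * ?h 3 i j" for i j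
    by (simp add: ricci_frame[OF x] algebra_simps)
  then have "scalar_curvature_coord G x =
     (1 - \<rho> / 2) * ((\<Sum>i\<in>UNIV. \<Sum>j\<in>UNIV. ?h 1 i j) + (\<Sum>i\<in>UNIV. \<Sum>j\<in>UNIV. ?h 2 i j))
     + \<rho>\<^sup>2 / 2 * (\<Sum>i\<in>UNIV. \<Sum>j\<in>UNIV. ?h 3 i j)"
    unfolding scalar_curvature_coord_def
    by (simp only: sum.distrib sum_distrib_left[symmetric])
  then have "scalar_curvature_coord G x = (1 - \<rho> / 2) * (1 / \<alpha> + 1 / \<alpha>) + \<rho>\<^sup>2 / 2 * (1 / (\<rho> * \<alpha>))"
    by (simp only: Hab) simp
  then show ?thesis
    using pos by (simp add: field_simps power2_eq_square)
qed

end

section \<open>The rotation group\<close>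

lemmas mat3_simps = vec_eq_iff forall_3 sum_3 matrix_matrix_mult_def transpose_def mat_def

lemma bounded_bilinear_matrix_mult: "bounded_bilinear ((**) :: real^3^3 \<Rightarrow> real^3^3 \<Rightarrow> real^3^3)"
  unfolding bilinear_conv_bounded_bilinear[symmetric]
  by (auto simp: bilinear_def linear_iff mat3_simps algebra_simps)

interpretation mm: bounded_bilinear "(**) :: real^3^3 \<Rightarrow> real^3^3 \<Rightarrow> real^3^3"
  by (rule bounded_bilinear_matrix_mult)

lemma bounded_linear_transpose: "bounded_linear (transpose :: real^3^3 \<Rightarrow> real^3^3)"
  unfolding linear_conv_bounded_linear[symmetric] by (auto simp: linear_iff mat3_simps)

text \<open>The matrix of v \<mapsto> \<open>cross3 w v\<close>. It identifies vectors with skew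
  matrices, that is, with the Lie algebra of the rotation group.\<close>

definition hat :: "real^3 \<Rightarrow> real^3^3" where
  "hat w = vector [vector [0, - w$3, w$2], vector [w$3, 0, - w$1], vector [- w$2, w$1, 0]]"

definition vee :: "real^3^3 \<Rightarrow> real^3" where
  "vee A = vector [A$3$2, A$1$3, A$2$1]"

lemma bounded_linear_hat: "bounded_linear hat"
  unfolding linear_conv_bounded_linear[symmetric] by (auto simp: linear_iff hat_def mat3_simps)

lemma bounded_linear_vee: "bounded_linear vee"
  unfolding linear_conv_bounded_linear[symmetric] by (auto simp: linear_iff vee_def mat3_simps)

lemmas linear_hat = bounded_linear.linear[OF bounded_linear_hat]
lemmas linear_vee = bounded_linear.linear[OF bounded_linear_vee]
lemmas hat_lin = linear_add[OF linear_hat] linear_cmul[OF linear_hat] linear_0[OF linear_hat]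
  linear_sum[OF linear_hat]
lemmas vee_lin = linear_add[OF linear_vee] linear_diff[OF linear_vee] linear_neg[OF linear_vee]

lemma vee_hat [simp]: "vee (hat w) = w"
  by (simp add: vee_def hat_def mat3_simps)

lemma hat_vee:
  assumes "transpose A = - A"
  shows "hat (vee A) = A"
proof -
  have A: "A $ j $ i = - A $ i $ j" for i j
    using arg_cong[OF assms, of "\<lambda>B. B $ i $ j"] by (simp add: transpose_def)
  have "A $ i $ i = 0" for i
    using A[of i i] by linarith
  then show ?thesis
    using A[of 1 2] A[of 1 3] A[of 2 3]
    by (simp add: vee_def hat_def vec_eq_iff forall_3)
qed

lemma transpose_hat: "transpose (hat w) = - hat w"
  by (simp add: hat_def mat3_simps)

lemma hat_cross3: "hat (cross3 u v) = hat u ** hat v - hat v ** hat u"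
  by (simp add: hat_def cross3_def mat3_simps algebra_simps)

lemma SO3_iff: "p \<in> SO3 \<longleftrightarrow> transpose p ** p = mat 1 \<and> p ** transpose p = mat 1 \<and> det p = 1"
  by (auto simp: SO3_def rotation_matrix_def orthogonal_matrix_def)

lemma SO3_cancel:
  assumes "p \<in> SO3"
  shows "transpose p ** (p ** A) = A" "p ** (transpose p ** A) = A"
    "A ** transpose p ** p = A" "A ** p ** transpose p = A"
  using assms by (simp_all add: SO3_iff matrix_mul_assoc) (simp_all add: SO3_iff flip: matrix_mul_assoc)

lemma SO3_mult: "p \<in> SO3 \<Longrightarrow> q \<in> SO3 \<Longrightarrow> p ** q \<in> SO3"
  unfolding SO3_def rotation_matrix_def by (auto simp: orthogonal_matrix_mul det_mul)

lemma SO3_transpose: "p \<in> SO3 \<Longrightarrow> transpose p \<in> SO3"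
  by (auto simp: SO3_iff det_transpose)

lemma SO3_mat_1: "mat 1 \<in> SO3"
  by (simp add: SO3_iff)

definition R1 :: "real \<Rightarrow> real^3^3" where
  "R1 a = vector [vector [1, 0, 0], vector [0, cos a, - sin a], vector [0, sin a, cos a]]"

lemma SO3_R: "R1 a \<in> SO3" "R2 a \<in> SO3" "R3 a \<in> SO3"
  by (auto simp: SO3_iff R1_def R2_def R3_def mat3_simps det_3 simp flip: power2_eq_square)

lemma transpose_R2: "transpose (R2 a) = R2 (- a)"
  by (simp add: R2_def mat3_simps)

lemma R_0 [simp]: "R1 0 = mat 1" "R2 0 = mat 1" "R3 0 = mat 1"
  by (simp_all add: R1_def R2_def R3_def mat3_simps)

lemma SO3_euler: "euler x \<in> SO3"
  unfolding euler_def by (intro SO3_mult SO3_R)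

lemma R_harmonic:
  "R1 a = cos a *\<^sub>R vector [0, axis 2 1, axis 3 1] + sin a *\<^sub>R hat (axis 1 1) + vector [axis 1 1, 0, 0]"
  "R2 a = cos a *\<^sub>R vector [axis 1 1, 0, axis 3 1] + sin a *\<^sub>R hat (axis 2 1) + vector [0, axis 2 1, 0]"
  "R3 a = cos a *\<^sub>R vector [axis 1 1, axis 2 1, 0] + sin a *\<^sub>R hat (axis 3 1) + vector [0, 0, axis 3 1]"
  by (simp_all add: R1_def R2_def R3_def hat_def mat3_simps axis_def)

lemma smooth_R:
  "smooth_on_open UNIV (\<lambda>t. R1 (w * t))" "smooth_on_open UNIV (\<lambda>t. R2 (w * t))"
  "smooth_on_open UNIV (\<lambda>t. R3 (w * t))"
  unfolding R_harmonic by (rule smooth_harmonic)+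

lemma R_deriv:
  "(R1 has_vector_derivative R1 a ** hat (axis 1 1)) (at a)"
  "(R2 has_vector_derivative R2 a ** hat (axis 2 1)) (at a)"
  "(R3 has_vector_derivative R3 a ** hat (axis 3 1)) (at a)"
proof -
  have D: "((\<lambda>a. cos a *\<^sub>R A + sin a *\<^sub>R B + C) has_vector_derivative - sin a *\<^sub>R A + cos a *\<^sub>R B) (at a)"
    for A B C :: "real^3^3"
    by (auto intro!: derivative_eq_intros)
  have "(R1 has_vector_derivative - sin a *\<^sub>R vector [0, axis 2 1, axis 3 1] + cos a *\<^sub>R hat (axis 1 1)) (at a)"
    "(R2 has_vector_derivative - sin a *\<^sub>R vector [axis 1 1, 0, axis 3 1] + cos a *\<^sub>R hat (axis 2 1)) (at a)"
    "(R3 has_vector_derivative - sin a *\<^sub>R vector [axis 1 1, axis 2 1, 0] + cos a *\<^sub>R hat (axis 3 1)) (at a)"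
    unfolding R_harmonic[abs_def] by (rule D)+
  moreover have "R1 a ** hat (axis 1 1) = - sin a *\<^sub>R vector [0, axis 2 1, axis 3 1] + cos a *\<^sub>R hat (axis 1 1)"
    "R2 a ** hat (axis 2 1) = - sin a *\<^sub>R vector [axis 1 1, 0, axis 3 1] + cos a *\<^sub>R hat (axis 2 1)"
    "R3 a ** hat (axis 3 1) = - sin a *\<^sub>R vector [axis 1 1, axis 2 1, 0] + cos a *\<^sub>R hat (axis 3 1)"
    by (simp_all add: R1_def R2_def R3_def hat_def mat3_simps axis_def)
  ultimately show "(R1 has_vector_derivative R1 a ** hat (axis 1 1)) (at a)"
    "(R2 has_vector_derivative R2 a ** hat (axis 2 1)) (at a)"
    "(R3 has_vector_derivative R3 a ** hat (axis 3 1)) (at a)"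
    by simp_all
qed

subsection \<open>Tangent vectors\<close>

text \<open>Differentiating the constant product of F with its transpose shows that the transpose of
  F x times \<open>F' v\<close> is skew, hence a value of \<open>hat\<close>.\<close>

lemma SO3_derivative:
  assumes F: "(F has_derivative F') (at x)" and U: "open U" "x \<in> U" "F ` U \<subseteq> SO3"
  shows "F' v = F x ** hat (vee (transpose (F x) ** F' v))"
proof -
  have x: "F x \<in> SO3" using U by auto
  have "((\<lambda>y. transpose (F y) ** F y) has_derivative
      (\<lambda>v. transpose (F x) ** F' v + transpose (F' v) ** F x)) (at x)"
    by (rule mm.FDERIV[OF bounded_linear.has_derivative[OF bounded_linear_transpose F] F])
  moreover have "((\<lambda>y. transpose (F y) ** F y) has_derivative (\<lambda>v. 0)) (at x)"
    by (rule has_derivative_transform_within_open[OF has_derivative_const[of "mat 1"] U(1,2)])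
      (use U(3) in \<open>auto simp: SO3_iff\<close>)
  ultimately have "transpose (F x) ** F' v + transpose (F' v) ** F x = 0"
    using has_derivative_unique by (metis (no_types, lifting))
  then have "transpose (transpose (F x) ** F' v) = - (transpose (F x) ** F' v)"
    by (simp add: matrix_transpose_mul add_eq_0_iff)
  then have "hat (vee (transpose (F x) ** F' v)) = transpose (F x) ** F' v" by (rule hat_vee)
  then show ?thesis by (simp add: SO3_cancel[OF x])
qed

lemma tangent_SO3_eq:
  assumes p: "p \<in> SO3"
  shows "tangent_SO3 p = range (\<lambda>w. p ** hat w)"
proof (intro subset_antisym subsetI)
  fix v assume "v \<in> tangent_SO3 p"
  then obtain c where "\<forall>t. c t \<in> SO3" "c 0 = p" "(c has_vector_derivative v) (at 0)"
    unfolding tangent_SO3_def by auto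
  then show "v \<in> range (\<lambda>w. p ** hat w)"
    using SO3_derivative[of c "\<lambda>t. t *\<^sub>R v" 0 UNIV 1]
    by (auto simp: has_vector_derivative_def)
next
  fix v assume "v \<in> range (\<lambda>w. p ** hat w)"
  then obtain w where w: "v = p ** hat w" by auto
  \<comment> \<open>A substitute for the exponential curve p exp(t \<open>hat w\<close>): it has the
    same velocity at 0, and stays in the group because its factors do.\<close>
  define c where "c = (\<lambda>t. p ** (R1 (w$1 * t) ** (R2 (w$2 * t) ** R3 (w$3 * t))))"
  have 1: "\<forall>t. c t \<in> SO3" unfolding c_def by (auto intro!: SO3_mult p SO3_R)
  have 2: "smooth_on_open UNIV c"
    unfolding c_def by (intro smooth_bilinear[OF bounded_bilinear_matrix_mult] smooth_const smooth_R open_UNIV)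
  have scale: "((\<lambda>t. f (a * t)) has_derivative (\<lambda>t. t *\<^sub>R (a *\<^sub>R D))) (at 0)"
    if "(f has_vector_derivative D) (at 0)" for f :: "real \<Rightarrow> real^3^3" and D a
  proof -
    have "((\<lambda>t. a * t) has_derivative (\<lambda>t. a * t)) (at 0)" by (auto intro!: derivative_eq_intros)
    from has_derivative_compose[OF this, of f "\<lambda>t. t *\<^sub>R D"] that show ?thesis
      by (simp add: has_vector_derivative_def mult.commute)
  qed
  have d: "((\<lambda>t. R1 (a * t)) has_derivative (\<lambda>t. t *\<^sub>R (a *\<^sub>R hat (axis 1 1)))) (at 0)"
     "((\<lambda>t. R2 (a * t)) has_derivative (\<lambda>t. t *\<^sub>R (a *\<^sub>R hat (axis 2 1)))) (at 0)"
     "((\<lambda>t. R3 (a * t)) has_derivative (\<lambda>t. t *\<^sub>R (a *\<^sub>R hat (axis 3 1)))) (at 0)" for a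
    using scale[OF R_deriv(1)] scale[OF R_deriv(2)] scale[OF R_deriv(3)] by simp_all
  have "(c has_derivative (\<lambda>t. t *\<^sub>R (p ** (w$1 *\<^sub>R hat (axis 1 1) + w$2 *\<^sub>R hat (axis 2 1) + w$3 *\<^sub>R hat (axis 3 1))))) (at 0)"
    unfolding c_def
    by (rule has_derivative_eq_rhs[OF mm.FDERIV[OF has_derivative_const mm.FDERIV[OF d(1) mm.FDERIV[OF d(2,3)]]]])
      (simp add: mm.scaleR_right mm.add_right algebra_simps)
  also have "w$1 *\<^sub>R hat (axis 1 1) + w$2 *\<^sub>R hat (axis 2 1) + w$3 *\<^sub>R hat (axis 3 1) = hat w"
    by (simp add: hat_def mat3_simps axis_def)
  finally have "(c has_vector_derivative v) (at 0)" by (simp add: w has_vector_derivative_def)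
  moreover have "c 0 = p" by (simp add: c_def)
  ultimately show "v \<in> tangent_SO3 p" unfolding tangent_SO3_def using 1 2 by blast
qed

subsection \<open>Left-invariant metrics\<close>

definition left_berger :: "SO3_metric \<Rightarrow> real \<Rightarrow> real \<Rightarrow> bool" where
  "left_berger h \<alpha> \<beta> \<longleftrightarrow> (\<forall>p\<in>SO3. \<forall>u v. h p (p ** hat u) (p ** hat v) = berger \<alpha> \<beta> u v)"

lemma left_berger_standard: "left_berger standard_metric 1 1"
proof -
  have "trace (transpose (p ** hat u) ** (p ** hat v)) = trace (transpose (hat u) ** hat v)"
    if "p \<in> SO3" for p u v
    by (simp add: matrix_transpose_mul SO3_cancel[OF that] flip: matrix_mul_assoc)
  then show ?thesis
    by (simp add: left_berger_def standard_metric_def trace_def hat_def berger_def mat3_simps)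
qed

text \<open>Instances of hat(u) R = R hat(R^T u). They carry the generator produced by
  differentiating an inner factor of \<open>euler\<close> to the right end, where it becomes a body
  velocity.\<close>

lemma hat_mult_R:
  "hat (axis 2 1) ** R3 b = R3 b ** hat (vector [sin b, cos b, 0])"
  "hat (axis 3 1) ** R2 a ** R3 b = R2 a ** R3 b ** hat (vector [- sin a * cos b, sin a * sin b, cos a])"
proof -
  have 0: "x = y * y * x + z * z * x" if "y\<^sup>2 + z\<^sup>2 = 1" for x y z :: real
    using that by (metis distrib_right mult_1 power2_eq_square)
  show "hat (axis 2 1) ** R3 b = R3 b ** hat (vector [sin b, cos b, 0])"
    by (simp add: hat_def R3_def axis_def mat3_simps flip: power2_eq_square)
  show "hat (axis 3 1) ** R2 a ** R3 b = R2 a ** R3 b ** hat (vector [- sin a * cos b, sin a * sin b, cos a])"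
    using 0[of "sin a" "cos a" "sin b"] 0[of "sin a" "cos a" "cos b"]
      0[of "sin b" "cos b" "sin a"] 
    by (simp add: hat_def R3_def R2_def axis_def mat3_simps algebra_simps)
qed

definition euler_body :: "3 \<Rightarrow> real^3 \<Rightarrow> real^3" where
  "euler_body i x = (if i = 1 then vector [- sin (x$2) * cos (x$3), sin (x$2) * sin (x$3), cos (x$2)]
     else if i = 2 then vector [sin (x$3), cos (x$3), 0] else axis 3 1)"

lemma partial_euler: "partial i euler x = euler x ** hat (euler_body i x)"
proof -
  have d: "((\<lambda>x. R2 (x$k)) has_derivative (\<lambda>v. v$k *\<^sub>R (R2 (x$k) ** hat (axis 2 1)))) (at x)"
     "((\<lambda>x. R3 (x$k)) has_derivative (\<lambda>v. v$k *\<^sub>R (R3 (x$k) ** hat (axis 3 1)))) (at x)" for k and x :: "real^3"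
    using has_derivative_compose[OF bounded_linear_imp_has_derivative[OF bounded_linear_vec_nth]
        R_deriv(2)[unfolded has_vector_derivative_def]]
      has_derivative_compose[OF bounded_linear_imp_has_derivative[OF bounded_linear_vec_nth]
        R_deriv(3)[unfolded has_vector_derivative_def]] by blast+
  have "partial i euler x = R3 (x$1) ** R2 (x$2) ** (axis i 1 $ 3 *\<^sub>R (R3 (x$3) ** hat (axis 3 1)))
     + (R3 (x$1) ** (axis i 1 $ 2 *\<^sub>R (R2 (x$2) ** hat (axis 2 1)))
        + (axis i 1 $ 1 *\<^sub>R (R3 (x$1) ** hat (axis 3 1))) ** R2 (x$2)) ** R3 (x$3)"
    unfolding partial_def euler_def
    by (rule frechet_derivative_eqI) (rule mm.FDERIV[OF mm.FDERIV[OF d(2) d(1)] d(2)])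
  then show ?thesis
    using exhaust_3[of i] hat_mult_R[of "x$3"] hat_mult_R(2)[of "x$2" "x$3"]
    by (auto simp: euler_body_def euler_def axis_def simp flip: matrix_mul_assoc)
qed

lemma gram_euler:
  assumes "left_berger h (\<xi>\<^sup>2) (s\<^sup>2)"
  shows "gram h euler x = Sigma_mat \<xi> s (x$2)"
proof -
  have 0: "a * (sin b * (sin b * c)) + a * (cos b * (cos b * c)) = a * c" for a b c :: real
    by (metis (no_types) distrib_left distrib_right mult.assoc mult_1 power2_eq_square sin_cos_squared_add)
  have "gram h euler x $ i $ j = berger (\<xi>\<^sup>2) (s\<^sup>2) (euler_body i x) (euler_body j x)" for i j
    using assms SO3_euler by (simp add: gram_def partial_euler left_berger_def)
  then show ?thesis
    using 0[of "\<xi> * \<xi>" "x$3" "sin (x$2) * sin (x$2)"] 0[of "\<xi> * \<xi>" "x$3" 1]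
    by (simp add: vec_eq_iff forall_3 Sigma_mat_def euler_body_def berger_def axis_def
        power2_eq_square algebra_simps)
qed

lemma span_range_tangent:
  assumes "p \<in> SO3"
  shows "span (range (\<lambda>i. p ** hat (axis i 1))) = tangent_SO3 p"
proof -
  have l: "linear (\<lambda>w. p ** hat w)"
    by (simp add: linear_iff hat_lin mm.add_right mm.scaleR_right)
  have "span (range (\<lambda>i::3. axis i (1::real))) = UNIV"
    using span_Basis[where 'a="real^3"] by (simp add: Basis_vec_def full_SetCompr_eq UNION_singleton_eq_range)
  then show ?thesis
    using linear_span_image[OF l, of "range (\<lambda>i. axis i 1)"]
    by (simp add: tangent_SO3_eq[OF assms] image_image)
qed

text \<open>The body components of a basis orthonormal for the standard metric form an orthogonal
  matrix V, so the matrix of h is V^T diag(\<alpha>, \<alpha>, \<beta>) V and its characteristic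
  polynomial is that of the diagonal.\<close>

lemma eigenvalues_left_berger:
  assumes h: "left_berger h \<alpha> \<beta>" and p: "p \<in> SO3"
  shows "eigenvalues_wrt h standard_metric p \<alpha> \<alpha> \<beta>"
  unfolding eigenvalues_wrt_def
proof (intro conjI allI impI)
  have "orthonormal_basis_at standard_metric p (\<lambda>i. p ** hat (axis i 1))"
    using left_berger_standard p span_range_tangent[OF p]
    by (auto simp: orthonormal_basis_at_def left_berger_def berger_def axis_def forall_3)
  then show "\<exists>e. orthonormal_basis_at standard_metric p e" by blast
next
  fix e assume e: "orthonormal_basis_at standard_metric p e"
  then have "e i \<in> range (\<lambda>w. p ** hat w)" for i
    unfolding orthonormal_basis_at_def tangent_SO3_eq[OF p, symmetric] by (auto intro: span_base)
  then have "\<forall>i. \<exists>u. e i = p ** hat u" by blast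
  then obtain u where u: "\<And>i. e i = p ** hat (u i)" by metis
  define V where "V = (\<chi> a i. u i $ a)"
  have b: "berger 1 1 (u i) (u j) = (if i = j then 1 else 0)" for i j
    using e left_berger_standard p by (simp add: orthonormal_basis_at_def left_berger_def u)
  then have "transpose V ** V = mat 1"
    by (simp add: V_def berger_def mat3_simps)
  then have d: "det V * det V = 1"
    by (metis det_I det_mul det_transpose)
  show "has_eigenvalues (\<chi> i j. h p (e i) (e j)) \<alpha> \<alpha> \<beta>"
    unfolding has_eigenvalues_def
  proof
    fix t
    let ?T = "\<chi> a b::3. if a = b then if a = 3 then t - \<beta> else t - \<alpha> else 0"
    have "(mat t - (\<chi> i j. h p (e i) (e j))) $ i $ j = (transpose V ** ?T ** V) $ i $ j" for i j
    proof -
      have "(mat t - (\<chi> i j. h p (e i) (e j))) $ i $ j = t * berger 1 1 (u i) (u j) - berger \<alpha> \<beta> (u i) (u j)"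
        using h p b by (simp add: u left_berger_def mat_def)
      then show ?thesis
        by (simp add: V_def berger_def matrix_matrix_mult_def transpose_def sum_3 algebra_simps)
    qed
    then have "mat t - (\<chi> i j. h p (e i) (e j)) = transpose V ** ?T ** V"
      by (simp add: vec_eq_iff)
    moreover have "det ?T = (t - \<alpha>) * (t - \<alpha>) * (t - \<beta>)" by (simp add: det_3)
    ultimately show "det (mat t - (\<chi> i j. h p (e i) (e j))) = (t - \<alpha>) * (t - \<alpha>) * (t - \<beta>)"
      using d by (simp add: det_mul)
  qed
qed

text \<open>The frame is the pullback of the left Maurer-Cartan form. In its exterior derivative the
  second partial derivatives of the chart cancel, and the remaining products form a commutator,
  hence a cross product by \<open>hat_cross3\<close>. Injectivity of the derivative of the chart
  makes the frame matrix invertible.\<close>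

lemma local_param_frame:
  assumes \<Psi>: "local_param U \<Psi>" and h: "left_berger h \<alpha> (\<rho> * \<alpha>)" and pos: "\<alpha> > 0" "\<rho> > 0"
  shows "berger_frame U (\<lambda>j y. vee (transpose (\<Psi> y) ** partial j \<Psi> y)) \<alpha> \<rho> (gram h \<Psi>)"
proof -
  let ?w = "\<lambda>j y. vee (transpose (\<Psi> y) ** partial j \<Psi> y)"
  have U: "open U" and sm: "smooth_on_open U \<Psi>" and im: "\<Psi> ` U \<subseteq> SO3"
    and inj: "\<And>x. x \<in> U \<Longrightarrow> inj (frechet_derivative \<Psi> (at x))"
    using \<Psi> by (auto simp: local_param_def)
  have w: "frechet_derivative \<Psi> (at x) v = \<Psi> x ** hat (vee (transpose (\<Psi> x) ** frechet_derivative \<Psi> (at x) v))"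
    if "x \<in> U" for x v
    by (rule SO3_derivative[OF smooth_has_derivative[OF sm that] U that im])
  have pw: "partial j \<Psi> x = \<Psi> x ** hat (?w j x)" if "x \<in> U" for j x
    unfolding partial_def by (rule w[OF that])
  show ?thesis
  proof
    show "smooth_on_open U (?w j)" for j
      by (intro smooth_linear[OF bounded_linear_vee U] smooth_bilinear[OF bounded_bilinear_matrix_mult U]
        smooth_linear[OF bounded_linear_transpose U] sm smooth_partial)
  next
    fix x i j assume x: "x \<in> U"
    have t: "partial i (\<lambda>y. transpose (\<Psi> y)) x = transpose (partial i \<Psi> x)" for i
      by (rule partial_linear[where h=transpose and f=\<Psi> and i=i, OF bounded_linear_transpose smooth_imp_differentiable[OF sm x]])
    have T: "transpose (partial i \<Psi> x) ** partial j \<Psi> x = - (hat (?w i x) ** hat (?w j x))" for i j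
    proof -
      have "\<Psi> x \<in> SO3" using im x by auto
      have "transpose (partial i \<Psi> x) ** partial j \<Psi> x
        = transpose (\<Psi> x ** hat (?w i x)) ** (\<Psi> x ** hat (?w j x))"
        by (simp only: pw[OF x, symmetric])
      also have "\<dots> = - (hat (?w i x) ** hat (?w j x))"
        by (simp add: matrix_transpose_mul SO3_cancel[OF \<open>\<Psi> x \<in> SO3\<close>] transpose_hat mm.minus_left
            flip: matrix_mul_assoc)
      finally show ?thesis .
    qed
    have "partial i (?w j) x = vee (transpose (\<Psi> x) ** partial i (partial j \<Psi>) x
        + transpose (partial i \<Psi> x) ** partial j \<Psi> x)" for i j
    proof -
      have s1: "smooth_on_open U (\<lambda>y. transpose (\<Psi> y))"
        by (rule smooth_linear[OF bounded_linear_transpose U sm])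
      have s2: "smooth_on_open U (\<lambda>y. transpose (\<Psi> y) ** partial j \<Psi> y)"
        by (rule smooth_bilinear[OF bounded_bilinear_matrix_mult U s1 smooth_partial[OF sm]])
      show ?thesis
        using partial_linear[OF bounded_linear_vee smooth_imp_differentiable[OF s2 x], of i]
          partial_bilinear[OF bounded_bilinear_matrix_mult smooth_imp_differentiable[OF s1 x]
            smooth_imp_differentiable[OF smooth_partial[OF sm] x], of i j]
        by (simp add: t)
    qed
    then have "partial i (?w j) x - partial j (?w i) x
        = vee (transpose (partial i \<Psi> x) ** partial j \<Psi> x - transpose (partial j \<Psi> x) ** partial i \<Psi> x)"
      by (simp add: partial_commute[OF sm U x, of i j] vee_lin)
    also have "\<dots> = vee (- hat (cross3 (?w i x) (?w j x)))"
      by (simp only: T hat_cross3) simp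
    finally show "partial i (?w j) x - partial j (?w i) x = - cross3 (?w i x) (?w j x)"
      by (simp add: vee_lin)
  next
    fix x assume x: "x \<in> U"
    let ?W = "\<chi> a j. ?w j x $ a"
    have l: "linear (frechet_derivative \<Psi> (at x))"
      using smooth_has_derivative[OF sm x] has_derivative_linear by blast
    have "t = 0" if t: "?W *v t = 0" for t
    proof -
      have "t = (\<Sum>k\<in>UNIV. t $ k *\<^sub>R axis k 1)"
        by (simp add: vec_eq_iff axis_def sum.delta if_distrib cong: if_cong)
      then have "frechet_derivative \<Psi> (at x) t = (\<Sum>k\<in>UNIV. t $ k *\<^sub>R partial k \<Psi> x)"
        unfolding partial_def using linear_sum[OF l] linear_cmul[OF l]
        by (metis (no_types, lifting) sum.cong)
      also have "\<dots> = (\<Sum>k\<in>UNIV. t $ k *\<^sub>R (\<Psi> x ** hat (?w k x)))"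
        by (simp only: pw[OF x, symmetric])
      also have "\<dots> = \<Psi> x ** hat (\<Sum>k\<in>UNIV. t $ k *\<^sub>R ?w k x)"
        by (simp add: hat_lin mm.sum_right mm.scaleR_right)
      also have "(\<Sum>k\<in>UNIV. t $ k *\<^sub>R ?w k x) = ?W *v t"
        by (simp add: vec_eq_iff matrix_vector_mult_def mult.commute)
      finally have "frechet_derivative \<Psi> (at x) t = frechet_derivative \<Psi> (at x) 0"
        using t linear_0[OF l] by (simp add: hat_lin mm.zero_right)
      then show "t = 0" using inj[OF x] by (simp add: inj_def)
    qed
    then have "\<exists>B. B ** ?W = mat 1" by (simp add: matrix_left_invertible_ker)
    then show "det ?W \<noteq> 0" by (simp add: invertible_left_inverse flip: invertible_det_nz)
  next
    fix x i j assume x: "x \<in> U"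
    then have "gram h \<Psi> x $ i $ j = h (\<Psi> x) (\<Psi> x ** hat (?w i x)) (\<Psi> x ** hat (?w j x))"
      by (simp only: pw[OF x, symmetric] gram_def) simp
    then show "gram h \<Psi> x $ i $ j = berger \<alpha> (\<rho> * \<alpha>) (?w i x) (?w j x)"
      using h im x by (auto simp: left_berger_def)
  qed (use U pos in auto)
qed

lemma scalar_curvature_left_berger:
  assumes h: "left_berger h \<alpha> \<beta>" and pos: "\<alpha> > 0" "\<beta> > 0"
  shows "scalar_curvature_at h p (2 / \<alpha> - \<beta> / (2 * \<alpha>\<^sup>2))"
  unfolding scalar_curvature_at_def
proof (intro allI impI)
  fix U \<Psi> x assume "local_param U \<Psi> \<and> x \<in> U \<and> \<Psi> x = p"
  then interpret berger_frame U "\<lambda>j y. vee (transpose (\<Psi> y) ** partial j \<Psi> y)" \<alpha> "\<beta> / \<alpha>" "gram h \<Psi>"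
    using local_param_frame[of U \<Psi> h \<alpha> "\<beta> / \<alpha>"] h pos by simp
  show "scalar_curvature_coord (gram h \<Psi>) x = 2 / \<alpha> - \<beta> / (2 * \<alpha>\<^sup>2)"
    using scalar_curvature_frame[of x] \<open>local_param U \<Psi> \<and> x \<in> U \<and> \<Psi> x = p\<close> pos
    by (simp add: field_simps power2_eq_square)
qed

section \<open>Axis-angle and Euler decompositions of a rotation\<close>

lemma SO3_stabilizer_e3:
  assumes q: "q \<in> SO3" and e: "q *v axis 3 1 = axis 3 1"
  obtains \<omega> where "q = R3 \<omega>"
proof -
  have z: "q $ 1 $ 3 = 0" "q $ 2 $ 3 = 0" "q $ 3 $ 3 = 1"
    using e by (auto simp: vec_eq_iff matrix_vector_mult_def sum_3 axis_def dest: spec[of _ 1] spec[of _ 2] spec[of _ 3])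
  have r: "q ** transpose q = mat 1" "det q = 1" using q by (auto simp: SO3_iff)
  \<comment> \<open>The third row is a unit vector whose last entry is 1, so q splits into a planar
    rotation and the entry 1.\<close>
  have "q $ 3 $ 1 * q $ 3 $ 1 + q $ 3 $ 2 * q $ 3 $ 2 = 0"
    using arg_cong[OF r(1), of "\<lambda>A. A $ 3 $ 3"] z by (simp add: matrix_matrix_mult_def transpose_def sum_3 mat_def)
  then have z3: "q $ 3 $ 1 = 0" "q $ 3 $ 2 = 0"
    by (auto simp: add_nonneg_eq_0_iff)
  have r1: "q $ 1 $ 1 * q $ 1 $ 1 + q $ 1 $ 2 * q $ 1 $ 2 = 1"
    "q $ 1 $ 1 * q $ 2 $ 1 + q $ 1 $ 2 * q $ 2 $ 2 = 0"
    using arg_cong[OF r(1), of "\<lambda>A. A $ 1 $ 1"] arg_cong[OF r(1), of "\<lambda>A. A $ 1 $ 2"] z z3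
    by (simp_all add: matrix_matrix_mult_def transpose_def sum_3 mat_def)
  have d: "q $ 1 $ 1 * q $ 2 $ 2 - q $ 1 $ 2 * q $ 2 $ 1 = 1"
    using r(2) z z3 by (simp add: det_3)
  have a: "q $ 2 $ 2 = q $ 1 $ 1" using r1 d by algebra
  have b: "q $ 2 $ 1 = - q $ 1 $ 2" using r1 d by algebra
  have "(q $ 1 $ 1)\<^sup>2 + (- q $ 1 $ 2)\<^sup>2 = 1" using r1 by (simp add: power2_eq_square)
  then obtain t where "q $ 1 $ 1 = cos t" "- q $ 1 $ 2 = sin t"
    using sincos_total_2pi by metis
  then have "q = R3 t" using z z3 a b by (simp add: R3_def vec_eq_iff forall_3)
  then show thesis by (rule that)
qed

text \<open>Euler's rotation theorem. Since q - 1 = q (1 - q)^T, the determinants of q - 1 and 1 - q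
  agree; in odd dimension they are also opposite, so q fixes an axis. Rotating the third axis to it
  turns q into some R3, and the trace survives the conjugation.\<close>

lemma SO3_conj_R3:
  assumes q: "q \<in> SO3"
  obtains A \<omega> where "A \<in> SO3" "q = A ** R3 \<omega> ** transpose A" "trace q = 1 + 2 * cos \<omega>"
proof -
  have "q - mat 1 = q ** transpose (mat 1 - q)"
    using q by (simp add: SO3_iff linear_diff[OF bounded_linear.linear[OF bounded_linear_transpose]] mm.diff_right)
  then have "det (q - mat 1) = det (mat 1 - q)"
    using q by (metis SO3_iff det_mul det_transpose mult_1)
  moreover have "det (mat 1 - q) = - det (q - mat 1)"
    by (simp add: det_3 algebra_simps)
  ultimately have "det (q - mat 1) = 0" by simp
  then have "\<not> (\<exists>B. B ** (q - mat 1) = mat 1)"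
    by (metis invertible_det_nz invertible_left_inverse)
  then obtain v where v: "v \<noteq> 0" "(q - mat 1) *v v = 0"
    by (auto simp: matrix_left_invertible_ker)
  define a where "a = v /\<^sub>R norm v"
  have a: "norm a = 1" "q *v a = a"
    using v by (auto simp: a_def matrix_vector_mult_diff_rdistrib matrix_vector_mult_scaleR)
  obtain A where A: "rotation_matrix A" "A *v axis 3 1 = a"
    using rotation_matrix_exists_basis[of a 3] a by auto
  have AS: "A \<in> SO3" using A by (simp add: SO3_def)
  have "transpose A ** q ** A \<in> SO3" by (intro SO3_mult SO3_transpose AS q)
  moreover have "(transpose A ** q ** A) *v axis 3 1 = axis 3 1"
    using A(2) a AS by (metis SO3_iff matrix_vector_mul_assoc matrix_vector_mul_lid)
  ultimately obtain w where w: "transpose A ** q ** A = R3 w" by (rule SO3_stabilizer_e3)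
  have q': "q = A ** R3 w ** transpose A"
    using AS unfolding w[symmetric] by (simp add: SO3_cancel(2)[OF AS] SO3_iff flip: matrix_mul_assoc)
  moreover have "trace q = 1 + 2 * cos w"
  proof -
    have "trace q = trace (transpose A ** (A ** R3 w))"
      unfolding q' by (rule trace_mul_sym)
    also have "\<dots> = trace (R3 w)" by (simp add: SO3_cancel[OF AS])
    finally show ?thesis by (simp add: trace_def sum_3 R3_def)
  qed
  ultimately show thesis using that AS by blast
qed

text \<open>The first two angles are the azimuth and the polar angle of the image of the third axis;
  what remains of q fixes that axis and is an R3. At the poles the azimuth is arbitrary and set to
  0.\<close>

lemma euler_surj:
  assumes q: "q \<in> SO3"
  obtains x where "q = euler x" "0 \<le> x $ 2" "x $ 2 \<le> pi"
proof -
  let ?a = "q $ 1 $ 3" and ?b = "q $ 2 $ 3" and ?c = "q $ 3 $ 3"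
  have r: "transpose q ** q = mat 1" using q by (auto simp: SO3_iff)
  have n: "?a\<^sup>2 + ?b\<^sup>2 + ?c\<^sup>2 = 1"
    using arg_cong[OF r, of "\<lambda>A. A $ 3 $ 3"]
    by (simp add: matrix_matrix_mult_def transpose_def sum_3 mat_def power2_eq_square)
  then have "?c\<^sup>2 \<le> 1"
    using zero_le_power2[of ?a] zero_le_power2[of ?b] by linarith
  then have c: "\<bar>?c\<bar> \<le> 1" by (simp add: abs_square_le_1)
  define t where "t = arccos ?c"
  have t: "0 \<le> t" "t \<le> pi" "cos t = ?c"
    using c by (auto simp: t_def arccos_lbound arccos_ubound cos_arccos_abs)
  have st: "(sin t)\<^sup>2 = ?a\<^sup>2 + ?b\<^sup>2" using n t by (simp add: sin_squared_eq)
  obtain f where f: "?a = sin t * cos f" "?b = sin t * sin f"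
  proof (cases "sin t = 0")
    case True
    then have "?a = 0" "?b = 0" using st by (auto simp: add_nonneg_eq_0_iff sum_power2_eq_zero_iff)
    then show thesis using that[of 0] True by simp
  next
    case False
    then have "(?a / sin t)\<^sup>2 + (?b / sin t)\<^sup>2 = 1"
      by (simp add: power_divide st[symmetric] add_divide_distrib[symmetric])
    then obtain f where "?a / sin t = cos f" "?b / sin t = sin f" using sincos_total_2pi by metis
    then show thesis using that[of f] False by (simp add: field_simps)
  qed
  define m where "m = R3 f ** R2 t"
  have mS: "m \<in> SO3" unfolding m_def by (intro SO3_mult SO3_R)
  have e3: "q *v axis 3 1 = m *v axis 3 1"
    using f t by (simp add: m_def vec_eq_iff forall_3 matrix_vector_mult_def sum_3 axis_def
        matrix_matrix_mult_def R3_def R2_def mult.commute)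
  have "transpose m ** q \<in> SO3" by (intro SO3_mult SO3_transpose mS q)
  moreover have "(transpose m ** q) *v axis 3 1 = axis 3 1"
    using e3 mS by (metis SO3_iff matrix_vector_mul_assoc matrix_vector_mul_lid)
  ultimately obtain w where w: "transpose m ** q = R3 w" by (rule SO3_stabilizer_e3)
  have "q = m ** R3 w" by (simp add: SO3_cancel[OF mS] flip: w)
  then have "q = euler (vector [f, t, w])" by (simp add: euler_def m_def)
  then show thesis using that t by (metis vector_3(2))
qed

section \<open>Chebyshev polynomials\<close>

text \<open>\<open>chebC n\<close> is the Chebyshev polynomial of the first kind, \<open>chebS n\<close> the one of the second kind
  with index \<open>n - 1\<close>; the recursion is the addition theorem.\<close>

fun chebC :: "nat \<Rightarrow> real \<Rightarrow> real" and chebS :: "nat \<Rightarrow> real \<Rightarrow> real" where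
  "chebC 0 y = 1"
| "chebC (Suc n) y = y * chebC n y - (1 - y\<^sup>2) * chebS n y"
| "chebS 0 y = 0"
| "chebS (Suc n) y = y * chebS n y + chebC n y"

lemma cheb_cos: "chebC n (cos x) = cos (real n * x) \<and> chebS n (cos x) * sin x = sin (real n * x)"
proof (induction n)
  case (Suc n)
  have 1: "1 - (cos x)\<^sup>2 = sin x * sin x"
    using sin_cos_squared_add[of x] unfolding power2_eq_square by linarith
  have "sin x * sin x * chebS n (cos x) = sin x * sin (real n * x)"
    using Suc by (metis mult.commute mult.left_commute)
  then have "chebC (Suc n) (cos x) = cos (x + real n * x)"
    using Suc by (simp add: 1 cos_add)
  moreover have "chebS (Suc n) (cos x) * sin x = sin (x + real n * x)"
    using Suc by (simp add: distrib_right sin_add mult.assoc)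
  ultimately show ?case by (simp add: algebra_simps)
qed simp

text \<open>The derivative of \<open>chebS n\<close> is given only after multiplication by 1 - y^2,
  so that the recursion closes without a division at y = 1 and y = -1. The point y = 1 is needed in
  \<open>covK_expansion\<close>.\<close>

lemma cheb_deriv:
  "(chebC n has_real_derivative real n * chebS n y) (at y) \<and>
   (\<exists>s. (chebS n has_real_derivative s) (at y) \<and> (1 - y\<^sup>2) * s = y * chebS n y - real n * chebC n y)"
proof (induction n)
  case 0
  have "chebC 0 = (\<lambda>y. 1)" "chebS 0 = (\<lambda>y. 0)" by (auto simp: fun_eq_iff)
  then show ?case by (auto intro!: derivative_eq_intros exI[of _ 0])
next
  case (Suc n)
  then obtain s where C: "(chebC n has_real_derivative real n * chebS n y) (at y)"
    and S: "(chebS n has_real_derivative s) (at y)" "(1 - y\<^sup>2) * s = y * chebS n y - real n * chebC n y"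
    by blast
  have e: "chebC (Suc n) = (\<lambda>y. y * chebC n y - (1 - y\<^sup>2) * chebS n y)"
    "chebS (Suc n) = (\<lambda>y. y * chebS n y + chebC n y)" by (auto simp: fun_eq_iff)
  have "(chebC (Suc n) has_real_derivative (chebC n y + y * (real n * chebS n y)
      - ((- 2 * y) * chebS n y + (1 - y\<^sup>2) * s))) (at y)"
    unfolding e by (auto intro!: derivative_eq_intros C S(1))
  also have "(chebC n y + y * (real n * chebS n y) - ((- 2 * y) * chebS n y + (1 - y\<^sup>2) * s))
      = real (Suc n) * chebS (Suc n) y"
    unfolding S(2) by (simp add: algebra_simps)
  finally have 1: "(chebC (Suc n) has_real_derivative real (Suc n) * chebS (Suc n) y) (at y)" .
  have 2: "(chebS (Suc n) has_real_derivative (chebS n y + y * s + real n * chebS n y)) (at y)"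
    unfolding e by (auto intro!: derivative_eq_intros C S(1))
  have "(1 - y\<^sup>2) * (chebS n y + y * s + real n * chebS n y)
      = (1 - y\<^sup>2) * chebS n y + y * ((1 - y\<^sup>2) * s) + real n * (1 - y\<^sup>2) * chebS n y"
    by (simp add: algebra_simps)
  also have "\<dots> = y * chebS (Suc n) y - real (Suc n) * chebC (Suc n) y"
    unfolding S(2) by (simp add: algebra_simps power2_eq_square)
  finally show ?case using 1 2 by blast
qed

text \<open>With y = cos x this is the Dirichlet kernel, the sum of exp(-i m x) over the weights m,
  i.e. the character of the l-th representation. The function \<open>chebQ\<close> below is the same
  sum weighted by m^2.\<close>

fun chebP :: "nat \<Rightarrow> real \<Rightarrow> real" where
  "chebP 0 y = 1"
| "chebP (Suc l) y = chebP l y + 2 * chebC (Suc l) y"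

fun chebQ :: "nat \<Rightarrow> real \<Rightarrow> real" where
  "chebQ 0 y = 0"
| "chebQ (Suc l) y = chebQ l y + 2 * (real (Suc l))\<^sup>2 * chebC (Suc l) y"

fun chebP' :: "nat \<Rightarrow> real \<Rightarrow> real" where
  "chebP' 0 y = 0"
| "chebP' (Suc l) y = chebP' l y + 2 * (real (Suc l) * chebS (Suc l) y)"

lemma chebP_deriv: "(chebP l has_real_derivative chebP' l y) (at y)"
proof (induction l)
  case 0
  have "chebP 0 = (\<lambda>y. 1)" by (auto simp: fun_eq_iff)
  then show ?case by simp
next
  case (Suc l)
  have "chebP (Suc l) = (\<lambda>y. chebP l y + 2 * chebC (Suc l) y)" by (auto simp: fun_eq_iff)
  then show ?case
    unfolding chebP'.simps
    by (auto intro!: DERIV_add DERIV_cmult Suc cheb_deriv[THEN conjunct1] simp del: chebC.simps chebS.simps of_nat_Suc)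
qed

lemma chebP'_differentiable: "chebP' l differentiable (at y)"
proof (induction l)
  case 0
  have "chebP' 0 = (\<lambda>y. 0)" by (auto simp: fun_eq_iff)
  then show ?case by simp
next
  case (Suc l)
  have "chebS (Suc l) differentiable (at y)"
    using cheb_deriv[of "Suc l" y] real_differentiable_def by blast
  moreover have "chebP' (Suc l) = (\<lambda>y. chebP' l y + 2 * (real (Suc l) * chebS (Suc l) y))"
    by (auto simp: fun_eq_iff)
  ultimately show ?case
    by (auto intro!: differentiable_add differentiable_mult Suc simp del: chebS.simps)
qed

text \<open>The closed form of the Dirichlet kernel without denominators: with y = cos x it reads
  sin((l + 1) x) cot(x/2) = \<open>chebP l\<close> + cos((l + 1) x).\<close>

lemma chebS_chebP: "chebS (Suc l) y * (1 + y) = chebP l y + chebC (Suc l) y"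
proof (induction l)
  case (Suc l)
  have "chebS (Suc (Suc l)) y * (1 + y) - chebS (Suc l) y * (1 + y) = chebC (Suc l) y + chebC (Suc (Suc l)) y"
    unfolding chebS.simps(2)[of "Suc l"] chebC.simps(2)[of "Suc l"]
    by (simp add: algebra_simps power2_eq_square del: chebS.simps chebC.simps)
  then show ?case
    using Suc by (simp add: algebra_simps del: chebS.simps chebC.simps)
qed simp

text \<open>The second derivative at the north pole of the character of the \<open>l\<close>-th representation, up to a
  factor; with \<open>y = cos \<phi>\<close> both sides are trigonometric polynomials in \<open>\<phi>\<close>.\<close>

lemma chebP'_eq: "chebP' l y * (1 + y) = real l * (real l + 1) * chebP l y - chebQ l y"
proof (induction l)
  case (Suc l)
  have "chebP' (Suc l) y * (1 + y) = chebP' l y * (1 + y) + 2 * real (Suc l) * (chebS (Suc l) y * (1 + y))"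
    by (simp add: algebra_simps del: chebS.simps)
  also have "\<dots> = real (Suc l) * (real (Suc l) + 1) * chebP (Suc l) y - chebQ (Suc l) y"
    unfolding Suc chebS_chebP by (simp add: algebra_simps power2_eq_square del: chebC.simps)
  finally show ?case .
qed simp

section \<open>Characters as trigonometric sums and discrete Fourier inversion\<close>

lemma weights_Suc: "weights (Suc l) = insert (int (Suc l)) (insert (- int (Suc l)) (weights l))"
  by (auto simp: weights_def)

lemma finite_weights [simp]: "finite (weights l)" by (simp add: weights_def)

lemma sum_weights_Suc:
  "(\<Sum>m\<in>weights (Suc l). g m) = (\<Sum>m\<in>weights l. g m) + (g (int (Suc l)) + g (- int (Suc l)))"
  for g :: "int \<Rightarrow> 'a::comm_monoid_add"
proof -
  have "int (Suc l) \<notin> insert (- int (Suc l)) (weights l)" "- int (Suc l) \<notin> weights l"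
    by (auto simp: weights_def)
  then show ?thesis
    unfolding weights_Suc by (simp add: ac_simps)
qed

lemma cis_plus_cis_minus: "cis (- (real_of_int m * x)) + cis (real_of_int m * x) = of_real (2 * cos (real_of_int m * x))"
  by (simp add: complex_eq_iff)

lemma sum_cis_weights: "(\<Sum>m\<in>weights l. cis (- of_int m * x)) = of_real (chebP l (cos x))"
proof (induction l)
  case 0
  then show ?case by (simp add: weights_def)
next
  case (Suc l)
  then show ?case
    using cis_plus_cis_minus[of "int (Suc l)" x] cheb_cos[of "Suc l" x]
    by (simp add: sum_weights_Suc del: chebC.simps of_nat_Suc)
qed

lemma sum_cis_weights_square: "(\<Sum>m\<in>weights l. of_int (m\<^sup>2) * cis (- of_int m * x)) = of_real (chebQ l (cos x))"
proof (induction l)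
  case 0
  then show ?case by (simp add: weights_def)
next
  case (Suc l)
  have "of_int ((int (Suc l))\<^sup>2) * cis (- (real (Suc l) * x)) + of_int ((int (Suc l))\<^sup>2) * cis (real (Suc l) * x)
    = of_int ((int (Suc l))\<^sup>2) * complex_of_real (2 * cos (real (Suc l) * x))"
    using cis_plus_cis_minus[of "int (Suc l)" x] by (simp only: distrib_left[symmetric] of_int_of_nat_eq)
  then show ?case
    using Suc cheb_cos[of "Suc l" x]
    by (simp add: sum_weights_Suc del: chebC.simps of_nat_Suc)
qed

text \<open>There are N = 2 l + 1 weights, and two distinct ones differ by less than N. They stay
  distinct modulo N, so N equidistant nodes separate their frequencies.\<close>

lemma fourier_inversion:
  assumes m: "m \<in> weights l" and N: "N = 2 * l + 1"
  shows "(\<Sum>j<N. cis (of_int m * (2 * pi * real j / real N)) *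
     (\<Sum>n\<in>weights l. a n * cis (- of_int n * (2 * pi * real j / real N)))) = of_nat N * a m"
proof -
  have geo: "(\<Sum>j<N. cis (of_int (m - n) * (2 * pi * real j / real N))) = (if m = n then of_nat N else 0)"
    if n: "n \<in> weights l" for n
  proof (cases "m = n")
    case False
    define z where "z = cis (of_int (m - n) * (2 * pi / real N))"
    have N0: "real N \<noteq> 0" using N by simp
    have pw: "cis (of_int (m - n) * (2 * pi * real j / real N)) = z ^ j" for j
      unfolding z_def Complex.DeMoivre by (rule arg_cong[where f=cis]) (simp add: field_simps)
    have "z ^ N = cis (2 * pi * of_int (m - n))"
      using pw[of N] N0 by (simp add: field_simps)
    then have zN: "z ^ N = 1" by (simp add: cis_multiple_2pi)
    have "z \<noteq> 1"
    proof
      assume "z = 1"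
      then have "cos (of_int (m - n) * (2 * pi / real N)) = 1" by (simp add: z_def complex_eq_iff)
      then obtain k :: int where "of_int (m - n) * (2 * pi / real N) = of_int k * 2 * pi"
        unfolding cos_one_2pi_int by blast
      then have "real_of_int (m - n) * (2 * pi) = (real_of_int k * real N) * (2 * pi)"
        using N0 by (simp add: field_simps)
      then have "real_of_int (m - n) = real_of_int k * real N"
        by (subst (asm) mult_right_cancel) simp_all
      then have "real_of_int (m - n) = real_of_int (k * int N)" by simp
      then have k: "m - n = k * int N" by (simp only: of_int_eq_iff)
      \<comment> \<open>A multiple k N of absolute value below N has k = 0, so z is a nontrivial
        N-th root of unity and its powers sum to 0.\<close>
      have "\<bar>m - n\<bar> < int N" using m n N by (auto simp: weights_def)
      then have "\<bar>k\<bar> * int N < 1 * int N" unfolding k by (simp add: abs_mult)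
      then have "k = 0" using mult_right_mono[of 1 "\<bar>k\<bar>" "int N"] by linarith
      then show False using k False by simp
    qed
    then have "(\<Sum>j<N. z ^ j) = 0" using geometric_sum[of z N] zN by simp
    then show ?thesis using False by (simp only: pw) simp
  qed simp
  have e: "cis (of_int m * x) * (b * cis (- of_int n * x)) = b * cis (of_int (m - n) * x)" for x b n
    by (simp add: cis_mult mult.left_commute left_diff_distrib)
  have "(\<Sum>j<N. cis (of_int m * (2 * pi * real j / real N)) *
     (\<Sum>n\<in>weights l. a n * cis (- of_int n * (2 * pi * real j / real N))))
    = (\<Sum>j<N. \<Sum>n\<in>weights l. a n * cis (of_int (m - n) * (2 * pi * real j / real N)))"
    by (simp only: sum_distrib_left e)
  also have "\<dots> = (\<Sum>n\<in>weights l. a n * (\<Sum>j<N. cis (of_int (m - n) * (2 * pi * real j / real N))))"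
    unfolding sum_distrib_left by (rule sum.swap)
  also have "\<dots> = (\<Sum>n\<in>weights l. if m = n then a n * of_nat N else 0)"
    by (rule sum.cong[OF refl]) (simp only: geo, simp)
  also have "\<dots> = of_nat N * a m" using m by (simp add: sum.delta')
  finally show ?thesis .
qed

section \<open>Wigner matrices\<close>

locale wigner =
  fixes D :: "nat \<Rightarrow> int \<Rightarrow> int \<Rightarrow> real^3^3 \<Rightarrow> complex"
  assumes wigner: "wigner_matrices D"
begin

lemma D_mult: "p \<in> SO3 \<Longrightarrow> q \<in> SO3 \<Longrightarrow> m \<in> weights l \<Longrightarrow> n \<in> weights l \<Longrightarrow>
    D l m n (p ** q) = (\<Sum>k\<in>weights l. D l m k p * D l k n q)"
  using wigner unfolding wigner_matrices_def unitary_rep_SO3_def by blast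

lemma D_unitary: "p \<in> SO3 \<Longrightarrow> m \<in> weights l \<Longrightarrow> n \<in> weights l \<Longrightarrow>
    (\<Sum>k\<in>weights l. cnj (D l k m p) * D l k n p) = (if m = n then 1 else 0)"
  using wigner unfolding wigner_matrices_def unitary_rep_SO3_def by blast

lemma D_R3: "p \<in> SO3 \<Longrightarrow> m \<in> weights l \<Longrightarrow> n \<in> weights l \<Longrightarrow>
    D l m n (R3 \<phi> ** p ** R3 \<psi>) = cis (- of_int m * \<phi>) * D l m n p * cis (- of_int n * \<psi>)"
  using wigner unfolding wigner_matrices_def by blast

text \<open>Expand D(p) = D(q) D(q^-1 p) and use unitarity of D(q). This is why the covariance of
  the field depends on q^-1 p only.\<close>

lemma D_inner:
  assumes p: "p \<in> SO3" and q: "q \<in> SO3" and m: "m \<in> weights l" and n: "n \<in> weights l"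
  shows "(\<Sum>k\<in>weights l. cnj (D l k m q) * D l k n p) = D l m n (transpose q ** p)"
proof -
  let ?r = "transpose q ** p"
  have r: "?r \<in> SO3" by (intro SO3_mult SO3_transpose p q)
  have "D l k n p = (\<Sum>j\<in>weights l. D l k j q * D l j n ?r)" if "k \<in> weights l" for k
    using D_mult[OF q r that n] by (simp add: SO3_cancel[OF q])
  then have "(\<Sum>k\<in>weights l. cnj (D l k m q) * D l k n p)
    = (\<Sum>k\<in>weights l. \<Sum>j\<in>weights l. cnj (D l k m q) * D l k j q * D l j n ?r)"
    by (simp add: sum_distrib_left mult.assoc)
  also have "\<dots> = (\<Sum>j\<in>weights l. (\<Sum>k\<in>weights l. cnj (D l k m q) * D l k j q) * D l j n ?r)"
    unfolding sum_distrib_right by (rule sum.swap)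
  also have "\<dots> = (\<Sum>j\<in>weights l. if m = j then D l j n ?r else 0)"
    by (rule sum.cong) (auto simp: D_unitary[OF q m])
  also have "\<dots> = D l m n ?r" using m by simp
  finally show ?thesis .
qed

lemma D_1: "m \<in> weights l \<Longrightarrow> n \<in> weights l \<Longrightarrow> D l m n (mat 1) = (if m = n then 1 else 0)"
  using D_inner[OF SO3_mat_1 SO3_mat_1, of m l n] D_unitary[OF SO3_mat_1, of m l n] by simp

lemma D_column: "p \<in> SO3 \<Longrightarrow> n \<in> weights l \<Longrightarrow> (\<Sum>k\<in>weights l. (cmod (D l k n p))\<^sup>2) = 1"
  using D_unitary[of p n l n]
  by (simp add: complex_norm_square[symmetric] mult.commute flip: of_real_sum of_real_power)

lemma D_norm_le_1: 
  assumes "p \<in> SO3" "m \<in> weights l" "n \<in> weights l"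
  shows "cmod (D l m n p) \<le> 1"
proof -
  have "(cmod (D l m n p))\<^sup>2 \<le> (\<Sum>k\<in>weights l. (cmod (D l k n p))\<^sup>2)"
    using assms by (intro member_le_sum) auto
  then show ?thesis by (simp add: D_column assms abs_square_le_1)
qed

text \<open>The trace of D is a class function and D(R3 w) is diagonal, so by
  \<open>SO3_conj_R3\<close> the character depends on cos w alone, which is (trace q - 1)/2.\<close>

lemma trace_D:
  assumes q: "q \<in> SO3"
  shows "(\<Sum>m\<in>weights l. D l m m q) = of_real (chebP l ((trace q - 1) / 2))"
proof -
  obtain A w where A: "A \<in> SO3" "q = A ** R3 w ** transpose A" and t: "trace q = 1 + 2 * cos w"
    using SO3_conj_R3[OF q] by blast
  have sym: "(\<Sum>m\<in>weights l. D l m m (a ** b)) = (\<Sum>m\<in>weights l. D l m m (b ** a))"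
    if "a \<in> SO3" "b \<in> SO3" for a b
  proof -
    have "(\<Sum>m\<in>weights l. D l m m (a ** b)) = (\<Sum>m\<in>weights l. \<Sum>k\<in>weights l. D l m k a * D l k m b)"
      by (simp add: D_mult that)
    also have "\<dots> = (\<Sum>k\<in>weights l. \<Sum>m\<in>weights l. D l k m b * D l m k a)"
      by (subst sum.swap) (simp add: mult.commute)
    finally show ?thesis by (simp add: D_mult that)
  qed
  have "(\<Sum>m\<in>weights l. D l m m q) = (\<Sum>m\<in>weights l. D l m m (transpose A ** (A ** R3 w)))"
    unfolding A(2) by (rule sym) (intro SO3_mult SO3_transpose A(1) SO3_R)+
  also have "\<dots> = (\<Sum>m\<in>weights l. cis (- of_int m * w))"
    using D_R3[OF SO3_mat_1, of _ l _ w 0] by (simp add: SO3_cancel[OF A(1)] D_1)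
  also have "\<dots> = of_real (chebP l (cos w))" by (rule sum_cis_weights)
  finally show ?thesis by (simp add: t)
qed

text \<open>From D being merely continuous, this yields diagonal entries that are polynomials in cos
  \<theta>, hence explicit derivatives.\<close>

lemma wigner_d_formula:
  assumes m: "m \<in> weights l" and N: "N = 2 * l + 1"
  shows "wigner_d D l m m \<theta> = (\<Sum>j<N. cis (of_int m * (2 * pi * real j / real N)) *
     of_real (chebP l ((cos (2 * pi * real j / real N) * (1 + cos \<theta>) + cos \<theta> - 1) / 2))) / of_nat N"
proof -
  have T: "(\<Sum>n\<in>weights l. wigner_d D l n n \<theta> * cis (- of_int n * \<phi>))
      = of_real (chebP l ((cos \<phi> * (1 + cos \<theta>) + cos \<theta> - 1) / 2))" for \<phi>
  proof -
    have "(\<Sum>n\<in>weights l. wigner_d D l n n \<theta> * cis (- of_int n * \<phi>)) = (\<Sum>n\<in>weights l. D l n n (R3 \<phi> ** R2 \<theta>))"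
      using D_R3[OF SO3_R(2), of _ l _ \<phi> \<theta> 0] by (intro sum.cong) (auto simp: wigner_d_def mult.commute)
    also have "\<dots> = of_real (chebP l ((trace (R3 \<phi> ** R2 \<theta>) - 1) / 2))"
      by (intro trace_D SO3_mult SO3_R)
    also have "trace (R3 \<phi> ** R2 \<theta>) = cos \<phi> * (1 + cos \<theta>) + cos \<theta>"
      by (simp add: trace_def sum_3 matrix_matrix_mult_def R3_def R2_def algebra_simps)
    finally show ?thesis by simp
  qed
  have "complex_of_nat N \<noteq> 0" using N by (simp del: of_nat_add of_nat_mult of_nat_Suc)
  then show ?thesis
    using fourier_inversion[OF m N, of "\<lambda>n. wigner_d D l n n \<theta>"] unfolding T
    by (simp add: nonzero_eq_divide_eq mult.commute[of _ "of_nat N"])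
qed

definition wigner_d' :: "nat \<Rightarrow> int \<Rightarrow> real \<Rightarrow> complex" where
  "wigner_d' l m \<theta> = (\<Sum>j<2 * l + 1. cis (of_int m * (2 * pi * real j / real (2 * l + 1))) *
     of_real (chebP' l ((cos (2 * pi * real j / real (2 * l + 1)) * (1 + cos \<theta>) + cos \<theta> - 1) / 2)
       * (- sin \<theta> * (1 + cos (2 * pi * real j / real (2 * l + 1))) / 2))) / of_nat (2 * l + 1)"

lemma wigner_d_deriv:
  assumes m: "m \<in> weights l"
  shows "(wigner_d D l m m has_vector_derivative wigner_d' l m \<theta>) (at \<theta>)"
proof -
  have "((\<lambda>\<theta>. chebP l ((a * (1 + cos \<theta>) + cos \<theta> - 1) / 2)) has_real_derivative
     chebP' l ((a * (1 + cos \<theta>) + cos \<theta> - 1) / 2) * (- sin \<theta> * (1 + a) / 2)) (at \<theta>)" for a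
    by (rule DERIV_chain2[OF chebP_deriv]) (auto intro!: derivative_eq_intros simp: field_simps)
  then have "((\<lambda>\<theta>. of_real (chebP l ((a * (1 + cos \<theta>) + cos \<theta> - 1) / 2))) has_vector_derivative
     complex_of_real (chebP' l ((a * (1 + cos \<theta>) + cos \<theta> - 1) / 2) * (- sin \<theta> * (1 + a) / 2))) (at \<theta>)" for a
    by (intro has_vector_derivative_of_real) (simp add: has_real_derivative_iff_has_vector_derivative)
  then show ?thesis
    unfolding wigner_d_formula[OF m refl, abs_def] wigner_d'_def
    by (intro has_vector_derivative_divide has_vector_derivative_sum has_vector_derivative_mult_right)
qed

lemma wigner_d'_0: "wigner_d' l m 0 = 0"
  by (simp add: wigner_d'_def)

text \<open>At \<theta> = 0 each node contributes \<open>chebP' l a * (1 + a)\<close> with a = cos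
  \<phi>. By \<open>chebP'_eq\<close> this is the character with its m-th term multiplied by l (l +
  1) - m^2, and Fourier inversion extracts that factor.\<close>

lemma wigner_d'_deriv:
  assumes m: "m \<in> weights l"
  shows "(wigner_d' l m has_vector_derivative of_real (- (real l * (real l + 1) - (of_int m)\<^sup>2) / 2)) (at 0)"
proof -
  let ?N = "2 * l + 1"
  let ?\<phi> = "\<lambda>j. 2 * pi * real j / real ?N"
  have "((\<lambda>\<theta>. chebP' l ((a * (1 + cos \<theta>) + cos \<theta> - 1) / 2) * (- sin \<theta> * (1 + a) / 2)) has_real_derivative
     - (chebP' l a * (1 + a)) / 2) (at 0)" for a
  proof -
    obtain D' where D': "(chebP' l has_real_derivative D') (at a)"
      using chebP'_differentiable real_differentiable_def by blast
    \<comment> \<open>The inner argument is stationary at \<theta> = 0, so the unknown second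
      derivative \<open>D'\<close> of \<open>chebP l\<close> drops out.\<close>
    have "((\<lambda>\<theta>. chebP' l ((a * (1 + cos \<theta>) + cos \<theta> - 1) / 2)) has_real_derivative D' * 0) (at 0)"
      by (rule DERIV_chain2[of "chebP' l" D' "\<lambda>\<theta>. (a * (1 + cos \<theta>) + cos \<theta> - 1) / 2"])
        (use D' in \<open>auto intro!: derivative_eq_intros\<close>)
    then show ?thesis
      by (auto intro!: derivative_eq_intros)
  qed
  then have "((\<lambda>\<theta>. chebP' l ((cos x * (1 + cos \<theta>) + cos \<theta> - 1) / 2) * (- sin \<theta> * (1 + cos x) / 2)) has_real_derivative
     - (real l * (real l + 1) * chebP l (cos x) - chebQ l (cos x)) / 2) (at 0)" for x
    unfolding chebP'_eq[symmetric] .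
  then have "((\<lambda>\<theta>. of_real (chebP' l ((cos x * (1 + cos \<theta>) + cos \<theta> - 1) / 2) * (- sin \<theta> * (1 + cos x) / 2))) has_vector_derivative
     complex_of_real (- (real l * (real l + 1) * chebP l (cos x) - chebQ l (cos x)) / 2)) (at 0)" for x
    by (intro has_vector_derivative_of_real) (simp add: has_real_derivative_iff_has_vector_derivative)
  then have 1: "(wigner_d' l m has_vector_derivative (\<Sum>j<?N. cis (of_int m * ?\<phi> j) *
     of_real (- (real l * (real l + 1) * chebP l (cos (?\<phi> j)) - chebQ l (cos (?\<phi> j))) / 2)) / of_nat ?N) (at 0)"
    unfolding wigner_d'_def[abs_def]
    by (intro has_vector_derivative_divide has_vector_derivative_sum has_vector_derivative_mult_right)
  have "complex_of_real (- (real l * (real l + 1) * chebP l (cos x) - chebQ l (cos x)) / 2)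
     = (\<Sum>n\<in>weights l. of_real (- (real l * (real l + 1) - (of_int n)\<^sup>2) / 2) * cis (- of_int n * x))" for x
  proof -
    have "complex_of_real (- (real l * (real l + 1) * chebP l (cos x) - chebQ l (cos x)) / 2)
      = - (of_nat l * (of_nat l + 1) / 2) * of_real (chebP l (cos x)) + of_real (chebQ l (cos x)) / 2"
      by (simp add: field_simps)
    also have "\<dots> = (\<Sum>n\<in>weights l. - (of_nat l * (of_nat l + 1) / 2) * cis (- of_int n * x)
        + of_int (n\<^sup>2) * cis (- of_int n * x) / 2)"
      by (simp add: sum_cis_weights[symmetric] sum_cis_weights_square[symmetric] sum_distrib_left
          sum_divide_distrib sum_subtractf sum_negf)
    also have "\<dots> = (\<Sum>n\<in>weights l. of_real (- (real l * (real l + 1) - (of_int n)\<^sup>2) / 2) * cis (- of_int n * x))"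
      by (intro sum.cong) (auto simp: field_simps)
    finally show ?thesis .
  qed
  then have 2: "(\<Sum>j<?N. cis (of_int m * ?\<phi> j) *
     of_real (- (real l * (real l + 1) * chebP l (cos (?\<phi> j)) - chebQ l (cos (?\<phi> j))) / 2))
    = of_nat ?N * of_real (- (real l * (real l + 1) - (of_int m)\<^sup>2) / 2)"
    using fourier_inversion[OF m refl, of "\<lambda>n. of_real (- (real l * (real l + 1) - (of_int n)\<^sup>2) / 2)"]
    by simp
  have nz: "complex_of_nat ?N \<noteq> 0" by (simp del: of_nat_add of_nat_mult of_nat_Suc)
  show ?thesis
    using 1 unfolding 2 nonzero_mult_div_cancel_left[OF nz] .
qed

lemma wigner_d_0: "m \<in> weights l \<Longrightarrow> wigner_d D l m m 0 = 1"
  by (simp add: wigner_d_def D_1)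

text \<open>R2(-\<theta>) is both the inverse of R2(\<theta>), which conjugates a diagonal entry,
  and its conjugate by R3(pi), which multiplies a diagonal entry by two cancelling phases.\<close>

lemma wigner_d_real:
  assumes m: "m \<in> weights l"
  shows "cnj (wigner_d D l m m \<theta>) = wigner_d D l m m \<theta>"
proof -
  have "wigner_d D l m m (- \<theta>) = (\<Sum>k\<in>weights l. cnj (D l k m (R2 \<theta>)) * D l k m (mat 1))"
    using D_inner[OF SO3_mat_1 SO3_R(2) m m] by (simp add: wigner_d_def transpose_R2)
  also have "\<dots> = (\<Sum>k\<in>weights l. if k = m then cnj (D l k m (R2 \<theta>)) else 0)"
    using m by (intro sum.cong) (auto simp: D_1)
  also have "\<dots> = cnj (wigner_d D l m m \<theta>)" using m by (simp add: wigner_d_def)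
  finally have 1: "wigner_d D l m m (- \<theta>) = cnj (wigner_d D l m m \<theta>)" .
  have "R3 pi ** R2 \<theta> ** R3 (- pi) = R2 (- \<theta>)"
    by (simp add: R3_def R2_def mat3_simps)
  then have "wigner_d D l m m (- \<theta>) = cis (- of_int m * pi) * wigner_d D l m m \<theta> * cis (- of_int m * - pi)"
    using D_R3[OF SO3_R(2) m m, of pi \<theta> "- pi"] by (simp add: wigner_d_def)
  also have "\<dots> = wigner_d D l m m \<theta> * (cis (- of_int m * pi) * cis (- of_int m * - pi))"
    by simp
  also have "\<dots> = wigner_d D l m m \<theta>" unfolding cis_mult by simp
  finally show ?thesis using 1 by simp
qed

lemma D_euler:
  assumes "m \<in> weights l"
  shows "D l m m (euler x) = cis (- of_int m * (x$1 + x$3)) * wigner_d D l m m (x$2)"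
  unfolding euler_def D_R3[OF SO3_R(2) assms assms] wigner_d_def
  by (simp add: cis_mult distrib_left mult.commute mult.left_commute)

end

section \<open>Centered Gaussian variables\<close>

text \<open>Stated through the characteristic function, so that variance 0 needs no separate
  treatment and independent sums and almost sure limits reduce to exponentials. Nonnegativity of v
  is a consequence, \<open>centered_gaussian_nonneg\<close>.\<close>

definition centered_gaussian :: "'w measure \<Rightarrow> ('w \<Rightarrow> real) \<Rightarrow> real \<Rightarrow> bool" where
  "centered_gaussian M Y v \<longleftrightarrow> Y \<in> borel_measurable M \<and>
     (\<forall>t. char (distr M borel Y) t = of_real (exp (- v * t\<^sup>2 / 2)))"

context prob_space
begin

lemma char_distr: "Y \<in> borel_measurable M \<Longrightarrow> char (distr M borel Y) t = (CLINT x|M. iexp (t * Y x))"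
  by (simp add: char_def integral_distr)

lemma centered_gaussian_normal:
  assumes X: "distributed M lborel X (\<lambda>x. ennreal (normal_density 0 \<sigma> x))" and \<sigma>: "\<sigma> > 0"
  shows "centered_gaussian M X (\<sigma>\<^sup>2)"
proof -
  have [measurable]: "X \<in> borel_measurable M" using X by (simp add: distributed_def)
  have S: "distributed M lborel (\<lambda>x. X x / \<sigma>) std_normal_density"
    using X normal_standard_normal_convert[OF \<sigma>, of X 0] by simp
  have "distr M borel (\<lambda>x. X x / \<sigma>) = std_normal_distribution"
    using distributed_distr_eq_density[OF S] by (simp cong: distr_cong)
  then have "char (distr M borel (\<lambda>x. X x / \<sigma>)) (t * \<sigma>) = of_real (exp (- \<sigma>\<^sup>2 * t\<^sup>2 / 2))" for t
    by (simp add: char_std_normal_distribution power_mult_distrib mult.commute)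
  moreover have "char (distr M borel (\<lambda>x. X x / \<sigma>)) (t * \<sigma>) = char (distr M borel X) t" for t
    using \<sigma> by (simp add: char_distr)
  ultimately show ?thesis by (simp add: centered_gaussian_def)
qed

lemma centered_gaussian_scale:
  assumes "centered_gaussian M X v"
  shows "centered_gaussian M (\<lambda>\<omega>. a * X \<omega>) (a\<^sup>2 * v)"
proof -
  have [measurable]: "X \<in> borel_measurable M" using assms by (simp add: centered_gaussian_def)
  have "char (distr M borel (\<lambda>\<omega>. a * X \<omega>)) t = char (distr M borel X) (t * a)" for t
    by (simp add: char_distr mult.assoc)
  then show ?thesis
    using assms by (simp add: centered_gaussian_def power_mult_distrib algebra_simps)
qed

lemma centered_gaussian_add:
  assumes "centered_gaussian M X v" "centered_gaussian M Y w" "indep_var borel X borel Y"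
  shows "centered_gaussian M (\<lambda>\<omega>. X \<omega> + Y \<omega>) (v + w)"
  using assms unfolding centered_gaussian_def
  by (auto simp: char_distr_add algebra_simps add_divide_distrib exp_add[symmetric] simp flip: of_real_mult)

lemma centered_gaussian_sum:
  assumes "indep_vars (\<lambda>i. borel) X A" "finite A" "\<And>i. i \<in> A \<Longrightarrow> centered_gaussian M (X i) (v i)"
  shows "centered_gaussian M (\<lambda>\<omega>. \<Sum>i\<in>A. X i \<omega>) (\<Sum>i\<in>A. v i)"
proof -
  have "(\<Prod>i\<in>A. char (distr M borel (X i)) t) = of_real (exp (- (\<Sum>i\<in>A. v i) * t\<^sup>2 / 2))" for t
  proof -
    have "(\<Prod>i\<in>A. char (distr M borel (X i)) t) = (\<Prod>i\<in>A. of_real (exp (- v i * t\<^sup>2 / 2)))"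
      using assms(3) by (intro prod.cong) (auto simp: centered_gaussian_def)
    also have "\<dots> = of_real (exp (\<Sum>i\<in>A. - v i * t\<^sup>2 / 2))"
      using assms(2) by (simp add: exp_sum)
    also have "(\<Sum>i\<in>A. - v i * t\<^sup>2 / 2) = - (\<Sum>i\<in>A. v i) * t\<^sup>2 / 2"
      by (simp add: sum_distrib_right sum_divide_distrib sum_negf)
    finally show ?thesis .
  qed
  moreover have "(\<lambda>\<omega>. \<Sum>i\<in>A. X i \<omega>) \<in> borel_measurable M"
    using assms(3) by (intro borel_measurable_sum) (auto simp: centered_gaussian_def)
  ultimately show ?thesis
    by (simp add: centered_gaussian_def char_distr_sum[OF assms(1)])
qed

text \<open>The integrands of the characteristic functions have modulus 1, so dominated convergence
  applies to any almost sure limit.\<close>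

lemma centered_gaussian_limit:
  assumes Y: "\<And>n. centered_gaussian M (Y n) (v n)" and v: "v \<longlonglongrightarrow> w"
    and lim: "AE \<omega> in M. (\<lambda>n. Y n \<omega>) \<longlonglongrightarrow> Z \<omega>" and [measurable]: "Z \<in> borel_measurable M"
  shows "centered_gaussian M Z w"
proof -
  have [measurable]: "Y n \<in> borel_measurable M" for n using Y by (simp add: centered_gaussian_def)
  have "char (distr M borel Z) t = of_real (exp (- w * t\<^sup>2 / 2))" for t
  proof (rule LIMSEQ_unique)
    have "(\<lambda>n. CLINT \<omega>|M. iexp (t * Y n \<omega>)) \<longlonglongrightarrow> (CLINT \<omega>|M. iexp (t * Z \<omega>))"
    proof (rule integral_dominated_convergence[where w="\<lambda>_. 1"])
      show "AE \<omega> in M. (\<lambda>n. iexp (t * Y n \<omega>)) \<longlonglongrightarrow> iexp (t * Z \<omega>)"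
        using lim by eventually_elim (intro tendsto_intros)
    qed auto
    then show "(\<lambda>n. char (distr M borel (Y n)) t) \<longlonglongrightarrow> char (distr M borel Z) t"
      by (simp add: char_distr)
    have "(\<lambda>n. of_real (exp (- v n * t\<^sup>2 / 2))) \<longlonglongrightarrow> complex_of_real (exp (- w * t\<^sup>2 / 2))"
      by (intro tendsto_intros v) simp
    then show "(\<lambda>n. char (distr M borel (Y n)) t) \<longlonglongrightarrow> of_real (exp (- w * t\<^sup>2 / 2))"
      using Y by (simp add: centered_gaussian_def)
  qed
  then show ?thesis by (simp add: centered_gaussian_def)
qed

lemma centered_gaussian_nonneg:
  assumes "centered_gaussian M Y v"
  shows "v \<ge> 0"
proof -
  have "Y \<in> borel_measurable M" using assms by (simp add: centered_gaussian_def)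
  from real_distribution.cmod_char_le_1[OF real_distribution_distr[OF this], of 1]
  show ?thesis
    using assms by (simp add: centered_gaussian_def)
qed

lemma centered_gaussian_zero:
  assumes "centered_gaussian M Y 0"
  shows "AE \<omega> in M. Y \<omega> = 0"
proof -
  have Y[measurable]: "Y \<in> borel_measurable M" using assms by (simp add: centered_gaussian_def)
  have "distr M borel Y = distr M borel (\<lambda>_. 0::real)"
  proof (rule Levy_uniqueness)
    show "char (distr M borel Y) = char (distr M borel (\<lambda>_. 0))"
      using assms by (auto simp: fun_eq_iff centered_gaussian_def char_distr prob_space simp del: distr_const)
  qed (auto intro!: real_distribution_distr simp del: distr_const)
  then have "emeasure (distr M borel Y) (- {0}) = emeasure (distr M borel (\<lambda>_. 0::real)) (- {0})" by (simp only:)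
  also have "\<dots> = 0" by (subst emeasure_distr) auto
  also have "emeasure (distr M borel Y) (- {0}) = emeasure M (Y -` (- {0}) \<inter> space M)"
    by (rule emeasure_distr) auto
  also have "Y -` (- {0}) \<inter> space M = {\<omega>\<in>space M. Y \<omega> \<noteq> 0}" by auto
  finally have "emeasure M {\<omega>\<in>space M. Y \<omega> \<noteq> 0} = 0" .
  then show ?thesis by (subst AE_iff_measurable[OF _ refl]) auto
qed

lemma centered_gaussian_distributed:
  assumes Y: "centered_gaussian M Y v" and v: "v > 0"
  shows "distributed M lborel Y (\<lambda>x. ennreal (normal_density 0 (sqrt v) x))"
proof -
  have [measurable]: "Y \<in> borel_measurable M" using Y by (simp add: centered_gaussian_def)
  let ?N = "density lborel (\<lambda>x. ennreal (normal_density 0 (sqrt v) x))"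
  interpret N: prob_space ?N using v by (intro prob_space_normal_density) simp
  have id: "distr ?N lborel (\<lambda>x. x) = ?N"
    by (rule distr_id2) simp
  have "distributed ?N lborel (\<lambda>x. x) (\<lambda>x. ennreal (normal_density 0 (sqrt v) x))"
    unfolding distributed_def id by simp
  \<comment> \<open>The identity on the normal law serves as a reference variable: its
    characteristic function agrees with that of Y, and Levy's theorem identifies the laws.\<close>
  then have "centered_gaussian ?N (\<lambda>x. x) v"
    using N.centered_gaussian_normal[of "\<lambda>x. x" "sqrt v"] v by simp
  moreover have id': "distr ?N borel (\<lambda>x. x) = ?N"
    by (rule distr_id2) simp
  ultimately have "char ?N = char (distr M borel Y)"
    using Y by (auto simp: centered_gaussian_def fun_eq_iff)
  then have "?N = distr M borel Y"
    by (intro Levy_uniqueness real_distribution_distr)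
      (auto simp: real_distribution_def real_distribution_axioms_def N.prob_space_axioms)
  then show ?thesis
    by (simp add: distributed_def cong: distr_cong)
qed

lemma centered_gaussian_square:
  assumes Y: "centered_gaussian M Y v"
  shows "integrable M (\<lambda>\<omega>. (Y \<omega>)\<^sup>2)" "(LINT \<omega>|M. (Y \<omega>)\<^sup>2) = v"
proof -
  have [measurable]: "Y \<in> borel_measurable M" using Y by (simp add: centered_gaussian_def)
  have "integrable M (\<lambda>\<omega>. (Y \<omega>)\<^sup>2) \<and> (LINT \<omega>|M. (Y \<omega>)\<^sup>2) = v"
  proof (cases "v = 0")
    case True
    then have "AE \<omega> in M. (Y \<omega>)\<^sup>2 = 0" using centered_gaussian_zero Y by auto
    then have "integrable M (\<lambda>\<omega>. (Y \<omega>)\<^sup>2) \<longleftrightarrow> integrable M (\<lambda>\<omega>. 0::real)"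
      by (intro integrable_cong_AE) auto
    moreover have "(LINT \<omega>|M. (Y \<omega>)\<^sup>2) = (LINT \<omega>|M. 0)"
      using \<open>AE \<omega> in M. (Y \<omega>)\<^sup>2 = 0\<close> by (intro integral_cong_AE) auto
    ultimately show ?thesis using True by simp
  next
    case False
    then have v: "v > 0" using centered_gaussian_nonneg[OF Y] by simp
    note d = centered_gaussian_distributed[OF Y v]
    have "integrable lborel (\<lambda>x. normal_density 0 (sqrt v) x * x\<^sup>2)"
      using integrable_normal_moment[of "sqrt v" 0 2] v by simp
    moreover have "(LINT x|lborel. normal_density 0 (sqrt v) x * x\<^sup>2) = v"
      using integral_normal_moment_even[of "sqrt v" 0 1] v by simp
    ultimately show ?thesis
      using distributed_integrable[OF d, of "\<lambda>x. x\<^sup>2"] distributed_integral[OF d, of "\<lambda>x. x\<^sup>2"] by simp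
  qed
  then show "integrable M (\<lambda>\<omega>. (Y \<omega>)\<^sup>2)" "(LINT \<omega>|M. (Y \<omega>)\<^sup>2) = v" by auto
qed

lemma centered_gaussian_imp_gaussian_rv:
  assumes "centered_gaussian M Y v"
  shows "gaussian_rv M Y"
proof (cases "v = 0")
  case True
  then show ?thesis
    using assms centered_gaussian_zero by (auto simp: gaussian_rv_def centered_gaussian_def)
next
  case False
  then have "v > 0" using centered_gaussian_nonneg[OF assms] by simp
  from centered_gaussian_distributed[OF assms this]
  have "\<exists>\<sigma>>0. distributed M lborel Y (\<lambda>x. ennreal (normal_density 0 \<sigma> x))"
    using \<open>v > 0\<close> by (intro exI[of _ "sqrt v"]) simp
  then show ?thesis
    using assms unfolding gaussian_rv_def centered_gaussian_def by blast
qed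

lemma complex_gaussian_Re:
  assumes "complex_gaussian M Z"
  shows "centered_gaussian M (\<lambda>\<omega>. Re (b * Z \<omega>)) ((cmod b)\<^sup>2 / 2)"
proof -
  have i: "indep_var borel (\<lambda>\<omega>. Re (Z \<omega>)) borel (\<lambda>\<omega>. Im (Z \<omega>))"
    and g: "centered_gaussian M (\<lambda>\<omega>. Re (Z \<omega>)) (1/2)" "centered_gaussian M (\<lambda>\<omega>. Im (Z \<omega>)) (1/2)"
    using assms centered_gaussian_normal[of _ "sqrt (1/2)"] by (auto simp: complex_gaussian_def power_divide)
  have "indep_var borel (\<lambda>\<omega>. Re b * Re (Z \<omega>)) borel (\<lambda>\<omega>. (- Im b) * Im (Z \<omega>))"
    using indep_var_compose[OF i, of "\<lambda>x. Re b * x" borel "\<lambda>x. (- Im b) * x" borel] by (simp add: comp_def)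
  from centered_gaussian_add[OF centered_gaussian_scale[OF g(1)] centered_gaussian_scale[OF g(2)] this]
  show ?thesis
    by (simp add: cmod_power2 add_divide_distrib)
qed

end

text \<open>By monotone convergence the sum has finite integral, hence is finite almost
  everywhere.\<close>

lemma AE_summable_integral:
  fixes h :: "nat \<Rightarrow> 'a \<Rightarrow> real"
  assumes int: "\<And>j. integrable M (h j)" and nn: "\<And>j x. h j x \<ge> 0" and s: "summable (\<lambda>j. LINT x|M. h j x)"
  shows "AE x in M. summable (\<lambda>j. h j x)"
proof -
  have [measurable]: "h j \<in> borel_measurable M" for j using int by auto
  have "(\<integral>\<^sup>+x. (\<Sum>j. ennreal (h j x)) \<partial>M) = (\<Sum>j. \<integral>\<^sup>+x. ennreal (h j x) \<partial>M)"
    by (rule nn_integral_suminf) auto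
  also have "\<dots> = (\<Sum>j. ennreal (LINT x|M. h j x))"
    by (simp add: nn_integral_eq_integral int nn)
  also have "\<dots> = ennreal (\<Sum>j. LINT x|M. h j x)"
    by (intro suminf_ennreal2 s integral_nonneg_AE) (auto simp: nn)
  finally have "(\<integral>\<^sup>+x. (\<Sum>j. ennreal (h j x)) \<partial>M) \<noteq> \<infinity>" by simp
  then have "AE x in M. (\<Sum>j. ennreal (h j x)) \<noteq> \<infinity>"
    by (intro nn_integral_PInf_AE) auto
  then show ?thesis
    by eventually_elim (auto intro!: summable_suminf_not_top simp: nn)
qed

section \<open>The circular covariance function\<close>

locale spin_covariance = wigner D for D +
  fixes c :: "nat \<Rightarrow> real" and s :: int
  assumes s_nonzero: "s \<noteq> 0"
    and c_pos: "\<And>l. int l \<ge> \<bar>s\<bar> \<Longrightarrow> c l > 0"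
    and conv: "converges_Cinf (\<lambda>N \<theta>. \<Sum>j<N. shifted s (circ_cov_term D c s \<theta>) j) (circ_cov D c s)"
begin

abbreviation lev :: "nat \<Rightarrow> nat" where "lev j \<equiv> nat \<bar>s\<bar> + j"

lemma s_weights: "s \<in> weights (lev j)" by (auto simp: weights_def)

lemma c_lev_pos: "c (lev j) > 0" by (rule c_pos) simp

abbreviation pcov :: "nat \<Rightarrow> real \<Rightarrow> complex" where
  "pcov N \<theta> \<equiv> \<Sum>j<N. shifted s (circ_cov_term D c s \<theta>) j"

lemma pcov_deriv:
  "((pcov N) has_vector_derivative (\<Sum>j<N. of_real ((c (lev j))\<^sup>2) * wigner_d' (lev j) s \<theta>)) (at \<theta>)"
  unfolding shifted_def circ_cov_term_def
  by (intro has_vector_derivative_sum has_vector_derivative_mult_right wigner_d_deriv s_weights)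

lemma vderiv_pcov: "vderiv (pcov N) = (\<lambda>\<theta>. \<Sum>j<N. of_real ((c (lev j))\<^sup>2) * wigner_d' (lev j) s \<theta>)"
  unfolding vderiv_def using vector_derivative_at[OF pcov_deriv] by blast

lemma vderiv2_pcov:
  "vderiv (vderiv (pcov N)) 0
    = of_real (\<Sum>j<N. - ((c (lev j))\<^sup>2 * ((real (lev j) * (real (lev j) + 1) - (of_int s)\<^sup>2) / 2)))"
proof -
  have "vderiv (vderiv (pcov N)) 0 = (\<Sum>j<N. of_real ((c (lev j))\<^sup>2) *
      of_real (- (real (lev j) * (real (lev j) + 1) - (of_int s)\<^sup>2) / 2))"
    unfolding vderiv_pcov vderiv_def[of _ 0]
    by (intro vector_derivative_at has_vector_derivative_sum has_vector_derivative_mult_right wigner_d'_deriv s_weights)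
  also have "\<dots> = of_real (\<Sum>j<N. - ((c (lev j))\<^sup>2 * ((real (lev j) * (real (lev j) + 1) - (of_int s)\<^sup>2) / 2)))"
    unfolding of_real_sum of_real_mult[symmetric]
    by (intro sum.cong refl arg_cong[where f=of_real]) (simp only: minus_divide_left[symmetric] mult_minus_right)
  finally show ?thesis .
qed

text \<open>Uniform convergence on the compact set {0}. The orders 0, 1 and 2 give k(0), k'(0) and
  k''(0) as limits of explicit partial sums.\<close>

lemma vderiv_limit: "(\<lambda>N. (vderiv ^^ j) (pcov N) 0) \<longlonglongrightarrow> (vderiv ^^ j) (circ_cov D c s) 0"
proof -
  have "\<forall>j K. compact K \<longrightarrow>
      uniform_limit K (\<lambda>N. (vderiv ^^ j) (pcov N)) ((vderiv ^^ j) (circ_cov D c s)) sequentially"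
    using conv unfolding converges_Cinf_def by (elim conjE)
  then have "uniform_limit {0} (\<lambda>N. (vderiv ^^ j) (pcov N)) ((vderiv ^^ j) (circ_cov D c s)) sequentially"
    by (elim allE[of _ j] allE[of _ "{0}"] mp) simp
  from tendsto_uniform_limitI[OF this, of 0] show ?thesis by simp
qed

lemma smooth_circ_cov: "smooth_on_open UNIV (circ_cov D c s)"
  using conv unfolding converges_Cinf_def by (elim conjE)

lemma of_real_sums_imp:
  fixes z :: complex
  assumes "(\<lambda>N. of_real (\<Sum>j<N. g j)) \<longlonglongrightarrow> z"
  shows "g sums Re z" "z = of_real (Re z)"
proof -
  show "g sums Re z" using tendsto_Re[OF assms] by (simp add: sums_def)
  have "(\<lambda>N. 0) \<longlonglongrightarrow> Im z" using tendsto_Im[OF assms] by simp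
  then have "Im z = 0" using LIMSEQ_unique tendsto_const by blast
  then show "z = of_real (Re z)" by (simp add: complex_eq_iff)
qed

lemma circ_cov_0:
  "(\<lambda>j. (c (lev j))\<^sup>2) sums Re (circ_cov D c s 0)" "circ_cov D c s 0 = of_real (Re (circ_cov D c s 0))"
proof -
  have "pcov N 0 = of_real (\<Sum>j<N. (c (lev j))\<^sup>2)" for N
    by (simp add: shifted_def circ_cov_term_def wigner_d_0[OF s_weights])
  then have "(\<lambda>N. of_real (\<Sum>j<N. (c (lev j))\<^sup>2)) \<longlonglongrightarrow> circ_cov D c s 0"
    using vderiv_limit[of 0] by simp
  from of_real_sums_imp[OF this] show
    "(\<lambda>j. (c (lev j))\<^sup>2) sums Re (circ_cov D c s 0)" "circ_cov D c s 0 = of_real (Re (circ_cov D c s 0))" .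
qed

lemma circ_cov_1: "vderiv (circ_cov D c s) 0 = 0"
  using vderiv_limit[of 1] LIMSEQ_unique[OF _ tendsto_const[of 0]]
  by (auto simp: vderiv_pcov wigner_d'_0)

text \<open>Twice the constant \<open>\<xi>\<^sup>2\<close> of the theorem.\<close>

definition \<kappa> :: real where "\<kappa> = - Re ((vderiv ^^ 2) (circ_cov D c s) 0)"

lemma circ_cov_2:
  "(\<lambda>j. (c (lev j))\<^sup>2 * ((real (lev j) * (real (lev j) + 1) - (of_int s)\<^sup>2) / 2)) sums \<kappa>"
  "(vderiv ^^ 2) (circ_cov D c s) 0 = of_real (- \<kappa>)"
proof -
  have "(\<lambda>N. of_real (\<Sum>j<N. - ((c (lev j))\<^sup>2 * ((real (lev j) * (real (lev j) + 1) - (of_int s)\<^sup>2) / 2))))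
      \<longlonglongrightarrow> (vderiv ^^ 2) (circ_cov D c s) 0"
    using vderiv_limit[of 2] by (simp only: numeral_2_eq_2 funpow.simps o_apply id_apply vderiv2_pcov)
  note 1 = of_real_sums_imp[OF this]
  show "(vderiv ^^ 2) (circ_cov D c s) 0 = of_real (- \<kappa>)" using 1(2) by (simp add: \<kappa>_def)
  show "(\<lambda>j. (c (lev j))\<^sup>2 * ((real (lev j) * (real (lev j) + 1) - (of_int s)\<^sup>2) / 2)) sums \<kappa>"
    using sums_minus[OF 1(1)] by (simp add: \<kappa>_def)
qed

lemma lev_bound: "real (lev j) \<le> real (lev j) * (real (lev j) + 1) - (of_int s)\<^sup>2"
proof -
  have "\<bar>real_of_int s\<bar> \<le> real (lev j)" by simp
  from power_mono[OF this abs_ge_zero, of 2] have "(real_of_int s)\<^sup>2 \<le> (real (lev j))\<^sup>2"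
    by (simp only: power2_abs)
  then show ?thesis by (simp add: algebra_simps power2_eq_square)
qed

text \<open>As s is nonzero, all degrees are at least 1 and \<open>lev_bound\<close> makes every
  term positive. The curvature computation uses this to have a nondegenerate metric.\<close>

lemma \<kappa>_pos: "\<kappa> > 0"
proof -
  have lev_pos: "real (lev j) > 0" for j using s_nonzero by simp
  have "(c (lev j))\<^sup>2 * ((real (lev j) * (real (lev j) + 1) - (of_int s)\<^sup>2) / 2) > 0" for j
    using lev_bound[of j] lev_pos[of j] c_lev_pos[of j] by (intro mult_pos_pos) auto
  then show ?thesis
    using suminf_pos[OF sums_summable[OF circ_cov_2(1)]] sums_unique[OF circ_cov_2(1)] by simp
qed

text \<open>The degree \<open>l\<close> enters \<open>\<kappa>\<close> with a weight growing like \<open>l\<^sup>2\<close>, so that \<open>c\<close> is summable by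
  \<open>2 c\<^sub>l \<le> l\<^sup>2 c\<^sub>l\<^sup>2 + 1 / l\<^sup>2\<close>.\<close>

lemma summable_c: "summable (\<lambda>j. c (lev j))"
proof -
  let ?g = "\<lambda>j. (c (lev j))\<^sup>2 * ((real (lev j) * (real (lev j) + 1) - (of_int s)\<^sup>2) / 2)"
  \<comment> \<open>With n = |s| \<ge> 1 and l = n + j, the bracket l (l + 1) - s^2 equals j^2 + 2nj
    + n + j. The factor 8 further down is this 4 times the 2 that undoes the halving in ?g.\<close>
  have q: "real (Suc j)^2 \<le> 4 * (real (lev j) * (real (lev j) + 1) - (of_int s)\<^sup>2)" for j
  proof -
    have n: "\<bar>real_of_int s\<bar> = real (nat \<bar>s\<bar>)" by simp
    have s2: "(real_of_int s)\<^sup>2 = (real (nat \<bar>s\<bar>))\<^sup>2" by (metis n power2_abs)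
    have n1: "real (nat \<bar>s\<bar>) \<ge> 1" using s_nonzero by simp
    show ?thesis
      unfolding s2 using n1
      by (simp add: power2_eq_square algebra_simps)
        (smt (verit) mult_nonneg_nonneg of_nat_0_le_iff mult_right_mono)
  qed
  have "summable (\<lambda>j. inverse ((real (Suc j))\<^sup>2))"
    by (subst summable_Suc_iff[where f="\<lambda>n. inverse ((real n)\<^sup>2)"]) (rule inverse_power_summable, simp)
  then have "summable (\<lambda>j. 8 * ?g j + inverse ((real (Suc j))\<^sup>2))"
    by (intro summable_add summable_mult sums_summable[OF circ_cov_2(1)])
  then show ?thesis
  proof (rule summable_comparison_test'[where N=0])
    fix j
    have "2 * (c (lev j)) \<le> (c (lev j))\<^sup>2 * (real (Suc j))\<^sup>2 + inverse ((real (Suc j))\<^sup>2)"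
    proof -
      have "0 \<le> (c (lev j) * real (Suc j) - inverse (real (Suc j)))\<^sup>2" by simp
      also have "\<dots> = (c (lev j))\<^sup>2 * (real (Suc j))\<^sup>2 - 2 * c (lev j) + inverse ((real (Suc j))\<^sup>2)"
        by (simp add: power2_diff power_mult_distrib power_inverse del: of_nat_Suc)
      finally show ?thesis by simp
    qed
    also have "(c (lev j))\<^sup>2 * (real (Suc j))\<^sup>2 \<le> (c (lev j))\<^sup>2 * (4 * (real (lev j) * (real (lev j) + 1) - (of_int s)\<^sup>2))"
      by (intro mult_left_mono q) simp
    finally have "2 * c (lev j) \<le> 8 * ?g j + inverse ((real (Suc j))\<^sup>2)" by (simp add: field_simps)
    then show "norm (c (lev j)) \<le> 8 * ?g j + inverse ((real (Suc j))\<^sup>2)"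
      using c_lev_pos[of j] by simp
  qed
qed

definition kr :: "real \<Rightarrow> real" where "kr \<theta> = Re (circ_cov D c s \<theta>)"

lemma kr_deriv:
  "(kr has_real_derivative Re (vderiv (circ_cov D c s) \<theta>)) (at \<theta>)"
  using bounded_linear.has_vector_derivative[OF bounded_linear_Re smooth_real_DERIV[OF smooth_circ_cov]]
  by (simp add: kr_def[abs_def] has_real_derivative_iff_has_vector_derivative)

lemma kr_deriv2:
  "((\<lambda>\<theta>. Re (vderiv (circ_cov D c s) \<theta>)) has_real_derivative - \<kappa>) (at 0)"
  using bounded_linear.has_vector_derivative[OF bounded_linear_Re smooth_real_DERIV[OF smooth_vderiv[OF smooth_circ_cov]], of 0]
    circ_cov_2(2)
  by (simp add: has_real_derivative_iff_has_vector_derivative numeral_2_eq_2)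

text \<open>The increment is compared with 1 - cos \<theta> rather than with \<theta>^2, because cos
  \<theta> is an entry of the rotation matrix. Since k'(0) = 0, the quotient k'(\<theta>)/\<theta>
  tends to -\<kappa>, and l'Hopital's rule passes from k'/sin to the quotient of the functions
  themselves.\<close>

lemma kr_expansion:
  obtains r where "\<And>\<theta>. 0 \<le> \<theta> \<Longrightarrow> \<theta> \<le> pi \<Longrightarrow> kr 0 - kr \<theta> = r \<theta> * (2 * (1 - cos \<theta>))"
    "isCont r 0" "r 0 = \<kappa> / 2"
proof -
  let ?k' = "\<lambda>\<theta>. Re (vderiv (circ_cov D c s) \<theta>)"
  \<comment> \<open>The default is the limit at 0. On [0, pi] it is taken only at \<theta> = 0,
    where both sides of the factorization vanish.\<close>
  define r where "r \<theta> = (if cos \<theta> = 1 then \<kappa> / 2 else (kr 0 - kr \<theta>) / (2 * (1 - cos \<theta>)))" for \<theta>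
  have ev: "\<forall>\<^sub>F \<theta>::real in at 0. \<theta> \<noteq> 0 \<and> \<bar>\<theta>\<bar> < pi"
    unfolding eventually_at by (intro exI[of _ pi]) (auto simp: dist_real_def)
  have sin0: "\<forall>\<^sub>F \<theta>::real in at 0. sin \<theta> \<noteq> 0"
    using ev by eventually_elim (metis abs_less_iff less_minus_iff sin_gt_zero sin_minus neg_equal_0_iff_equal order_less_irrefl linorder_neqE_linordered_idom minus_less_iff neg_0_less_iff_less)
  have cos0: "\<forall>\<^sub>F \<theta>::real in at 0. cos \<theta> \<noteq> 1"
    using sin0 by eventually_elim (metis cos_one_sin_zero)
  have "((\<lambda>\<theta>. ?k' \<theta> / \<theta>) \<longlongrightarrow> - \<kappa>) (at 0)"
    using kr_deriv2[unfolded has_field_derivative_iff] circ_cov_1 by simp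
  moreover have "((\<lambda>\<theta>::real. sin \<theta> / \<theta>) \<longlongrightarrow> 1) (at 0)"
    using DERIV_sin[of "0::real", unfolded has_field_derivative_iff] by simp
  ultimately have "((\<lambda>\<theta>. - (?k' \<theta> / \<theta>) / (2 * (sin \<theta> / \<theta>))) \<longlongrightarrow> - (- \<kappa>) / (2 * 1)) (at 0)"
    by (intro tendsto_intros) auto
  then have "((\<lambda>\<theta>. - ?k' \<theta> / (2 * sin \<theta>)) \<longlongrightarrow> - (- \<kappa>) / (2 * 1)) (at 0)"
    by (rule Lim_transform_eventually) (use ev in \<open>auto elim!: eventually_mono simp: divide_simps\<close>)
  then have "((\<lambda>\<theta>. - ?k' \<theta> / (2 * sin \<theta>)) \<longlongrightarrow> \<kappa> / 2) (at 0)" by simp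
  then have "((\<lambda>\<theta>. (kr 0 - kr \<theta>) / (2 * (1 - cos \<theta>))) \<longlongrightarrow> \<kappa> / 2) (at 0)"
  proof (rule lhopital[rotated -1])
    have "isCont kr 0" using kr_deriv DERIV_isCont by blast
    then show "((\<lambda>\<theta>. kr 0 - kr \<theta>) \<longlongrightarrow> 0) (at 0)"
      using tendsto_diff[OF tendsto_const[of "kr 0"], of kr "kr 0" "at 0"] by (simp add: isCont_def)
    have "((\<lambda>\<theta>::real. 2 * (1 - cos \<theta>)) \<longlongrightarrow> 2 * (1 - cos 0)) (at 0)" by (intro tendsto_intros)
    then show "((\<lambda>\<theta>::real. 2 * (1 - cos \<theta>)) \<longlongrightarrow> 0) (at 0)" by simp
    show "\<forall>\<^sub>F x in at 0. ((\<lambda>\<theta>. kr 0 - kr \<theta>) has_real_derivative - ?k' x) (at x)"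
      using DERIV_diff[OF DERIV_const[of "kr 0"] kr_deriv] by (intro always_eventually allI) simp
    show "\<forall>\<^sub>F x in at 0. ((\<lambda>\<theta>. 2 * (1 - cos \<theta>)) has_real_derivative 2 * sin x) (at x)"
      by (intro always_eventually allI) (auto intro!: derivative_eq_intros)
    show "\<forall>\<^sub>F x::real in at 0. 2 * (1 - cos x) \<noteq> 0" using cos0 by eventually_elim simp
    show "\<forall>\<^sub>F x::real in at 0. 2 * sin x \<noteq> 0" using sin0 by eventually_elim simp
  qed
  then have "(r \<longlongrightarrow> \<kappa> / 2) (at 0)"
  proof (rule Lim_transform_eventually)
    show "\<forall>\<^sub>F \<theta> in at 0. (kr 0 - kr \<theta>) / (2 * (1 - cos \<theta>)) = r \<theta>"
      using cos0 by eventually_elim (simp add: r_def)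
  qed
  then have "(r \<longlongrightarrow> r 0) (at 0)" by (simp add: r_def)
  then have "isCont r 0" by (simp add: isCont_def)
  moreover have "kr 0 - kr \<theta> = r \<theta> * (2 * (1 - cos \<theta>))" if "0 \<le> \<theta>" "\<theta> \<le> pi" for \<theta>
  proof (cases "cos \<theta> = 1")
    case True
    then have "\<theta> = 0" using that cos_inj_pi[of \<theta> 0] by simp
    then show ?thesis by simp
  qed (simp add: r_def)
  ultimately show thesis using that[of r] by (simp add: r_def)
qed

text \<open>The covariance E f(p) f(q), as the variances in \<open>centered_gaussian_field\<close>
  show.\<close>

definition covK :: "real^3^3 \<Rightarrow> real^3^3 \<Rightarrow> real" where
  "covK p q = (\<Sum>j. (c (lev j))\<^sup>2 / 2 * Re (D (lev j) s s (transpose q ** p)))"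

lemma summable_covK:
  assumes "p \<in> SO3" "q \<in> SO3"
  shows "summable (\<lambda>j. (c (lev j))\<^sup>2 / 2 * Re (D (lev j) s s (transpose q ** p)))"
proof (rule summable_comparison_test'[where N=0])
  show "summable (\<lambda>j. (c (lev j))\<^sup>2 / 2)"
    using sums_summable[OF circ_cov_0(1)] by (rule summable_divide)
  fix j
  have "\<bar>Re (D (lev j) s s (transpose q ** p))\<bar> \<le> 1"
    using D_norm_le_1[OF SO3_mult[OF SO3_transpose[OF assms(2)] assms(1)] s_weights s_weights, of j]
      abs_Re_le_cmod order_trans by blast
  then show "norm ((c (lev j))\<^sup>2 / 2 * Re (D (lev j) s s (transpose q ** p))) \<le> (c (lev j))\<^sup>2 / 2"
    by (simp add: abs_mult mult_left_le)
qed

lemma covK_same: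
  assumes "p \<in> SO3"
  shows "(\<lambda>j. (c (lev j))\<^sup>2 / 2) sums covK p p"
  using summable_sums[OF summable_covK[OF assms assms]] assms
  by (simp add: covK_def SO3_iff D_1[OF s_weights s_weights])

lemma covK_same_eq: "p \<in> SO3 \<Longrightarrow> covK p p = kr 0 / 2"
  using sums_unique2[OF covK_same[of p] sums_divide[OF circ_cov_0(1), of 2]] by (simp add: kr_def)

text \<open>Unitarity makes the entries at q^-1 p and p^-1 q complex conjugates of each
  other.\<close>

lemma covK_commute:
  assumes "p \<in> SO3" "q \<in> SO3"
  shows "covK p q = covK q p"
proof -
  have "Re (D l s s (transpose q ** p)) = Re (D l s s (transpose p ** q))" if "s \<in> weights l" for l
  proof -
    have "D l s s (transpose q ** p) = cnj (D l s s (transpose p ** q))"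
      by (simp add: D_inner[OF _ _ that that, symmetric] assms mult.commute)
    then show ?thesis by simp
  qed
  then show ?thesis by (simp add: covK_def s_weights)
qed

lemma covK_euler:
  assumes pq: "p \<in> SO3" "q \<in> SO3" and x: "transpose q ** p = euler x"
  shows "covK p q = cos (of_int s * (x$1 + x$3)) * kr (x$2) / 2"
proof -
  let ?t = "\<lambda>j. shifted s (circ_cov_term D c s (x$2)) j"
  have sm: "summable ?t"
  proof (rule summable_comparison_test'[where N=0])
    show "summable (\<lambda>j. (c (lev j))\<^sup>2)" by (rule sums_summable[OF circ_cov_0(1)])
    fix j show "norm (?t j) \<le> (c (lev j))\<^sup>2"
      using D_norm_le_1[OF SO3_R(2) s_weights s_weights, of j "x$2"]
      by (simp add: shifted_def circ_cov_term_def wigner_d_def norm_mult norm_power mult_left_le)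
  qed
  have "(c (lev j))\<^sup>2 / 2 * Re (D (lev j) s s (transpose q ** p))
      = cos (of_int s * (x$1 + x$3)) / 2 * Re (?t j)" for j
  proof -
    have "Im (wigner_d D (lev j) s s (x$2)) = 0"
      using wigner_d_real[OF s_weights, of j "x$2"] by (simp add: complex_eq_iff)
    then show ?thesis
      by (simp add: x D_euler[OF s_weights] shifted_def circ_cov_term_def)
  qed
  then have "covK p q = (\<Sum>j. cos (of_int s * (x$1 + x$3)) / 2 * Re (?t j))"
    by (simp add: covK_def)
  also have "\<dots> = cos (of_int s * (x$1 + x$3)) / 2 * (\<Sum>j. Re (?t j))"
    by (rule suminf_mult) (rule bounded_linear.summable[OF bounded_linear_Re sm])
  also have "(\<Sum>j. Re (?t j)) = kr (x$2)"
    unfolding kr_def circ_cov_def by (rule bounded_linear.suminf[OF bounded_linear_Re sm, symmetric])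
  finally show ?thesis by simp
qed

lemma chebC_1: "chebC n 1 = 1 \<and> chebS n 1 = real n"
  by (induction n) auto

text \<open>The rotations \<open>q n\<close> tend to 1 with first order term \<open>hat w\<close>,
  while their individual angles phi and psi are uncontrolled. The third column yields 1 - cos
  \<theta> to second order, governed by w1^2 + w2^2, and the upper left block yields the sine and
  cosine of y = phi + psi, governed by w3.\<close>

lemma covK_expansion:
  assumes p: "p \<in> SO3" and P: "\<And>n. P n \<in> SO3" and h: "h \<longlonglongrightarrow> 0" "\<And>n. h n \<noteq> 0"
    and lim: "(\<lambda>n. (P n - p) /\<^sub>R h n) \<longlonglongrightarrow> p ** hat w"
    and k0: "kr 0 = 2"
  shows "(\<lambda>n. (2 - 2 * covK (P n) p) / (h n)\<^sup>2) \<longlonglongrightarrow> berger (\<kappa> / 2) ((of_int s)\<^sup>2) w w"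
proof -
  define q where "q n = transpose p ** P n" for n
  have qS: "q n \<in> SO3" for n unfolding q_def by (intro SO3_mult SO3_transpose p P)
  have "(\<lambda>n. transpose p ** ((P n - p) /\<^sub>R h n)) \<longlonglongrightarrow> transpose p ** (p ** hat w)"
    by (intro mm.tendsto tendsto_const lim)
  then have "(\<lambda>n. (q n - mat 1) /\<^sub>R h n) \<longlonglongrightarrow> hat w"
    using p by (simp add: SO3_cancel[OF p] mm.scaleR_right mm.diff_right q_def SO3_iff)
  then have ent: "(\<lambda>n. (q n $ i $ j - (if i = j then 1 else 0)) / h n) \<longlonglongrightarrow> hat w $ i $ j" for i j
    using tendsto_vec_nth[OF tendsto_vec_nth, of "\<lambda>n. (q n - mat 1) /\<^sub>R h n"]
    by (simp add: mat_def divide_inverse_commute)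
  have ent0: "(\<lambda>n. q n $ i $ j) \<longlonglongrightarrow> (if i = j then 1 else 0)" for i j
  proof -
    have "(\<lambda>n. (q n $ i $ j - (if i = j then 1 else 0)) / h n * h n + (if i = j then 1 else 0))
        \<longlonglongrightarrow> hat w $ i $ j * 0 + (if i = j then 1 else 0)"
      by (intro tendsto_intros ent h(1))
    then show ?thesis using h(2) by simp
  qed
  have "\<exists>x. q n = euler x \<and> 0 \<le> x $ 2 \<and> x $ 2 \<le> pi" for n
    using euler_surj[OF qS] by metis
  then obtain x where x: "\<And>n. q n = euler (x n)" "\<And>n. 0 \<le> x n $ 2" "\<And>n. x n $ 2 \<le> pi" by metis
  define \<theta> where "\<theta> n = x n $ 2" for n
  define y where "y n = x n $ 1 + x n $ 3" for n
  have q33: "q n $ 3 $ 3 = cos (\<theta> n)"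
    and qc: "q n $ 1 $ 1 + q n $ 2 $ 2 = (1 + cos (\<theta> n)) * cos (y n)"
    and qs: "q n $ 2 $ 1 - q n $ 1 $ 2 = (1 + cos (\<theta> n)) * sin (y n)"
    and q3: "(q n $ 1 $ 3)\<^sup>2 + (q n $ 2 $ 3)\<^sup>2 = (1 - cos (\<theta> n)) * (1 + cos (\<theta> n))" for n
  proof -
    show "q n $ 3 $ 3 = cos (\<theta> n)" "q n $ 1 $ 1 + q n $ 2 $ 2 = (1 + cos (\<theta> n)) * cos (y n)"
      "q n $ 2 $ 1 - q n $ 1 $ 2 = (1 + cos (\<theta> n)) * sin (y n)"
      unfolding x(1) euler_def R3_def R2_def \<theta>_def y_def
      by (simp_all add: matrix_matrix_mult_def sum_3 cos_add sin_add algebra_simps)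
    have "(q n $ 1 $ 3)\<^sup>2 + (q n $ 2 $ 3)\<^sup>2 = (sin (\<theta> n))\<^sup>2 * ((cos (x n $ 1))\<^sup>2 + (sin (x n $ 1))\<^sup>2)"
      unfolding x(1) euler_def R3_def R2_def \<theta>_def y_def
      by (simp add: matrix_matrix_mult_def sum_3 power_mult_distrib flip: distrib_right)
    then show "(q n $ 1 $ 3)\<^sup>2 + (q n $ 2 $ 3)\<^sup>2 = (1 - cos (\<theta> n)) * (1 + cos (\<theta> n))"
      by (simp add: sin_squared_eq power2_eq_square algebra_simps)
  qed
  have ct: "(\<lambda>n. cos (\<theta> n)) \<longlonglongrightarrow> 1" using ent0[of 3 3] by (simp add: q33)
  \<comment> \<open>Convergence of cos \<theta> to 1 gives that of \<theta> to 0 because \<theta>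
    lies in [0, pi].\<close>
  have "(\<lambda>n. arccos (cos (\<theta> n))) \<longlonglongrightarrow> arccos 1"
    by (rule continuous_on_tendsto_compose[OF continuous_on_arccos' ct]) auto
  then have th: "\<theta> \<longlonglongrightarrow> 0" using x(2,3) by (simp add: \<theta>_def[abs_def] arccos_cos)
  have pos: "\<forall>\<^sub>F n in sequentially. 1 + cos (\<theta> n) > 1"
    using order_tendstoD(1)[OF ct, of 0] by (auto elim: eventually_mono)
  have l1: "(\<lambda>n. (1 - cos (\<theta> n)) / (h n)\<^sup>2) \<longlonglongrightarrow> ((w$1)\<^sup>2 + (w$2)\<^sup>2) / 2"
  proof -
    have "(\<lambda>n. ((q n $ 1 $ 3 / h n)\<^sup>2 + (q n $ 2 $ 3 / h n)\<^sup>2) / (1 + cos (\<theta> n)))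
        \<longlonglongrightarrow> ((hat w $ 1 $ 3)\<^sup>2 + (hat w $ 2 $ 3)\<^sup>2) / (1 + 1)"
      using ent[of 1 3] ent[of 2 3] by (intro tendsto_intros ct) auto
    moreover have "\<forall>\<^sub>F n in sequentially. ((q n $ 1 $ 3 / h n)\<^sup>2 + (q n $ 2 $ 3 / h n)\<^sup>2) / (1 + cos (\<theta> n))
        = (1 - cos (\<theta> n)) / (h n)\<^sup>2"
      using pos by eventually_elim
        (simp add: power_divide add_divide_distrib[symmetric] q3 h(2))
    ultimately show ?thesis
      using Lim_transform_eventually by (fastforce simp: hat_def add.commute)
  qed
  have cy: "(\<lambda>n. cos (y n)) \<longlonglongrightarrow> 1"
  proof -
    have "(\<lambda>n. (q n $ 1 $ 1 + q n $ 2 $ 2) / (1 + cos (\<theta> n))) \<longlonglongrightarrow> (1 + 1) / (1 + 1)"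
      using ent0[of 1 1] ent0[of 2 2] by (intro tendsto_intros ct) auto
    moreover have "\<forall>\<^sub>F n in sequentially. (q n $ 1 $ 1 + q n $ 2 $ 2) / (1 + cos (\<theta> n)) = cos (y n)"
      using pos by eventually_elim (simp add: qc)
    ultimately show ?thesis using Lim_transform_eventually by fastforce
  qed
  have sy: "(\<lambda>n. sin (y n) / h n) \<longlonglongrightarrow> w$3"
  proof -
    have "(\<lambda>n. (q n $ 2 $ 1 / h n - q n $ 1 $ 2 / h n) / (1 + cos (\<theta> n)))
        \<longlonglongrightarrow> (hat w $ 2 $ 1 - hat w $ 1 $ 2) / (1 + 1)"
      using ent[of 2 1] ent[of 1 2] by (intro tendsto_intros ct) auto
    moreover have "\<forall>\<^sub>F n in sequentially. (q n $ 2 $ 1 / h n - q n $ 1 $ 2 / h n) / (1 + cos (\<theta> n)) = sin (y n) / h n"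
      using pos by eventually_elim (simp add: diff_divide_distrib[symmetric] qs)
    ultimately show ?thesis
      using Lim_transform_eventually by (fastforce simp: hat_def)
  qed
  have l2: "(\<lambda>n. (1 - cos (y n)) / (h n)\<^sup>2) \<longlonglongrightarrow> (w$3)\<^sup>2 / 2"
  proof -
    have "(\<lambda>n. (sin (y n) / h n)\<^sup>2 / (1 + cos (y n))) \<longlonglongrightarrow> (w$3)\<^sup>2 / (1 + 1)"
      by (intro tendsto_intros sy cy) auto
    moreover have "\<forall>\<^sub>F n in sequentially. 1 + cos (y n) > 1"
      using order_tendstoD(1)[OF cy, of 0] by (auto elim: eventually_mono)
    then have "\<forall>\<^sub>F n in sequentially. (sin (y n) / h n)\<^sup>2 / (1 + cos (y n)) = (1 - cos (y n)) / (h n)\<^sup>2"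
    proof eventually_elim
      case (elim n)
      have "(sin (y n))\<^sup>2 = (1 - cos (y n)) * (1 + cos (y n))"
        by (simp add: sin_squared_eq power2_eq_square algebra_simps)
      then show ?case using elim by (simp add: power_divide)
    qed
    ultimately show ?thesis using Lim_transform_eventually by fastforce
  qed
  \<comment> \<open>The angle y is known only modulo 2 pi, through its sine and cosine. As s is an
    integer, cos(s y) is a polynomial in cos y, whose derivative at 1 is |s| times |s|.\<close>
  let ?C = "chebC (nat \<bar>s\<bar>)"
  have sC: "cos (of_int s * y n) = ?C (cos (y n))" for n
  proof -
    have "cos (of_int s * y n) = cos (\<bar>of_int s\<bar> * y n)" by (cases "s \<ge> 0") auto
    then show ?thesis using cheb_cos[of "nat \<bar>s\<bar>" "y n"] by simp
  qed
  \<comment> \<open>The Caratheodory slope avoids dividing by cos y - 1, which may vanish along the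
    sequence.\<close>
  obtain g where g: "\<And>z. ?C z - ?C 1 = g z * (z - 1)" "isCont g 1" "g 1 = real (nat \<bar>s\<bar>) * chebS (nat \<bar>s\<bar>) 1"
    using cheb_deriv[of "nat \<bar>s\<bar>" 1, THEN conjunct1] unfolding CARAT_DERIV by blast
  have g1: "g 1 = (of_int s)\<^sup>2" using g(3) chebC_1[of "nat \<bar>s\<bar>"]
    by (simp add: power2_eq_square[symmetric])
  have l3: "(\<lambda>n. 2 * (1 - cos (of_int s * y n)) / (h n)\<^sup>2) \<longlonglongrightarrow> (of_int s)\<^sup>2 * (w$3)\<^sup>2"
  proof -
    have a: "(\<lambda>n. 2 * g (cos (y n)) * ((1 - cos (y n)) / (h n)\<^sup>2)) \<longlonglongrightarrow> 2 * g 1 * ((w$3)\<^sup>2 / 2)"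
      by (intro tendsto_intros l2 isCont_tendsto_compose[OF g(2)] cy)
    have e: "2 * g (cos (y n)) * ((1 - cos (y n)) / (h n)\<^sup>2) = 2 * (1 - cos (of_int s * y n)) / (h n)\<^sup>2" for n
    proof -
      have "1 - cos (of_int s * y n) = g (cos (y n)) * (1 - cos (y n))"
        using g(1)[of "cos (y n)"] chebC_1[of "nat \<bar>s\<bar>"] unfolding sC by (simp add: algebra_simps)
      then show ?thesis by simp
    qed
    show ?thesis using a unfolding e by (simp add: g1)
  qed
  obtain r where r: "\<And>\<theta>. 0 \<le> \<theta> \<Longrightarrow> \<theta> \<le> pi \<Longrightarrow> kr 0 - kr \<theta> = r \<theta> * (2 * (1 - cos \<theta>))"
    "isCont r 0" "r 0 = \<kappa> / 2" by (rule kr_expansion) blast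
  \<comment> \<open>Rests on the splitting 2 - cos(s y) k(\<theta>) = cos(s y) (2 - k(\<theta>)) + 2
    (1 - cos(s y)), whose two parts give the first two eigenvalues and the third one.\<close>
  have lim0: "(\<lambda>n. ?C (cos (y n)) * (r (\<theta> n) * 2 * ((1 - cos (\<theta> n)) / (h n)\<^sup>2)) + 2 * (1 - cos (of_int s * y n)) / (h n)\<^sup>2)
     \<longlonglongrightarrow> ?C 1 * (r 0 * 2 * (((w$1)\<^sup>2 + (w$2)\<^sup>2) / 2)) + (of_int s)\<^sup>2 * (w$3)\<^sup>2"
    by (intro tendsto_intros l1 l3 isCont_tendsto_compose[OF r(2)] th
        isCont_tendsto_compose[OF DERIV_isCont[OF cheb_deriv[THEN conjunct1]]] cy)
  have eq0: "?C (cos (y n)) * (r (\<theta> n) * 2 * ((1 - cos (\<theta> n)) / (h n)\<^sup>2)) + 2 * (1 - cos (of_int s * y n)) / (h n)\<^sup>2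
     = (2 - 2 * covK (P n) p) / (h n)\<^sup>2" for n
  proof -
    have k: "2 - kr (\<theta> n) = r (\<theta> n) * (2 * (1 - cos (\<theta> n)))"
      using r(1)[of "\<theta> n"] x(2,3) k0 by (simp add: \<theta>_def)
    have "transpose p ** P n = euler (x n)" using x(1)[of n] by (simp add: q_def)
    then have "covK (P n) p = cos (of_int s * y n) * kr (\<theta> n) / 2"
      unfolding \<theta>_def y_def by (rule covK_euler[OF P p])
    then have "2 - 2 * covK (P n) p = cos (of_int s * y n) * (2 - kr (\<theta> n)) + 2 * (1 - cos (of_int s * y n))"
      by (simp add: algebra_simps)
    then have e: "2 - 2 * covK (P n) p = cos (of_int s * y n) * (r (\<theta> n) * (2 * (1 - cos (\<theta> n)))) + 2 * (1 - cos (of_int s * y n))"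
      unfolding k .
    show ?thesis unfolding e sC[symmetric] by (simp only: add_divide_distrib times_divide_eq_right mult.assoc)
  qed
  have "?C 1 * (r 0 * 2 * (((w$1)\<^sup>2 + (w$2)\<^sup>2) / 2)) + (of_int s)\<^sup>2 * (w$3)\<^sup>2 = berger (\<kappa> / 2) ((of_int s)\<^sup>2) w w"
    using chebC_1[of "nat \<bar>s\<bar>"] r(3) by (simp add: berger_def power2_eq_square)
  then show ?thesis
    using lim0 unfolding eq0 by (simp only:)
qed

end

section \<open>Spin fields\<close>

lemma has_vector_derivative_sequence:
  fixes f :: "real \<Rightarrow> 'a::real_normed_vector"
  assumes f: "(f has_vector_derivative v) (at 0)" and h: "h \<longlonglongrightarrow> 0" "\<And>n. h n \<noteq> 0"
  shows "(\<lambda>n. (f (h n) - f 0) /\<^sub>R h n) \<longlonglongrightarrow> v"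
proof -
  have "filterlim h (at 0) sequentially"
    using h by (intro filterlim_atI) auto
  moreover have "((\<lambda>y. (f y - f 0 - y *\<^sub>R v) /\<^sub>R norm y) \<longlongrightarrow> 0) (at 0)"
    using f by (simp add: has_vector_derivative_def has_derivative_def)
  ultimately have "(\<lambda>n. (f (h n) - f 0 - h n *\<^sub>R v) /\<^sub>R norm (h n)) \<longlonglongrightarrow> 0"
    by (rule filterlim_compose[rotated])
  then have "(\<lambda>n. norm ((f (h n) - f 0 - h n *\<^sub>R v) /\<^sub>R norm (h n))) \<longlonglongrightarrow> 0"
    by (rule tendsto_norm_zero)
  moreover have "norm ((f (h n) - f 0 - h n *\<^sub>R v) /\<^sub>R norm (h n)) = norm ((f (h n) - f 0) /\<^sub>R h n - v)" for n
  proof -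
    have "(f (h n) - f 0) /\<^sub>R h n - v = (f (h n) - f 0 - h n *\<^sub>R v) /\<^sub>R h n"
      using h(2)[of n] by (simp add: scaleR_diff_right)
    then show ?thesis by simp
  qed
  ultimately have "(\<lambda>n. norm ((f (h n) - f 0) /\<^sub>R h n - v)) \<longlonglongrightarrow> 0" by (simp only:)
  then show ?thesis
    using LIM_zero_iff tendsto_norm_zero_iff by metis
qed

text \<open>The local smooth extension makes f differentiable within the group, so the linear map
  chosen by \<open>frechet_derivative\<close> is a genuine derivative there. The chain rule along a
  curve in the group then holds for whichever map was chosen.\<close>

lemma diff_SO3_curve:
  assumes f: "smooth_on_subset SO3 f" and C: "\<And>t. C t \<in> SO3" "C 0 = p" "(C has_vector_derivative v) (at 0)"
  shows "((\<lambda>t. f (C t)) has_vector_derivative diff_SO3 f p v) (at 0)"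
    and "linear (diff_SO3 f p)"
proof -
  have p: "p \<in> SO3" using C by auto
  obtain U F where U: "open U" "p \<in> U" "smooth_on_open U F" "\<And>q. q \<in> U \<inter> SO3 \<Longrightarrow> F q = f q"
    using f p unfolding smooth_on_subset_def by metis
  obtain e where e: "e > 0" "ball p e \<subseteq> U" using U open_contains_ball by blast
  have "(F has_derivative frechet_derivative F (at p)) (at p within SO3)"
    using smooth_has_derivative[OF U(3,2)] by (rule has_derivative_at_withinI)
  then have "(f has_derivative frechet_derivative F (at p)) (at p within SO3)"
  proof (rule has_derivative_transform_within[OF _ e(1) p])
    fix q assume "q \<in> SO3" "dist q p < e"
    then have "q \<in> U \<inter> SO3" using e(2) by (auto simp: dist_commute)
    then show "F q = f q" by (rule U(4))
  qed
  then have "f differentiable (at p within SO3)" by (auto simp: differentiable_def)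
  then have L: "(f has_derivative diff_SO3 f p) (at p within SO3)"
    unfolding frechet_derivative_works diff_SO3_def[abs_def] .
  then show lin: "linear (diff_SO3 f p)" by (rule has_derivative_linear)
  have "(f has_derivative diff_SO3 f p) (at (C 0) within range C)"
    unfolding C(2) by (rule has_derivative_subset[OF L]) (use C(1) in auto)
  from diff_chain_within[OF C(3)[unfolded has_vector_derivative_def] this]
  show "((\<lambda>t. f (C t)) has_vector_derivative diff_SO3 f p v) (at 0)"
    by (simp add: has_vector_derivative_def o_def linear_cmul[OF lin])
qed

text \<open>For the differential of the field, which agrees only almost surely with a measurable
  limit of difference quotients.\<close>

lemma AE_cong_borel_completion:
  fixes g Z :: "'a \<Rightarrow> real"
  assumes g: "g \<in> borel_measurable (completion M)" and eq: "AE x in M. g x = Z x"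
  shows "Z \<in> borel_measurable (completion M)"
proof (rule measurableI)
  fix A :: "real set" assume A: "A \<in> sets borel"
  show "Z -` A \<inter> space (completion M) \<in> sets (completion M)"
  proof (rule completion.in_sets_AE)
    show "AE x in completion M. (x \<in> g -` A \<inter> space (completion M)) = (x \<in> Z -` A \<inter> space (completion M))"
      using AE_completion[OF eq] by eventually_elim auto
    show "g -` A \<inter> space (completion M) \<in> sets (completion M)" using g A by (rule measurable_sets)
  qed auto
qed auto

lemma Re_scale: "Re (complex_of_real a * z) = a * Re z"
  by simp

locale spin_random = spin_covariance D c s + prob_space M
  for D c s and M :: "'w measure" +
  fixes \<gamma> :: "nat \<Rightarrow> int \<Rightarrow> 'w \<Rightarrow> complex" and f :: "'w \<Rightarrow> real^3^3 \<Rightarrow> real"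
  assumes iid: "iid_complex_gaussians M s \<gamma>"
    and f_def: "f = (\<lambda>\<omega> p. Re (spin_field D c \<gamma> s \<omega> p))"
begin

definition idx :: "(nat \<times> int) set" where
  "idx = {(l, m). \<bar>s\<bar> \<le> int l \<and> m \<in> weights l}"

lemma indep_\<gamma>: "indep_vars (\<lambda>_. borel) (\<lambda>i. \<gamma> (fst i) (snd i)) idx"
  and gauss_\<gamma>: "\<bar>s\<bar> \<le> int l \<Longrightarrow> m \<in> weights l \<Longrightarrow> complex_gaussian M (\<gamma> l m)"
  using iid by (auto simp: iid_complex_gaussians_def idx_def Let_def case_prod_unfold)

lemma measurable_\<gamma>: "\<bar>s\<bar> \<le> int l \<Longrightarrow> m \<in> weights l \<Longrightarrow> \<gamma> l m \<in> borel_measurable M"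
  using indep_\<gamma> unfolding indep_vars_def by (auto simp: idx_def)

lemma centered_gaussian_combination:
  assumes L: "finite L" "\<And>l. l \<in> L \<Longrightarrow> \<bar>s\<bar> \<le> int l"
  shows "centered_gaussian M (\<lambda>\<omega>. \<Sum>l\<in>L. \<Sum>m\<in>weights l. Re (\<beta> l m * \<gamma> l m \<omega>))
    (\<Sum>l\<in>L. \<Sum>m\<in>weights l. (cmod (\<beta> l m))\<^sup>2 / 2)"
proof -
  let ?A = "Sigma L weights"
  have A: "?A \<subseteq> idx" using L by (auto simp: idx_def)
  have "indep_vars (\<lambda>_. borel) (\<lambda>i \<omega>. Re (\<beta> (fst i) (snd i) * \<gamma> (fst i) (snd i) \<omega>)) ?A"
    by (rule indep_vars_compose2[OF indep_vars_subset[OF indep_\<gamma> A], of "\<lambda>i x. Re (\<beta> (fst i) (snd i) * x)"])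
      (auto intro!: borel_measurable_continuous_onI continuous_intros)
  then have "centered_gaussian M (\<lambda>\<omega>. \<Sum>i\<in>?A. Re (\<beta> (fst i) (snd i) * \<gamma> (fst i) (snd i) \<omega>))
     (\<Sum>i\<in>?A. (cmod (\<beta> (fst i) (snd i)))\<^sup>2 / 2)"
    using L by (intro centered_gaussian_sum complex_gaussian_Re gauss_\<gamma>) auto
  then show ?thesis
    using L by (simp add: sum.Sigma case_prod_unfold)
qed

definition Z :: "nat \<Rightarrow> real^3^3 \<Rightarrow> 'w \<Rightarrow> complex" where
  "Z l p \<omega> = (\<Sum>m\<in>weights l. \<gamma> l m \<omega> * D l m s p)"

lemma measurable_Z [measurable]: "Z (lev j) p \<in> borel_measurable M"
  unfolding Z_def[abs_def]
  by (intro borel_measurable_sum borel_measurable_times measurable_\<gamma> borel_measurable_const) auto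

text \<open>A column of a unitary matrix has norm 1, so the variance depends neither on the point
  nor on the degree.\<close>

lemma centered_gaussian_Z:
  assumes "p \<in> SO3"
  shows "centered_gaussian M (\<lambda>\<omega>. Re (b * Z (lev j) p \<omega>)) ((cmod b)\<^sup>2 / 2)"
proof -
  have "(\<Sum>m\<in>weights (lev j). (cmod (b * D (lev j) m s p))\<^sup>2 / 2)
    = (cmod b)\<^sup>2 / 2 * (\<Sum>m\<in>weights (lev j). (cmod (D (lev j) m s p))\<^sup>2)"
    by (simp add: sum_distrib_left norm_mult power_mult_distrib)
  also have "\<dots> = (cmod b)\<^sup>2 / 2" by (simp add: D_column[OF assms s_weights])
  finally have v: "(\<Sum>m\<in>weights (lev j). (cmod (b * D (lev j) m s p))\<^sup>2 / 2) = (cmod b)\<^sup>2 / 2" .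
  have a: "centered_gaussian M (\<lambda>\<omega>. \<Sum>l\<in>{lev j}. \<Sum>m\<in>weights l. Re (b * D l m s p * \<gamma> l m \<omega>))
    (\<Sum>l\<in>{lev j}. \<Sum>m\<in>weights l. (cmod (b * D l m s p))\<^sup>2 / 2)"
    by (rule centered_gaussian_combination) auto
  have e: "(\<Sum>m\<in>weights (lev j). Re (b * D (lev j) m s p * \<gamma> (lev j) m \<omega>)) = Re (b * Z (lev j) p \<omega>)" for \<omega>
    unfolding Z_def sum_distrib_left Re_sum by (rule sum.cong) (auto simp: algebra_simps)
  have one: "(\<Sum>l\<in>{k}. g l) = g k" for g :: "nat \<Rightarrow> real" and k by simp
  show ?thesis using a unfolding one e v .
qed

lemma AE_summable_field:
  assumes p: "p \<in> SO3"
  shows "AE \<omega> in M. summable (\<lambda>j. of_real (c (lev j)) * Z (lev j) p \<omega>)"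
proof -
  \<comment> \<open>A majorant of the j-th term with expectation 2 c, the two squares contributing
    1/2 each; \<open>summable_c\<close> makes these expectations summable.\<close>
  let ?h = "\<lambda>j \<omega>. c (lev j) * (1 + (Re (Z (lev j) p \<omega>))\<^sup>2 + (Im (Z (lev j) p \<omega>))\<^sup>2)"
  have 1: "integrable M (\<lambda>\<omega>. (Re (Z (lev j) p \<omega>))\<^sup>2)" "(LINT \<omega>|M. (Re (Z (lev j) p \<omega>))\<^sup>2) = 1/2" for j
    using centered_gaussian_square[OF centered_gaussian_Z[OF p, of 1 j]] by simp_all
  \<comment> \<open>The factor -i turns the imaginary part into a real part.\<close>
  have 2: "integrable M (\<lambda>\<omega>. (Im (Z (lev j) p \<omega>))\<^sup>2)" "(LINT \<omega>|M. (Im (Z (lev j) p \<omega>))\<^sup>2) = 1/2" for j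
    using centered_gaussian_square[OF centered_gaussian_Z[OF p, of "- \<i>" j]] by simp_all
  have "AE \<omega> in M. summable (\<lambda>j. ?h j \<omega>)"
  proof (rule AE_summable_integral)
    show "integrable M (?h j)" for j using 1 2 by simp
    show "0 \<le> ?h j \<omega>" for j \<omega> using c_lev_pos[of j] by simp
    have e: "(LINT \<omega>|M. ?h j \<omega>) = 2 * c (lev j)" for j by (simp add: prob_space 1 2)
    show "summable (\<lambda>j. LINT \<omega>|M. ?h j \<omega>)" unfolding e by (rule summable_mult[OF summable_c])
  qed
  then show ?thesis
  proof eventually_elim
    case (elim \<omega>)
    show ?case
    proof (rule summable_comparison_test'[OF elim, where N=0])
      fix j
      have "cmod (Z (lev j) p \<omega>) \<le> \<bar>Re (Z (lev j) p \<omega>)\<bar> + \<bar>Im (Z (lev j) p \<omega>)\<bar>" by (rule cmod_le)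
      also have "\<dots> \<le> 1 + (Re (Z (lev j) p \<omega>))\<^sup>2 + (Im (Z (lev j) p \<omega>))\<^sup>2"
      proof -
        have "2 * \<bar>x\<bar> \<le> 1 + x\<^sup>2" for x :: real
          using zero_le_power2[of "\<bar>x\<bar> - 1"] by (simp add: power2_diff)
        from this[of "Re (Z (lev j) p \<omega>)"] this[of "Im (Z (lev j) p \<omega>)"]
        show ?thesis
          using zero_le_power2[of "Re (Z (lev j) p \<omega>)"] zero_le_power2[of "Im (Z (lev j) p \<omega>)"] by linarith
      qed
      finally show "norm (of_real (c (lev j)) * Z (lev j) p \<omega>) \<le> ?h j \<omega>"
        using c_lev_pos[of j] by (simp add: norm_mult)
    qed
  qed
qed

lemma spin_field_eq: "spin_field D c \<gamma> s \<omega> p = (\<Sum>j. of_real (c (lev j)) * Z (lev j) p \<omega>)"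
  by (simp add: spin_field_def shifted_def[abs_def] Z_def)

lemma measurable_f [measurable]: "(\<lambda>\<omega>. f \<omega> p) \<in> borel_measurable M"
  unfolding f_def spin_field_eq by measurable

lemma AE_field_limit:
  assumes p: "p \<in> SO3"
  shows "AE \<omega> in M. (\<lambda>N. \<Sum>j<N. Re (of_real (c (lev j)) * Z (lev j) p \<omega>)) \<longlonglongrightarrow> f \<omega> p"
  using AE_summable_field[OF p]
proof eventually_elim
  case (elim \<omega>)
  from tendsto_Re[OF summable_LIMSEQ[OF elim]] show ?case
    by (simp add: f_def spin_field_eq)
qed

text \<open>A partial sum of the series is the real part of a finite linear combination of the
  \<gamma>, hence exactly Gaussian, and \<open>D_inner\<close> evaluates its variance. The property
  passes to the almost sure limit.\<close>

theorem centered_gaussian_field: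
  assumes P: "finite P" "P \<subseteq> SO3"
  shows "centered_gaussian M (\<lambda>\<omega>. \<Sum>p\<in>P. a p * f \<omega> p) (\<Sum>p\<in>P. \<Sum>q\<in>P. a p * a q * covK p q)"
proof (rule centered_gaussian_limit)
  let ?t = "\<lambda>j p q. (c (lev j))\<^sup>2 / 2 * Re (D (lev j) s s (transpose q ** p))"
  let ?Y = "\<lambda>N \<omega>. \<Sum>p\<in>P. a p * (\<Sum>j<N. Re (of_real (c (lev j)) * Z (lev j) p \<omega>))"
  show "centered_gaussian M (?Y N) (\<Sum>p\<in>P. \<Sum>q\<in>P. a p * a q * (\<Sum>j<N. ?t j p q))" for N
  proof -
    \<comment> \<open>Up to the factor \<open>c l\<close>, the coefficient of
      \<open>\<gamma> l m\<close> in the combination of field values.\<close>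
    define B where "B l m = (\<Sum>p\<in>P. of_real (a p) * D l m s p)" for l m
    have Bsq: "(\<Sum>m\<in>weights (lev j). (cmod (B (lev j) m))\<^sup>2) = (\<Sum>p\<in>P. \<Sum>q\<in>P. a p * a q * Re (D (lev j) s s (transpose q ** p)))" for j
    proof -
      let ?l = "lev j"
      have "(cmod (B ?l m))\<^sup>2 = (\<Sum>p\<in>P. \<Sum>q\<in>P. a p * a q * Re (cnj (D ?l m s q) * D ?l m s p))" for m
      proof -
        have "of_real ((cmod (B ?l m))\<^sup>2) = B ?l m * cnj (B ?l m)" by (rule complex_norm_square)
        also have "\<dots> = (\<Sum>p\<in>P. \<Sum>q\<in>P. of_real (a p * a q) * (cnj (D ?l m s q) * D ?l m s p))"
          by (simp add: B_def sum_product cnj_sum mult_ac)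
        finally have "Re (of_real ((cmod (B ?l m))\<^sup>2)) = Re (\<Sum>p\<in>P. \<Sum>q\<in>P. of_real (a p * a q) * (cnj (D ?l m s q) * D ?l m s p))"
          by (simp only:)
        then show ?thesis by (simp only: Re_sum Re_scale Re_complex_of_real)
      qed
      then have "(\<Sum>m\<in>weights ?l. (cmod (B ?l m))\<^sup>2)
        = (\<Sum>m\<in>weights ?l. \<Sum>p\<in>P. \<Sum>q\<in>P. a p * a q * Re (cnj (D ?l m s q) * D ?l m s p))" by (simp only:)
      also have "\<dots> = (\<Sum>p\<in>P. \<Sum>q\<in>P. \<Sum>m\<in>weights ?l. a p * a q * Re (cnj (D ?l m s q) * D ?l m s p))"
        by (subst sum.swap) (intro sum.cong refl sum.swap)
      also have "\<dots> = (\<Sum>p\<in>P. \<Sum>q\<in>P. a p * a q * Re (\<Sum>m\<in>weights ?l. cnj (D ?l m s q) * D ?l m s p))"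
        by (simp only: Re_sum sum_distrib_left)
      also have "\<dots> = (\<Sum>p\<in>P. \<Sum>q\<in>P. a p * a q * Re (D ?l s s (transpose q ** p)))"
        using P by (intro sum.cong refl arg_cong2[where f="(*)"] arg_cong[where f=Re] D_inner s_weights) auto
      finally show ?thesis .
    qed
    have "centered_gaussian M (\<lambda>\<omega>. \<Sum>l\<in>lev ` {..<N}. \<Sum>m\<in>weights l. Re (of_real (c l) * B l m * \<gamma> l m \<omega>))
      (\<Sum>l\<in>lev ` {..<N}. \<Sum>m\<in>weights l. (cmod (of_real (c l) * B l m))\<^sup>2 / 2)"
      by (rule centered_gaussian_combination) auto
    moreover have "inj_on lev {..<N}" by (auto simp: inj_on_def)
    ultimately have "centered_gaussian M (\<lambda>\<omega>. \<Sum>j<N. \<Sum>m\<in>weights (lev j). Re (of_real (c (lev j)) * B (lev j) m * \<gamma> (lev j) m \<omega>))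
      (\<Sum>j<N. \<Sum>m\<in>weights (lev j). (cmod (of_real (c (lev j)) * B (lev j) m))\<^sup>2 / 2)"
      by (simp only: sum.reindex o_def)
    moreover have "(\<Sum>m\<in>weights (lev j). Re (of_real (c (lev j)) * B (lev j) m * \<gamma> (lev j) m \<omega>))
        = (\<Sum>p\<in>P. a p * Re (of_real (c (lev j)) * Z (lev j) p \<omega>))" for j \<omega>
    proof -
      have "(\<Sum>m\<in>weights (lev j). of_real (c (lev j)) * B (lev j) m * \<gamma> (lev j) m \<omega>)
        = (\<Sum>m\<in>weights (lev j). \<Sum>p\<in>P. of_real (a p) * (of_real (c (lev j)) * (\<gamma> (lev j) m \<omega> * D (lev j) m s p)))"
        by (simp add: B_def sum_distrib_left sum_distrib_right mult_ac)
      also have "\<dots> = (\<Sum>p\<in>P. \<Sum>m\<in>weights (lev j). of_real (a p) * (of_real (c (lev j)) * (\<gamma> (lev j) m \<omega> * D (lev j) m s p)))"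
        by (rule sum.swap)
      also have "\<dots> = (\<Sum>p\<in>P. of_real (a p) * (of_real (c (lev j)) * Z (lev j) p \<omega>))"
        by (simp only: Z_def sum_distrib_left)
      finally have "Re (\<Sum>m\<in>weights (lev j). of_real (c (lev j)) * B (lev j) m * \<gamma> (lev j) m \<omega>)
        = Re (\<Sum>p\<in>P. of_real (a p) * (of_real (c (lev j)) * Z (lev j) p \<omega>))" by (simp only:)
      then show ?thesis by (simp only: Re_sum Re_scale)
    qed
    moreover have "(\<Sum>j<N. \<Sum>p\<in>P. a p * Re (of_real (c (lev j)) * Z (lev j) p \<omega>)) = ?Y N \<omega>" for \<omega>
      unfolding sum_distrib_left by (rule sum.swap)
    moreover have "(\<Sum>j<N. \<Sum>m\<in>weights (lev j). (cmod (of_real (c (lev j)) * B (lev j) m))\<^sup>2 / 2)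
       = (\<Sum>p\<in>P. \<Sum>q\<in>P. a p * a q * (\<Sum>j<N. ?t j p q))"
    proof -
      have "(\<Sum>m\<in>weights (lev j). (cmod (of_real (c (lev j)) * B (lev j) m))\<^sup>2 / 2)
        = (c (lev j))\<^sup>2 / 2 * (\<Sum>m\<in>weights (lev j). (cmod (B (lev j) m))\<^sup>2)" for j
        by (simp add: sum_distrib_left norm_mult power_mult_distrib)
      also have "\<And>j. (c (lev j))\<^sup>2 / 2 * (\<Sum>m\<in>weights (lev j). (cmod (B (lev j) m))\<^sup>2)
         = (\<Sum>p\<in>P. \<Sum>q\<in>P. a p * a q * ?t j p q)"
        unfolding Bsq sum_distrib_left by (intro sum.cong refl) (simp add: mult_ac)
      finally have "(\<Sum>j<N. \<Sum>m\<in>weights (lev j). (cmod (of_real (c (lev j)) * B (lev j) m))\<^sup>2 / 2)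
        = (\<Sum>j<N. \<Sum>p\<in>P. \<Sum>q\<in>P. a p * a q * ?t j p q)" by (simp only:)
      also have "\<dots> = (\<Sum>p\<in>P. \<Sum>q\<in>P. \<Sum>j<N. a p * a q * ?t j p q)"
        by (subst sum.swap) (intro sum.cong refl sum.swap)
      finally show ?thesis by (simp only: sum_distrib_left)
    qed
    ultimately show ?thesis by (simp only:)
  qed
  show "(\<lambda>N. \<Sum>p\<in>P. \<Sum>q\<in>P. a p * a q * (\<Sum>j<N. ?t j p q)) \<longlonglongrightarrow> (\<Sum>p\<in>P. \<Sum>q\<in>P. a p * a q * covK p q)"
    unfolding covK_def using P
    by (intro tendsto_sum tendsto_mult tendsto_const summable_LIMSEQ summable_covK) auto
  have "AE \<omega> in M. \<forall>p\<in>P. (\<lambda>N. \<Sum>j<N. Re (of_real (c (lev j)) * Z (lev j) p \<omega>)) \<longlonglongrightarrow> f \<omega> p"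
    using P AE_field_limit by (intro AE_finite_allI) auto
  then show "AE \<omega> in M. (\<lambda>N. ?Y N \<omega>) \<longlonglongrightarrow> (\<Sum>p\<in>P. a p * f \<omega> p)"
    by eventually_elim (intro tendsto_sum tendsto_mult tendsto_const, blast)
  show "(\<lambda>\<omega>. \<Sum>p\<in>P. a p * f \<omega> p) \<in> borel_measurable M" by measurable
qed

lemma variance_field:
  assumes "p \<in> SO3"
  shows "(LINT \<omega>|M. (f \<omega> p)\<^sup>2) = kr 0 / 2"
  using centered_gaussian_square(2)[OF centered_gaussian_field[of "{p}" "\<lambda>_. 1"]] assms
  by (simp add: covK_same_eq)

lemma centered_gaussian_increment:
  assumes p: "p \<in> SO3" and q: "q \<in> SO3" and k0: "kr 0 = 2"
  shows "centered_gaussian M (\<lambda>\<omega>. (f \<omega> q - f \<omega> p) * b) (b\<^sup>2 * (2 - 2 * covK q p))"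
\<comment> \<open>For equal points the set {p, q} is a singleton, and the two opposite coefficients
  cannot be told apart by a function on it.\<close>
proof (cases "p = q")
  case True
  then show ?thesis
    using covK_same_eq[OF q] k0 centered_gaussian_field[of "{}" "\<lambda>_. 0"] by simp
next
  case False
  have e: "covK p p = 1" "covK q q = 1" "covK p q = covK q p"
    using covK_same_eq[OF q] covK_same_eq[OF p] covK_commute[OF p q] k0 by auto
  have "centered_gaussian M (\<lambda>\<omega>. \<Sum>x\<in>{p, q}. (if x = p then - b else b) * f \<omega> x)
     (\<Sum>x\<in>{p, q}. \<Sum>y\<in>{p, q}. (if x = p then - b else b) * (if y = p then - b else b) * covK x y)"
    using p q by (intro centered_gaussian_field) auto
  then show ?thesis using False by (simp add: e power2_eq_square algebra_simps)
qed

lemma differential_gaussian: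
  assumes sm: "AE \<omega> in M. smooth_on_subset SO3 (f \<omega>)" and k0: "kr 0 = 2" and p: "p \<in> SO3"
  shows "centered_gaussian (completion M) (\<lambda>\<omega>. diff_SO3 (f \<omega>) p (p ** hat w)) (berger (\<kappa> / 2) ((of_int s)\<^sup>2) w w)"
proof -
  have "p ** hat w \<in> tangent_SO3 p" unfolding tangent_SO3_eq[OF p] by blast
  then obtain C where C: "\<And>t. C t \<in> SO3" "C 0 = p" "(C has_vector_derivative p ** hat w) (at 0)"
    unfolding tangent_SO3_def by blast
  define h where "h n = inverse (real (Suc n))" for n
  have h: "h \<longlonglongrightarrow> 0" "\<And>n. h n \<noteq> 0"
    unfolding h_def[abs_def] by (rule LIMSEQ_inverse_real_of_nat) simp
  let ?\<Delta> = "\<lambda>n \<omega>. (f \<omega> (C (h n)) - f \<omega> p) * inverse (h n)"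
  have lim: "AE \<omega> in M. (\<lambda>n. ?\<Delta> n \<omega>) \<longlonglongrightarrow> diff_SO3 (f \<omega>) p (p ** hat w)"
    using sm
  proof eventually_elim
    case (elim \<omega>)
    from has_vector_derivative_sequence[OF diff_SO3_curve(1)[OF elim C] h]
    show ?case by (simp add: C(2) mult.commute)
  qed
  interpret cM: prob_space "completion M" by (rule prob_space_completion)
  have meas: "(\<lambda>\<omega>. diff_SO3 (f \<omega>) p (p ** hat w)) \<in> borel_measurable (completion M)"
  proof (rule AE_cong_borel_completion)
    show "(\<lambda>\<omega>. lim (\<lambda>n. ?\<Delta> n \<omega>)) \<in> borel_measurable (completion M)"
      by (intro borel_measurable_lim_metric measurable_completion) measurable
    show "AE \<omega> in M. lim (\<lambda>n. ?\<Delta> n \<omega>) = diff_SO3 (f \<omega>) p (p ** hat w)"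
      using lim by eventually_elim (rule limI)
  qed
  show ?thesis
  proof (rule cM.centered_gaussian_limit)
    show "centered_gaussian (completion M) (?\<Delta> n) ((inverse (h n))\<^sup>2 * (2 - 2 * covK (C (h n)) p))" for n
      using centered_gaussian_increment[OF p C(1) k0, of "h n" "inverse (h n)"]
      by (simp add: centered_gaussian_def distr_completion measurable_completion)
    have "(\<lambda>n. (C (h n) - p) /\<^sub>R h n) \<longlonglongrightarrow> p ** hat w"
      using has_vector_derivative_sequence[OF C(3) h] by (simp add: C(2))
    note l = covK_expansion[OF p C(1) h this k0]
    have "(inverse a)\<^sup>2 * x = x / a\<^sup>2" for a x :: real
      by (cases "a = 0") (simp_all add: field_simps)
    then show "(\<lambda>n. (inverse (h n))\<^sup>2 * (2 - 2 * covK (C (h n)) p)) \<longlonglongrightarrow> berger (\<kappa> / 2) ((of_int s)\<^sup>2) w w"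
      using l by (simp only:)
    show "AE \<omega> in completion M. (\<lambda>n. ?\<Delta> n \<omega>) \<longlonglongrightarrow> diff_SO3 (f \<omega>) p (p ** hat w)"
      by (rule AE_completion[OF lim])
  qed (rule meas)
qed

theorem left_berger_adler_taylor:
  assumes sm: "AE \<omega> in M. smooth_on_subset SO3 (f \<omega>)" and k0: "kr 0 = 2"
  shows "left_berger (adler_taylor_metric M f) (\<kappa> / 2) ((of_int s)\<^sup>2)"
  unfolding left_berger_def
proof (intro ballI allI)
  fix p u v assume p: "p \<in> SO3"
  let ?b = "berger (\<kappa> / 2) ((of_int s)\<^sup>2)"
  let ?X = "\<lambda>w \<omega>. diff_SO3 (f \<omega>) p (p ** hat w)"
  interpret cM: prob_space "completion M" by (rule prob_space_completion)
  note g = differential_gaussian[OF sm k0 p]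
  have [measurable]: "?X w \<in> borel_measurable (completion M)" for w
    using g by (simp add: centered_gaussian_def)
  have sq: "integrable (completion M) (\<lambda>\<omega>. (?X w \<omega>)\<^sup>2)" "(LINT \<omega>|completion M. (?X w \<omega>)\<^sup>2) = ?b w w" for w
    using cM.centered_gaussian_square[OF g] by auto
  \<comment> \<open>Any curve through p serves here: it only instantiates
    \<open>diff_SO3_curve\<close> for the linearity of the differential.\<close>
  have "p ** hat 0 \<in> tangent_SO3 p" unfolding tangent_SO3_eq[OF p] by blast
  then obtain C where C: "\<And>t. C t \<in> SO3" "C 0 = p" "(C has_vector_derivative p ** hat 0) (at 0)"
    unfolding tangent_SO3_def by blast
  \<comment> \<open>Polarization: \<open>differential_gaussian\<close> provides second moments in
    single directions, and the almost sure linearity of the differential reduces the mixed moment to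
    them.\<close>
  have "AE \<omega> in completion M. ?X u \<omega> * ?X v \<omega> = ((?X (u + v) \<omega>)\<^sup>2 - (?X u \<omega>)\<^sup>2 - (?X v \<omega>)\<^sup>2) / 2"
    using AE_completion[OF sm]
  proof eventually_elim
    case (elim \<omega>)
    have "?X (u + v) \<omega> = ?X u \<omega> + ?X v \<omega>"
      using linear_add[OF diff_SO3_curve(2)[OF elim C]] by (simp add: hat_lin mm.add_right)
    then show ?case by (simp add: power2_sum)
  qed
  then have "(LINT \<omega>|completion M. ?X u \<omega> * ?X v \<omega>)
    = (LINT \<omega>|completion M. ((?X (u + v) \<omega>)\<^sup>2 - (?X u \<omega>)\<^sup>2 - (?X v \<omega>)\<^sup>2) / 2)"
    by (intro integral_cong_AE) measurable
  also have "\<dots> = (?b (u + v) (u + v) - ?b u u - ?b v v) / 2"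
    by (simp add: sq)
  also have "\<dots> = ?b u v"
    by (simp add: berger_def algebra_simps)
  finally show "adler_taylor_metric M f p (p ** hat u) (p ** hat v) = ?b u v"
    by (simp add: adler_taylor_metric_def)
qed

end

theorem theorem1p3:
  fixes M :: "'w measure"
    and D :: "nat \<Rightarrow> int \<Rightarrow> int \<Rightarrow> real^3^3 \<Rightarrow> complex"
    and c :: "nat \<Rightarrow> real"
    and \<gamma> :: "nat \<Rightarrow> int \<Rightarrow> 'w \<Rightarrow> complex"
    and s :: int
    and f :: "'w \<Rightarrow> real^3^3 \<Rightarrow> real"
    and \<xi> :: real
  assumes "prob_space M"
    and "wigner_matrices D"
    and "s \<noteq> 0"
    and "\<And>l. int l \<ge> \<bar>s\<bar> \<Longrightarrow> c l > 0"
    and "iid_complex_gaussians M s \<gamma>"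
    and "f = (\<lambda>\<omega> p. Re (spin_field D c \<gamma> s \<omega> p))"
    and "converges_Cinf (\<lambda>N \<theta>. \<Sum>j<N. shifted s (circ_cov_term D c s \<theta>) j) (circ_cov D c s)"
    and "AE \<omega> in M. smooth_on_subset SO3 (f \<omega>)"
    and "\<And>p. p \<in> SO3 \<Longrightarrow> (LINT \<omega>|M. \<bar>f \<omega> p\<bar>\<^sup>2) = 1"
    and "\<xi>\<^sup>2 = suminf (shifted s (\<lambda>l. (c l)\<^sup>2 / 2 * ((real l * (real l + 1) - (of_int s)\<^sup>2) / 2)))"
  shows "shifted s (\<lambda>l. (c l)\<^sup>2 / 2) sums 1 \<and>
         circ_cov D c s 0 / 2 = 1 \<and>
         shifted s (\<lambda>l. (c l)\<^sup>2 / 2 * ((real l * (real l + 1) - (of_int s)\<^sup>2) / 2)) sums \<xi>\<^sup>2 \<and>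
         - (vderiv ^^ 2) (circ_cov D c s) 0 / 2 = of_real (\<xi>\<^sup>2) \<and>
         smooth_gaussian_field_SO3 M f \<and>
         (\<forall>x\<in>euler_domain. gram (adler_taylor_metric M f) euler x = Sigma_mat \<xi> (of_int s) (x$2)) \<and>
         (\<forall>x\<in>euler_domain. gram standard_metric euler x = Sigma_mat 1 1 (x$2)) \<and>
         (\<forall>p\<in>SO3. eigenvalues_wrt (adler_taylor_metric M f) standard_metric p
           (\<xi>\<^sup>2) (\<xi>\<^sup>2) ((of_int s)\<^sup>2)) \<and>
         (\<forall>p\<in>SO3. scalar_curvature_at (adler_taylor_metric M f) p
           (2 / \<xi>\<^sup>2 - (of_int s)\<^sup>2 / (2 * \<xi> ^ 4)))"
proof -
  interpret prob_space M by (rule assms(1))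
  interpret spin_random D c s M \<gamma> f
    by unfold_locales (use assms in auto)
  \<comment> \<open>The variance is k(0)/2 at every point, so the normalization at the identity
    fixes k(0).\<close>
  have k0: "kr 0 = 2"
    using assms(9)[OF SO3_mat_1] variance_field[OF SO3_mat_1] by simp
  have k0': "circ_cov D c s 0 = 2"
    using circ_cov_0(2) k0 by (simp add: kr_def)
  have sums1: "shifted s (\<lambda>l. (c l)\<^sup>2 / 2) sums 1"
    using sums_divide[OF circ_cov_0(1), of 2] k0 by (simp add: shifted_def[abs_def] kr_def)
  have sums2: "shifted s (\<lambda>l. (c l)\<^sup>2 / 2 * ((real l * (real l + 1) - (of_int s)\<^sup>2) / 2)) sums (\<kappa> / 2)"
    using sums_divide[OF circ_cov_2(1), of 2] by (simp add: shifted_def[abs_def])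
  have \<xi>: "\<kappa> / 2 = \<xi>\<^sup>2"
    using sums_unique[OF sums2] assms(10) by simp
  have pos: "\<xi>\<^sup>2 > 0" "(real_of_int s)\<^sup>2 > 0"
    using \<kappa>_pos assms(3) by (simp_all flip: \<xi>)
  have at: "left_berger (adler_taylor_metric M f) (\<xi>\<^sup>2) ((of_int s)\<^sup>2)"
    using left_berger_adler_taylor[OF assms(8) k0] unfolding \<xi> .
  have k2: "- (vderiv ^^ 2) (circ_cov D c s) 0 / 2 = of_real (\<xi>\<^sup>2)"
    unfolding circ_cov_2(2) \<xi>[symmetric] by simp
  have gauss: "smooth_gaussian_field_SO3 M f"
    unfolding smooth_gaussian_field_SO3_def
    using assms(8) centered_gaussian_imp_gaussian_rv[OF centered_gaussian_field] by blast
  have scal: "scalar_curvature_at (adler_taylor_metric M f) p (2 / \<xi>\<^sup>2 - (of_int s)\<^sup>2 / (2 * \<xi> ^ 4))" for p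
    using scalar_curvature_left_berger[OF at pos, of p] by (simp flip: power_mult)
  have gram1: "gram standard_metric euler x = Sigma_mat 1 1 (x$2)" for x
    using gram_euler[of standard_metric 1 1 x] left_berger_standard by simp
  show ?thesis
    using sums1 sums2[unfolded \<xi>] k0' k2 gauss gram_euler[OF at] gram1 eigenvalues_left_berger[OF at] scal
    by (intro conjI ballI) simp_all
qed

end
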